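(* Let $\mathbb{F}_n$, $2\le n\le\infty$, denote the free group on $n$ generators, let $a$ be one of these generators, let $\mathcal{M}=VN(\mathbb{F}_n)$, and let $\mathcal{A}\subseteq\mathcal{M}$ be the von Neumann subalgebra (masa) generated by $a$. Then $\mathcal{A}$ is a strongly singular masa in $\mathcal{M}$ and $\delta(\mathcal{A})=1$.
   Context: For a discrete group $\Gamma$, $VN(\Gamma)$ is the von Neumann algebra generated by the left regular representation of $\Gamma$ on $\ell^2(\Gamma)$; group elements are regarded as unitaries in $VN(\Gamma)$. The case $n=\infty$ means countably infinitely many generators. Let $\mathcal{M}$ be a type $II_1$ factor with normalized trace $\mathrm{tr}$; $\|\cdot\|$ is the operator norm and $\|x\|_2=(\mathrm{tr}(x^*x))^{1/2}$. For a von Neumann subalgebra $\mathcal{N}\subseteq\mathcal{M}$ (containing the identity of $\mathcal M$), $\mathbb{E}_{\mathcal{N}}:\mathcal{M}\to\mathcal{N}$ is the unique trace preserving conditional expectation. For a linear map $\phi:\mathcal{M}\to\mathcal{M}$, $\|\phi\|_{\infty,2}=\sup\{\|\phi(x)\|_2: x\in\mathcal{M},\ \|x\|\le 1\}$. A masa is a maximal abelian self-adjoint subalgebra. A masa $\mathcal{A}\subseteq\mathcal{M}$ is strongly singular if $\|\mathbb{E}_{u\mathcal{A}u^*}-\mathbb{E}_{\mathcal{A}}\|_{\infty,2}\ge\|u-\mathbb{E}_{\mathcal{A}}(u)\|_2$ for all unitaries $u\in\mathcal{M}$. Popa invariant: for a masa $\mathcal{A}\subseteq\mathcal{M}$ and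 a non-zero partial isometry $v\in\mathcal{M}$ such that $vv^*$ and $v^*v$ are orthogonal projections in $\mathcal{A}$, put $\delta(v\mathcal{A}v^*,\mathcal{A})=\sup\{\|x-\mathbb{E}_{\mathcal{A}}(x)\|_2: x\in v\mathcal{A}v^*,\ \|x\|\le1\}$. Then $\delta(\mathcal{A})$ is the largest $\lambda$ for which $\delta(v\mathcal{A}v^*,\mathcal{A})\ge\lambda\|v^*v\|_2$ holds for all such $v$. *)

theory Defs
  imports "HOL-Analysis.Analysis" "HOL-Library.FuncSet"
begin

section \<open>Complex Hilbert spaces and bounded operators\<close>

class scaleC =
  fixes scaleC :: "complex \<Rightarrow> 'a \<Rightarrow> 'a" (infixr "*\<^sub>C" 75)

text \<open>The inner product \<open>cinner\<close> is linear in its first argument; its real part is the inner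
  product of the underlying real Hilbert space.\<close>

class complex_hilbert = real_inner + complete_space + scaleC +
  fixes cinner :: "'a \<Rightarrow> 'a \<Rightarrow> complex"
  assumes scaleC_add_right: "c *\<^sub>C (x + y) = c *\<^sub>C x + c *\<^sub>C y"
    and scaleC_add_left: "(c + d) *\<^sub>C x = c *\<^sub>C x + d *\<^sub>C x"
    and scaleC_scaleC: "c *\<^sub>C d *\<^sub>C x = (c * d) *\<^sub>C x"
    and scaleC_of_real: "complex_of_real r *\<^sub>C x = r *\<^sub>R x"
    and cinner_commute: "cinner x y = cnj (cinner y x)"
    and cinner_add_left: "cinner (x + y) z = cinner x z + cinner y z"
    and cinner_scaleC_left: "cinner (c *\<^sub>C x) y = c * cinner x y"
    and Re_cinner: "Re (cinner x y) = inner x y"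

lemma norm_scaleC: "norm (c *\<^sub>C x) = cmod c * norm (x :: 'h::complex_hilbert)"
proof -
  have "inner (c *\<^sub>C x) (c *\<^sub>C x) = Re (c * cnj (c * cinner x x))"
    by (metis Re_cinner cinner_commute cinner_scaleC_left)
  also have "c * cnj (c * cinner x x) = of_real ((cmod c)\<^sup>2) * cinner x x"
    unfolding complex_cnj_mult complex_norm_square
    by (simp only: cinner_commute[of x x, symmetric] mult.assoc)
  finally show ?thesis
    by (simp add: norm_eq_sqrt_inner Re_cinner real_sqrt_mult)
qed

lemma bounded_linear_scaleC: "bounded_linear (\<lambda>x :: 'h::complex_hilbert. c *\<^sub>C x)"
proof (rule bounded_linear_intro)
  show "c *\<^sub>C (r *\<^sub>R x) = r *\<^sub>R (c *\<^sub>C x)" for r and x :: 'h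
    by (metis scaleC_of_real scaleC_scaleC mult.commute)
  show "norm (c *\<^sub>C x) \<le> norm x * cmod c" for x :: 'h
    by (simp add: norm_scaleC)
qed (rule scaleC_add_right)

instantiation blinfun :: (real_normed_vector, complex_hilbert) scaleC
begin

lift_definition scaleC_blinfun :: "complex \<Rightarrow> 'a \<Rightarrow>\<^sub>L 'b \<Rightarrow> 'a \<Rightarrow>\<^sub>L 'b"
  is "\<lambda>c T x. c *\<^sub>C T x"
  by (rule bounded_linear_compose[OF bounded_linear_scaleC])

instance ..

end

text \<open>\<open>B(H)\<close>: the library type \<open>'h \<Rightarrow>\<^sub>L 'h\<close> consists of the bounded real-linear operators.\<close>

definition bounded_ops :: "('h::complex_hilbert \<Rightarrow>\<^sub>L 'h) set" where
  "bounded_ops = {T :: 'h \<Rightarrow>\<^sub>L 'h. \<forall>c x. T (c *\<^sub>C x) = c *\<^sub>C T x}"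

definition adj :: "('h::complex_hilbert \<Rightarrow>\<^sub>L 'h) \<Rightarrow> ('h \<Rightarrow>\<^sub>L 'h)" where
  "adj T = (THE S. S \<in> bounded_ops \<and> (\<forall>x y. cinner (T x) y = cinner x (S y)))"

definition positive_op :: "('h::complex_hilbert \<Rightarrow>\<^sub>L 'h) \<Rightarrow> bool" where
  "positive_op T \<longleftrightarrow> T \<in> bounded_ops \<and> (\<forall>x. cinner (T x) x \<in> \<real>\<^sub>\<ge>\<^sub>0)"

definition is_projection :: "('h::complex_hilbert \<Rightarrow>\<^sub>L 'h) \<Rightarrow> bool" where
  "is_projection p \<longleftrightarrow> p \<in> bounded_ops \<and> p o\<^sub>L p = p \<and> adj p = p"

definition is_unitary :: "('h::complex_hilbert \<Rightarrow>\<^sub>L 'h) \<Rightarrow> bool" where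
  "is_unitary u \<longleftrightarrow> u \<in> bounded_ops \<and> adj u o\<^sub>L u = id_blinfun \<and> u o\<^sub>L adj u = id_blinfun"

definition partial_isometry :: "('h::complex_hilbert \<Rightarrow>\<^sub>L 'h) \<Rightarrow> bool" where
  "partial_isometry v \<longleftrightarrow> v \<in> bounded_ops \<and> is_projection (adj v o\<^sub>L v)"

text \<open>The set \<open>v A v\<^sup>*\<close>.\<close>

definition conjugate ::
  "('h::complex_hilbert \<Rightarrow>\<^sub>L 'h) \<Rightarrow> ('h \<Rightarrow>\<^sub>L 'h) set \<Rightarrow> ('h \<Rightarrow>\<^sub>L 'h) set" where
  "conjugate v A = (\<lambda>x. v o\<^sub>L x o\<^sub>L adj v) ` A"


section \<open>Von Neumann algebras\<close>

definition commutant :: "('h::complex_hilbert \<Rightarrow>\<^sub>L 'h) set \<Rightarrow> ('h \<Rightarrow>\<^sub>L 'h) set" where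
  "commutant S = {T \<in> bounded_ops. \<forall>s\<in>S. T o\<^sub>L s = s o\<^sub>L T}"

text \<open>Self-adjoint sets of operators equal to their double commutant; these are automatically unital
  subalgebras of \<open>B(H)\<close>.\<close>

definition von_neumann_algebra :: "('h::complex_hilbert \<Rightarrow>\<^sub>L 'h) set \<Rightarrow> bool" where
  "von_neumann_algebra M \<longleftrightarrow> (\<forall>x\<in>M. adj x \<in> M) \<and> commutant (commutant M) = M"

definition generated_vna :: "('h::complex_hilbert \<Rightarrow>\<^sub>L 'h) set \<Rightarrow> ('h \<Rightarrow>\<^sub>L 'h) set" where
  "generated_vna S = \<Inter>{N. von_neumann_algebra N \<and> S \<subseteq> N}"

definition star_subalgebra :: "('h::complex_hilbert \<Rightarrow>\<^sub>L 'h) set \<Rightarrow> bool" where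
  "star_subalgebra A \<longleftrightarrow> A \<subseteq> bounded_ops \<and> 0 \<in> A \<and>
     (\<forall>x\<in>A. \<forall>y\<in>A. x + y \<in> A) \<and> (\<forall>c. \<forall>x\<in>A. c *\<^sub>C x \<in> A) \<and>
     (\<forall>x\<in>A. \<forall>y\<in>A. x o\<^sub>L y \<in> A) \<and> (\<forall>x\<in>A. adj x \<in> A)"

definition abelian :: "('h::complex_hilbert \<Rightarrow>\<^sub>L 'h) set \<Rightarrow> bool" where
  "abelian A \<longleftrightarrow> (\<forall>x\<in>A. \<forall>y\<in>A. x o\<^sub>L y = y o\<^sub>L x)"

definition masa :: "('h::complex_hilbert \<Rightarrow>\<^sub>L 'h) set \<Rightarrow> ('h \<Rightarrow>\<^sub>L 'h) set \<Rightarrow> bool" where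
  "masa M A \<longleftrightarrow> A \<subseteq> M \<and> star_subalgebra A \<and> abelian A \<and>
     (\<forall>B. B \<subseteq> M \<and> star_subalgebra B \<and> abelian B \<and> A \<subseteq> B \<longrightarrow> B = A)"


section \<open>Finite von Neumann algebras\<close>

text \<open>In this section \<open>tr\<close> is the normalized trace of \<open>M\<close>.\<close>

definition norm2 :: "(('h::complex_hilbert \<Rightarrow>\<^sub>L 'h) \<Rightarrow> complex) \<Rightarrow> ('h \<Rightarrow>\<^sub>L 'h) \<Rightarrow> real" where
  "norm2 tr x = sqrt (Re (tr (adj x o\<^sub>L x)))"

definition is_trace_preserving_cond_exp ::
  "(('h::complex_hilbert \<Rightarrow>\<^sub>L 'h) \<Rightarrow> complex) \<Rightarrow> ('h \<Rightarrow>\<^sub>L 'h) set \<Rightarrow> ('h \<Rightarrow>\<^sub>L 'h) set \<Rightarrow>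
    (('h \<Rightarrow>\<^sub>L 'h) \<Rightarrow> ('h \<Rightarrow>\<^sub>L 'h)) \<Rightarrow> bool" where
  "is_trace_preserving_cond_exp tr M N E \<longleftrightarrow>
     (\<forall>x\<in>M. E x \<in> N) \<and>
     (\<forall>x\<in>M. \<forall>y\<in>M. E (x + y) = E x + E y) \<and>
     (\<forall>c. \<forall>x\<in>M. E (c *\<^sub>C x) = c *\<^sub>C E x) \<and>
     (\<forall>x\<in>N. E x = x) \<and>
     (\<forall>x\<in>M. \<forall>p\<in>N. \<forall>q\<in>N. E (p o\<^sub>L x o\<^sub>L q) = p o\<^sub>L E x o\<^sub>L q) \<and>
     (\<forall>x\<in>M. positive_op x \<longrightarrow> positive_op (E x)) \<and>
     (\<forall>x\<in>M. tr (E x) = tr x)"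

text \<open>Membership in \<open>extensional M\<close> only fixes the irrelevant values outside \<open>M\<close>, so that the
  conditional expectation is unique as a function on the whole type.\<close>

definition cond_exp ::
  "(('h::complex_hilbert \<Rightarrow>\<^sub>L 'h) \<Rightarrow> complex) \<Rightarrow> ('h \<Rightarrow>\<^sub>L 'h) set \<Rightarrow> ('h \<Rightarrow>\<^sub>L 'h) set \<Rightarrow>
    ('h \<Rightarrow>\<^sub>L 'h) \<Rightarrow> ('h \<Rightarrow>\<^sub>L 'h)" where
  "cond_exp tr M N = (THE E. E \<in> extensional M \<and> is_trace_preserving_cond_exp tr M N E)"

text \<open>The norm \<open>\<parallel>\<phi>\<parallel>\<^sub>\<infinity>\<^sub>,\<^sub>2\<close>. The supremum is taken in the reals; it is bounded for the maps used
  below, since conditional expectations are contractive for \<open>norm2\<close>. The same holds for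
  \<open>delta_dist\<close>.\<close>

definition norm_inf2 ::
  "(('h::complex_hilbert \<Rightarrow>\<^sub>L 'h) \<Rightarrow> complex) \<Rightarrow> ('h \<Rightarrow>\<^sub>L 'h) set \<Rightarrow>
    (('h \<Rightarrow>\<^sub>L 'h) \<Rightarrow> ('h \<Rightarrow>\<^sub>L 'h)) \<Rightarrow> real" where
  "norm_inf2 tr M \<phi> = (SUP x\<in>{x \<in> M. norm x \<le> 1}. norm2 tr (\<phi> x))"

definition strongly_singular_masa ::
  "(('h::complex_hilbert \<Rightarrow>\<^sub>L 'h) \<Rightarrow> complex) \<Rightarrow> ('h \<Rightarrow>\<^sub>L 'h) set \<Rightarrow> ('h \<Rightarrow>\<^sub>L 'h) set \<Rightarrow> bool" where
  "strongly_singular_masa tr M A \<longleftrightarrow> masa M A \<and>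
     (\<forall>u\<in>M. is_unitary u \<longrightarrow>
        norm_inf2 tr M (\<lambda>x. cond_exp tr M (conjugate u A) x - cond_exp tr M A x)
          \<ge> norm2 tr (u - cond_exp tr M A u))"

text \<open>\<open>delta_dist tr M B A\<close> is \<open>\<delta>(B, A)\<close>, used for \<open>B = v A v\<^sup>*\<close>.\<close>

definition delta_dist ::
  "(('h::complex_hilbert \<Rightarrow>\<^sub>L 'h) \<Rightarrow> complex) \<Rightarrow> ('h \<Rightarrow>\<^sub>L 'h) set \<Rightarrow> ('h \<Rightarrow>\<^sub>L 'h) set \<Rightarrow>
    ('h \<Rightarrow>\<^sub>L 'h) set \<Rightarrow> real" where
  "delta_dist tr M B A = (SUP x\<in>{x \<in> B. norm x \<le> 1}. norm2 tr (x - cond_exp tr M A x))"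

definition popa_admissible ::
  "('h::complex_hilbert \<Rightarrow>\<^sub>L 'h) set \<Rightarrow> ('h \<Rightarrow>\<^sub>L 'h) set \<Rightarrow> ('h \<Rightarrow>\<^sub>L 'h) \<Rightarrow> bool" where
  "popa_admissible M A v \<longleftrightarrow> v \<in> M \<and> v \<noteq> 0 \<and> partial_isometry v \<and>
     v o\<^sub>L adj v \<in> A \<and> adj v o\<^sub>L v \<in> A \<and> (v o\<^sub>L adj v) o\<^sub>L (adj v o\<^sub>L v) = 0"

text \<open>\<open>\<delta>(A)\<close> is the largest constant with the stated property, so the value of \<open>popa_delta\<close> is
  meaningful only if some \<open>v\<close> is admissible, as is the case for masas in type \<open>II\<^sub>1\<close> factors.\<close>

definition popa_delta ::
  "(('h::complex_hilbert \<Rightarrow>\<^sub>L 'h) \<Rightarrow> complex) \<Rightarrow> ('h \<Rightarrow>\<^sub>L 'h) set \<Rightarrow> ('h \<Rightarrow>\<^sub>L 'h) set \<Rightarrow> real" where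
  "popa_delta tr M A = (GREATEST r. \<forall>v. popa_admissible M A v \<longrightarrow>
     delta_dist tr M (conjugate v A) A \<ge> r * norm2 tr (adj v o\<^sub>L v))"


section \<open>The Hilbert space of square-summable functions\<close>

definition square_summable :: "('a \<Rightarrow> complex) \<Rightarrow> bool" where
  "square_summable f \<longleftrightarrow> (\<lambda>x. (cmod (f x))\<^sup>2) summable_on UNIV"

lemma square_summable_mult:
  assumes "square_summable f" "square_summable g"
  shows "(\<lambda>x. f x * cnj (g x)) summable_on UNIV"
proof -
  have sq: "norm (a * a) = (cmod a)\<^sup>2" for a
    by (simp add: norm_mult power2_eq_square)
  have "(\<lambda>x. norm (f x * cnj (g x))) summable_on UNIV"
    by (rule abs_summable_product)
      (use assms in \<open>simp_all only: sq square_summable_def complex_mod_cnj\<close>)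
  then show ?thesis by (rule abs_summable_summable)
qed

lemma Re_infsum_mult_cnj:
  assumes "square_summable f"
  shows "Re (\<Sum>\<^sub>\<infinity>x. f x * cnj (f x)) = (\<Sum>\<^sub>\<infinity>x. (cmod (f x))\<^sup>2)"
proof -
  have "Re (f x * cnj (f x)) = (cmod (f x))\<^sup>2" for x
    by (simp only: complex_norm_square[symmetric] Re_complex_of_real)
  with infsum_Re[OF square_summable_mult[OF assms assms]] show ?thesis
    by (simp only:)
qed

lemma square_summable_add:
  assumes "square_summable f" "square_summable g"
  shows "square_summable (\<lambda>x. f x + g x)"
proof -
  have le: "(cmod (a + b))\<^sup>2 \<le> 2 * (cmod a)\<^sup>2 + 2 * (cmod b)\<^sup>2" for a b
  proof -
    have "(cmod (a + b))\<^sup>2 \<le> (cmod a + cmod b)\<^sup>2"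
      by (simp add: norm_triangle_ineq power_mono)
    also have "\<dots> \<le> 2 * (cmod a)\<^sup>2 + 2 * (cmod b)\<^sup>2"
      using sum_squares_bound[of "cmod a" "cmod b"] by (simp add: power2_sum)
    finally show ?thesis .
  qed
  have "(\<lambda>x. 2 * (cmod (f x))\<^sup>2 + 2 * (cmod (g x))\<^sup>2) summable_on UNIV"
    using assms unfolding square_summable_def
    by (intro summable_on_add summable_on_cmult_right)
  then show ?thesis
    unfolding square_summable_def
    by (rule summable_on_comparison_test) (simp_all only: le zero_le_power2)
qed

lemma square_summable_cmult:
  "square_summable f \<Longrightarrow> square_summable (\<lambda>x. c * f x)"
  unfolding square_summable_def norm_mult power_mult_distrib
  by (rule summable_on_cmult_right)

typedef 'a ell2 = "{f :: 'a \<Rightarrow> complex. square_summable f}"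
  morphisms ell2_apply Abs_ell2
  by (rule exI[of _ "\<lambda>_. 0"]) (simp add: square_summable_def)

setup_lifting type_definition_ell2

lemma square_summable_ell2 [simp]: "square_summable (ell2_apply f)"
  using ell2_apply by blast

instantiation ell2 :: (type) "{real_inner, scaleC}"
begin

lift_definition zero_ell2 :: "'a ell2" is "\<lambda>_. 0"
  by (simp add: square_summable_def)

lift_definition plus_ell2 :: "'a ell2 \<Rightarrow> 'a ell2 \<Rightarrow> 'a ell2" is "\<lambda>f g x. f x + g x"
  by (rule square_summable_add)

lift_definition uminus_ell2 :: "'a ell2 \<Rightarrow> 'a ell2" is "\<lambda>f x. - f x"
  by (simp add: square_summable_def)

lift_definition minus_ell2 :: "'a ell2 \<Rightarrow> 'a ell2 \<Rightarrow> 'a ell2" is "\<lambda>f g x. f x - g x"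
proof -
  fix f g :: "'a \<Rightarrow> complex"
  assume "square_summable f" "square_summable g"
  then show "square_summable (\<lambda>x. f x - g x)"
    using square_summable_add[of f "\<lambda>x. - g x"] by (simp add: square_summable_def)
qed

lift_definition scaleC_ell2 :: "complex \<Rightarrow> 'a ell2 \<Rightarrow> 'a ell2" is "\<lambda>c f x. c * f x"
  by (rule square_summable_cmult)

lift_definition scaleR_ell2 :: "real \<Rightarrow> 'a ell2 \<Rightarrow> 'a ell2" is "\<lambda>r f x. complex_of_real r * f x"
  by (rule square_summable_cmult)

definition inner_ell2 :: "'a ell2 \<Rightarrow> 'a ell2 \<Rightarrow> real" where
  "inner_ell2 f g = Re (\<Sum>\<^sub>\<infinity>x. ell2_apply f x * cnj (ell2_apply g x))"

definition norm_ell2 :: "'a ell2 \<Rightarrow> real" where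
  "norm_ell2 f = sqrt (inner f f)"

definition dist_ell2 :: "'a ell2 \<Rightarrow> 'a ell2 \<Rightarrow> real" where
  "dist_ell2 f g = norm (f - g)"

definition sgn_ell2 :: "'a ell2 \<Rightarrow> 'a ell2" where
  "sgn_ell2 f = inverse (norm f) *\<^sub>R f"

definition uniformity_ell2 :: "('a ell2 \<times> 'a ell2) filter" where
  "uniformity_ell2 = (INF e\<in>{0 <..}. principal {(x, y). dist x y < e})"

definition open_ell2 :: "'a ell2 set \<Rightarrow> bool" where
  "open_ell2 S = (\<forall>x\<in>S. \<forall>\<^sub>F (x', y) in uniformity. x' = x \<longrightarrow> y \<in> S)"

instance
proof
  fix f g h :: "'a ell2" and r s :: real
  show "f + g + h = f + (g + h)" by transfer (simp add: add.assoc)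
  show "f + g = g + f" by transfer (simp add: add.commute)
  show "0 + f = f" by transfer simp
  show "- f + f = 0" by transfer simp
  show "f - g = f + - g" by transfer simp
  show "r *\<^sub>R (f + g) = r *\<^sub>R f + r *\<^sub>R g" by transfer (simp add: algebra_simps)
  show "(r + s) *\<^sub>R f = r *\<^sub>R f + s *\<^sub>R f" by transfer (simp add: algebra_simps)
  show "r *\<^sub>R s *\<^sub>R f = (r * s) *\<^sub>R f" by transfer (simp add: mult.assoc)
  show "1 *\<^sub>R f = f" by transfer simp
  show "sgn f = inverse (norm f) *\<^sub>R f" by (rule sgn_ell2_def)
  show "dist f g = norm (f - g)" by (rule dist_ell2_def)
  show "(uniformity :: ('a ell2 \<times> 'a ell2) filter) =
      (INF e\<in>{0 <..}. principal {(x, y). dist x y < e})"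
    by (rule uniformity_ell2_def)
  show "open S \<longleftrightarrow> (\<forall>x\<in>S. \<forall>\<^sub>F (x', y) in uniformity. x' = x \<longrightarrow> y \<in> S)" for S :: "'a ell2 set"
    by (rule open_ell2_def)
  have "(\<Sum>\<^sub>\<infinity>x. ell2_apply f x * cnj (ell2_apply g x)) =
      cnj (\<Sum>\<^sub>\<infinity>x. ell2_apply g x * cnj (ell2_apply f x))"
    by (simp flip: infsum_cnj add: mult.commute)
  then show "inner f g = inner g f"
    by (simp add: inner_ell2_def)
  show "inner (f + g) h = inner f h + inner g h"
    by (simp add: inner_ell2_def plus_ell2.rep_eq distrib_right infsum_add square_summable_mult)
  show "inner (r *\<^sub>R f) g = r * inner f g"
    by (simp add: inner_ell2_def scaleR_ell2.rep_eq mult.assoc infsum_cmult_right')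
  have sq: "inner f f = (\<Sum>\<^sub>\<infinity>x. (cmod (ell2_apply f x))\<^sup>2)"
    by (simp only: inner_ell2_def Re_infsum_mult_cnj square_summable_ell2)
  then show "0 \<le> inner f f"
    by (simp add: infsum_nonneg)
  show "inner f f = 0 \<longleftrightarrow> f = 0"
  proof
    assume "inner f f = 0"
    then have "(cmod (ell2_apply f x))\<^sup>2 = 0" for x
      using nonneg_infsum_le_0D[of "\<lambda>x. (cmod (ell2_apply f x))\<^sup>2" UNIV x]
        square_summable_ell2[of f] by (simp add: sq square_summable_def)
    then show "f = 0"
      by transfer auto
  qed (simp add: inner_ell2_def zero_ell2.rep_eq)
  show "norm f = sqrt (inner f f)"
    by (rule norm_ell2_def)
qed

end

lemma norm_ell2_squared: "(norm f)\<^sup>2 = (\<Sum>\<^sub>\<infinity>x. (cmod (ell2_apply f x))\<^sup>2)"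
  by (simp only: power2_norm_eq_inner inner_ell2_def Re_infsum_mult_cnj square_summable_ell2)

lemma sum_le_norm_ell2_squared:
  "finite F \<Longrightarrow> (\<Sum>x\<in>F. (cmod (ell2_apply f x))\<^sup>2) \<le> (norm f)\<^sup>2"
  unfolding norm_ell2_squared
  by (rule finite_sum_le_infsum) (use square_summable_ell2[of f] in \<open>auto simp: square_summable_def\<close>)

lemma cmod_ell2_apply_le_norm: "cmod (ell2_apply f x) \<le> norm f"
  using sum_le_norm_ell2_squared[of "{x}" f] by (simp add: abs_le_square_iff[symmetric])

lemma ell2_from_finite_bounds:
  assumes "\<And>F. finite F \<Longrightarrow> (\<Sum>x\<in>F. (cmod (f x))\<^sup>2) \<le> B"
  shows "square_summable f" and "(norm (Abs_ell2 f))\<^sup>2 \<le> B"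
proof -
  show sq: "square_summable f"
    unfolding square_summable_def
    by (rule nonneg_bdd_above_summable_on) (auto intro!: bdd_aboveI2 assms)
  then show "(norm (Abs_ell2 f))\<^sup>2 \<le> B"
    unfolding norm_ell2_squared
    by (intro infsum_le_finite_sums)
      (auto simp: Abs_ell2_inverse assms simp flip: square_summable_def)
qed

instance ell2 :: (type) complete_space
proof
  fix X :: "nat \<Rightarrow> 'a ell2"
  assume X: "Cauchy X"
  have coord: "Cauchy (\<lambda>n. ell2_apply (X n) x)" for x
  proof (rule metric_CauchyI)
    fix e :: real assume "e > 0"
    from metric_CauchyD[OF X this] obtain N where
      N: "\<And>m n. m \<ge> N \<Longrightarrow> n \<ge> N \<Longrightarrow> dist (X m) (X n) < e"
      by blast
    have "dist (ell2_apply (X m) x) (ell2_apply (X n) x) \<le> dist (X m) (X n)" for m n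
      using cmod_ell2_apply_le_norm[of "X m - X n" x]
      by (simp add: dist_norm minus_ell2.rep_eq)
    from order_le_less_trans[OF this N]
    show "\<exists>N. \<forall>m\<ge>N. \<forall>n\<ge>N. dist (ell2_apply (X m) x) (ell2_apply (X n) x) < e"
      by blast
  qed
  define L where "L x = lim (\<lambda>n. ell2_apply (X n) x)" for x
  have L: "(\<lambda>n. ell2_apply (X n) x) \<longlonglongrightarrow> L x" for x
    unfolding L_def using Cauchy_convergent[OF coord] by (simp only: convergent_LIMSEQ_iff)
  have bound: "\<exists>N. \<forall>n\<ge>N. \<forall>F. finite F \<longrightarrow> (\<Sum>x\<in>F. (cmod (ell2_apply (X n) x - L x))\<^sup>2) \<le> e\<^sup>2"
    if e: "e > 0" for e
  proof -
    from metric_CauchyD[OF X e] obtain N where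
      N: "\<And>m n. m \<ge> N \<Longrightarrow> n \<ge> N \<Longrightarrow> dist (X m) (X n) < e"
      by blast
    have "(\<Sum>x\<in>F. (cmod (ell2_apply (X n) x - L x))\<^sup>2) \<le> e\<^sup>2" if "n \<ge> N" "finite F" for n F
    proof (rule LIMSEQ_le_const2)
      show "(\<lambda>m. \<Sum>x\<in>F. (cmod (ell2_apply (X n) x - ell2_apply (X m) x))\<^sup>2)
          \<longlonglongrightarrow> (\<Sum>x\<in>F. (cmod (ell2_apply (X n) x - L x))\<^sup>2)"
        by (intro tendsto_intros L)
      have "(\<Sum>x\<in>F. (cmod (ell2_apply (X n) x - ell2_apply (X m) x))\<^sup>2) \<le> e\<^sup>2" if "m \<ge> N" for m
      proof -
        have "(\<Sum>x\<in>F. (cmod (ell2_apply (X n) x - ell2_apply (X m) x))\<^sup>2) \<le> (norm (X n - X m))\<^sup>2"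
          using sum_le_norm_ell2_squared[OF \<open>finite F\<close>, of "X n - X m"]
          by (simp add: minus_ell2.rep_eq)
        also have "\<dots> \<le> e\<^sup>2"
          using N[OF \<open>n \<ge> N\<close> that] by (intro power_mono) (auto simp: dist_norm)
        finally show ?thesis .
      qed
      then show "\<exists>N. \<forall>m\<ge>N.
          (\<Sum>x\<in>F. (cmod (ell2_apply (X n) x - ell2_apply (X m) x))\<^sup>2) \<le> e\<^sup>2"
        by blast
    qed
    then show ?thesis by blast
  qed
  from bound[OF zero_less_one] obtain N where
    "\<And>F. finite F \<Longrightarrow> (\<Sum>x\<in>F. (cmod (ell2_apply (X N) x - L x))\<^sup>2) \<le> 1\<^sup>2"
    by blast
  then have diff: "square_summable (\<lambda>x. ell2_apply (X N) x - L x)"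
    by (rule ell2_from_finite_bounds(1))
  have L2: "square_summable L"
    using square_summable_add[OF square_summable_ell2[of "X N"] square_summable_cmult[OF diff, of "-1"]]
    by simp
  have "X \<longlonglongrightarrow> Abs_ell2 L"
  proof (rule metric_LIMSEQ_I)
    fix e :: real assume "e > 0"
    then have "e/2 > 0" by simp
    from bound[OF this] obtain N where N: "\<And>n F. n \<ge> N \<Longrightarrow> finite F \<Longrightarrow>
        (\<Sum>x\<in>F. (cmod (ell2_apply (X n) x - L x))\<^sup>2) \<le> (e/2)\<^sup>2"
      by blast
    have "dist (X n) (Abs_ell2 L) < e" if "n \<ge> N" for n
    proof -
      have "ell2_apply (X n - Abs_ell2 L) = (\<lambda>x. ell2_apply (X n) x - L x)"
        by (simp add: minus_ell2.rep_eq Abs_ell2_inverse L2)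
      then have "X n - Abs_ell2 L = Abs_ell2 (\<lambda>x. ell2_apply (X n) x - L x)"
        using ell2_apply_inverse[of "X n - Abs_ell2 L"] by simp
      then have "(norm (X n - Abs_ell2 L))\<^sup>2 \<le> (e/2)\<^sup>2"
        using ell2_from_finite_bounds(2)[OF N[OF that]] by simp
      then have "norm (X n - Abs_ell2 L) \<le> e/2"
        by (rule power2_le_imp_le) (use \<open>e > 0\<close> in simp)
      then show ?thesis
        using \<open>e > 0\<close> by (simp add: dist_norm)
    qed
    then show "\<exists>N. \<forall>n\<ge>N. dist (X n) (Abs_ell2 L) < e"
      by blast
  qed
  then show "convergent X"
    by (rule convergentI)
qed

instantiation ell2 :: (type) complex_hilbert
begin

definition cinner_ell2 :: "'a ell2 \<Rightarrow> 'a ell2 \<Rightarrow> complex" where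
  "cinner_ell2 f g = (\<Sum>\<^sub>\<infinity>x. ell2_apply f x * cnj (ell2_apply g x))"

instance
proof
  fix f g h :: "'a ell2" and c d :: complex and r :: real
  show "c *\<^sub>C (f + g) = c *\<^sub>C f + c *\<^sub>C g" by transfer (simp add: algebra_simps)
  show "(c + d) *\<^sub>C f = c *\<^sub>C f + d *\<^sub>C f" by transfer (simp add: algebra_simps)
  show "c *\<^sub>C d *\<^sub>C f = (c * d) *\<^sub>C f" by transfer (simp add: mult.assoc)
  show "complex_of_real r *\<^sub>C f = r *\<^sub>R f" by transfer simp
  show "cinner f g = cnj (cinner g f)"
    by (simp add: cinner_ell2_def mult.commute flip: infsum_cnj)
  show "cinner (f + g) h = cinner f h + cinner g h"
    by (simp add: cinner_ell2_def plus_ell2.rep_eq distrib_right infsum_add square_summable_mult)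
  show "cinner (c *\<^sub>C f) g = c * cinner f g"
    by (simp add: cinner_ell2_def scaleC_ell2.rep_eq mult.assoc infsum_cmult_right')
  show "Re (cinner f g) = inner f g"
    by (simp add: cinner_ell2_def inner_ell2_def)
qed

end

lift_definition point_mass :: "'a \<Rightarrow> 'a ell2" is "\<lambda>a x. if x = a then 1 else 0"
proof -
  fix a :: 'a
  show "square_summable (\<lambda>x. if x = a then 1 else 0)"
    unfolding square_summable_def
    by (rule finite_nonzero_values_imp_summable_on) (rule finite_subset[of _ "{a}"], auto)
qed


section \<open>Group von Neumann algebras\<close>

text \<open>Discrete groups are types of class \<^class>\<open>group_add\<close>, which does not require commutativity:
  the group law of \<open>\<Gamma>\<close> is written \<open>+\<close>, its unit \<open>0\<close> and the inverse of \<open>g\<close> as \<open>- g\<close>.\<close>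

lift_definition left_translate :: "'g::group_add \<Rightarrow> 'g ell2 \<Rightarrow> 'g ell2"
  is "\<lambda>g f h. f (- g + h)"
proof -
  fix g :: 'g and f :: "'g \<Rightarrow> complex"
  assume f: "square_summable f"
  have "bij (\<lambda>h. - g + h)"
    by (rule bij_betwI[where g = "\<lambda>h. g + h"]) (auto simp: add.assoc[symmetric])
  from summable_on_reindex_bij_betw[OF this, of "\<lambda>x. (cmod (f x))\<^sup>2"] f
  show "square_summable (\<lambda>h. f (- g + h))"
    by (simp add: square_summable_def)
qed

lemma norm_left_translate: "norm (left_translate g f) = norm f"
proof -
  have "bij (\<lambda>h. - g + h)"
    by (rule bij_betwI[where g = "\<lambda>h. g + h"]) (auto simp: add.assoc[symmetric])
  then have "(norm (left_translate g f))\<^sup>2 = (norm f)\<^sup>2"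
    by (simp add: norm_ell2_squared left_translate.rep_eq
        infsum_reindex_bij_betw[where f = "\<lambda>x. (cmod (ell2_apply f x))\<^sup>2"])
  then show ?thesis by simp
qed

lift_definition left_regular :: "'g::group_add \<Rightarrow> 'g ell2 \<Rightarrow>\<^sub>L 'g ell2" is left_translate
proof (rule bounded_linear_intro[where K = 1])
  fix g :: 'g and f h :: "'g ell2" and r :: real
  show "left_translate g (f + h) = left_translate g f + left_translate g h" by transfer simp
  show "left_translate g (r *\<^sub>R f) = r *\<^sub>R left_translate g f" by transfer simp
  show "norm (left_translate g f) \<le> norm f * 1" by (simp add: norm_left_translate)
qed

definition group_vna :: "('g::group_add ell2 \<Rightarrow>\<^sub>L 'g ell2) set" where
  "group_vna = generated_vna (range left_regular)"

text \<open>The canonical trace \<open>x \<mapsto> \<langle>x \<delta>\<^sub>e, \<delta>\<^sub>e\<rangle>\<close>, which is the unique normalized trace of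
  \<open>group_vna\<close> whenever the latter is a factor.\<close>

definition group_trace :: "('g::group_add ell2 \<Rightarrow>\<^sub>L 'g ell2) \<Rightarrow> complex" where
  "group_trace x = cinner (x (point_mass 0)) (point_mass 0)"


section \<open>Free groups\<close>

text \<open>Words in the letters \<open>(i, True)\<close>, standing for the generator \<open>i\<close>, and \<open>(i, False)\<close>, standing
  for its inverse, modulo the congruence generated by cancelling adjacent inverse letters. The
  rank is the cardinality of \<open>'i\<close>: the groups \<open>F\<^sub>n\<close> with \<open>n \<le> \<infinity>\<close>, where \<open>\<infinity>\<close> means countably
  infinite, are the groups \<open>'i free_group\<close> for countable types \<open>'i\<close>.\<close>

inductive word_equiv :: "('i \<times> bool) list \<Rightarrow> ('i \<times> bool) list \<Rightarrow> bool" where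
  cancel: "word_equiv (u @ [(i, b), (i, \<not> b)] @ v) (u @ v)"
| refl: "word_equiv u u"
| sym: "word_equiv u v \<Longrightarrow> word_equiv v u"
| trans: "word_equiv u v \<Longrightarrow> word_equiv v w \<Longrightarrow> word_equiv u w"

quotient_type 'i free_group = "('i \<times> bool) list" / word_equiv
  by (rule equivpI) (auto intro!: reflpI sympI transpI intro: word_equiv.intros)

lemma word_equiv_append_left: "word_equiv u v \<Longrightarrow> word_equiv (w @ u) (w @ v)"
proof (induction rule: word_equiv.induct)
  case (cancel u i b v)
  then show ?case using word_equiv.cancel[of "w @ u" i b v] by simp
qed (auto intro: word_equiv.intros)

lemma word_equiv_append_right: "word_equiv u v \<Longrightarrow> word_equiv (u @ w) (v @ w)"
proof (induction rule: word_equiv.induct)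
  case (cancel u i b v)
  then show ?case using word_equiv.cancel[of u i b "v @ w"] by simp
qed (auto intro: word_equiv.intros)

definition inverse_word :: "('i \<times> bool) list \<Rightarrow> ('i \<times> bool) list" where
  "inverse_word w = rev (map (\<lambda>(i, b). (i, \<not> b)) w)"

lemma word_equiv_inverse_word: "word_equiv u v \<Longrightarrow> word_equiv (inverse_word u) (inverse_word v)"
proof (induction rule: word_equiv.induct)
  case (cancel u i b v)
  then show ?case
    using word_equiv.cancel[of "inverse_word v" i b "inverse_word u"]
    by (simp add: inverse_word_def)
qed (auto intro: word_equiv.intros)

lemma word_equiv_inverse_word_append: "word_equiv (inverse_word w @ w) []"
proof (induction w)
  case (Cons l w)
  obtain i b where l: "l = (i, b)" by (cases l)
  have "word_equiv (inverse_word (l # w) @ l # w) (inverse_word w @ w)"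
    using word_equiv.cancel[of "inverse_word w" i "\<not> b" w] by (simp add: inverse_word_def l)
  then show ?case using Cons.IH by (rule word_equiv.trans)
qed (simp add: inverse_word_def word_equiv.refl)

instantiation free_group :: (type) group_add
begin

lift_definition zero_free_group :: "'i free_group" is "[]" .

lift_definition plus_free_group :: "'i free_group \<Rightarrow> 'i free_group \<Rightarrow> 'i free_group" is "(@)"
  by (meson word_equiv.trans word_equiv_append_left word_equiv_append_right)

lift_definition uminus_free_group :: "'i free_group \<Rightarrow> 'i free_group" is inverse_word
  by (rule word_equiv_inverse_word)

definition minus_free_group :: "'i free_group \<Rightarrow> 'i free_group \<Rightarrow> 'i free_group" where
  "minus_free_group g h = g + - h"

instance
proof
  fix g h k :: "'i free_group"
  show "g + h + k = g + (h + k)" by transfer (simp add: word_equiv.refl)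
  show "0 + g = g" by transfer (simp add: word_equiv.refl)
  show "g + 0 = g" by transfer (simp add: word_equiv.refl)
  show "- g + g = 0" by transfer (rule word_equiv_inverse_word_append)
  show "g + - h = g - h" by (simp add: minus_free_group_def)
qed

end

lift_definition free_generator :: "'i \<Rightarrow> 'i free_group" is "\<lambda>i. [(i, True)]" .

end

theory Submission
  imports Defs
begin

text \<open>Since \<open>VN(\<Gamma>)\<close> is the commutant of the right translations, its elements are the bounded left
  convolvers, \<open>A\<close> consists of those supported on \<open>H = \<langle>a\<rangle>\<close>, and \<open>\<bbbE>\<^sub>A\<close> restricts the Fourier coefficients
  to \<open>H\<close>. The subgroup \<open>H\<close> is malnormal. Hence the cosets \<open>H k a\<^sup>n\<close> with \<open>k \<notin> H\<close> are disjoint, and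
  \<open>\<parallel>\<bbbE>\<^sub>A(x a\<^sup>n y) - \<bbbE>\<^sub>A(x) a\<^sup>n \<bbbE>\<^sub>A(y)\<parallel>\<^sub>2 \<rightarrow> 0\<close> for all \<open>x, y\<close>. Testing with \<open>u a\<^sup>n u\<^sup>*\<close> gives strong
  singularity; testing with \<open>v a\<^sup>n v\<^sup>*\<close>, where \<open>\<bbbE>\<^sub>A(v) = 0\<close>, gives \<open>\<delta>(v A v\<^sup>*, A) = \<parallel>v\<^sup>* v\<parallel>\<^sub>2\<close>. For \<open>\<delta>(A) = 1\<close> one
  also needs an admissible \<open>v\<close>: a symmetry \<open>s \<in> A\<close> supported on odd powers of \<open>a\<close> and its conjugate
  \<open>t = b\<^sup>-\<^sup>1 s b\<close> generate an infinite dihedral group, and the sign of \<open>s - t\<close> yields a unitary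
  that conjugates \<open>s\<close> into \<open>- s\<close>.\<close>


section \<open>Complex Hilbert spaces\<close>

text \<open>Estimates are made on the single vector \<open>x (point_mass 0)\<close>, whose norm is
  the 2-norm of \<open>x\<close>. A lower bound on a distance from A thereby becomes an upper bound
  on mass sitting on H, and the limits in n use only that a square-summable function has vanishing
  mass along a sequence of disjoint sets. The distance in the Popa invariant comes out exactly, for
  every admissible \<open>v\<close>. One such \<open>v\<close> must still be exhibited, since
  otherwise the condition on \<open>r\<close> is vacuous and has no greatest solution. The usual
  source is comparison of projections in a factor of type II_1; the explicit dihedral construction
  uses neither factoriality nor comparison theory. From operator theory it takes only the sign of an
  injective self-adjoint contraction, so a norm-convergent square root and one strong limit stand in
  for Borel functional calculus. The sign has to inherit relations \<open>S X = X T\<close> with two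
  different operators: this lets it exchange \<open>s\<close> with \<open>- t\<close>, and with S =
  T it keeps signs inside the group algebra.\<close>

instance complex_hilbert \<subseteq> banach ..

lemma cinner_add_right: "cinner x (y + z) = cinner x y + cinner x (z :: 'h::complex_hilbert)"
  by (metis cinner_commute cinner_add_left complex_cnj_add)

lemma cinner_scaleC_right: "cinner x (c *\<^sub>C y) = cnj c * cinner x (y :: 'h::complex_hilbert)"
  by (metis cinner_commute cinner_scaleC_left complex_cnj_mult)

lemma scaleC_zero_left [simp]: "0 *\<^sub>C x = (0 :: 'h::complex_hilbert)"
  using scaleC_of_real[of 0 x] by simp

lemma scaleC_zero_right [simp]: "c *\<^sub>C 0 = (0 :: 'h::complex_hilbert)"
  using linear_0[OF bounded_linear.linear[OF bounded_linear_scaleC]] .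

lemma scaleC_minus_one: "(- 1) *\<^sub>C x = - (x :: 'h::complex_hilbert)"
  using scaleC_of_real[of "- 1" x] by simp

lemma scaleC_diff_right: "c *\<^sub>C (x - y) = c *\<^sub>C x - c *\<^sub>C (y :: 'h::complex_hilbert)"
  using linear_diff[OF bounded_linear.linear[OF bounded_linear_scaleC]] .

lemma cinner_minus_left: "cinner (- x) y = - cinner x (y :: 'h::complex_hilbert)"
  using cinner_scaleC_left[of "- 1" x y] by (simp add: scaleC_minus_one)

lemma cinner_minus_right: "cinner x (- y) = - cinner x (y :: 'h::complex_hilbert)"
  using cinner_scaleC_right[of x "- 1" y] by (simp add: scaleC_minus_one)

lemma cinner_diff_left: "cinner (x - y) z = cinner x z - cinner y (z :: 'h::complex_hilbert)"
  using cinner_add_left[of x "- y" z] by (simp add: cinner_minus_left)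

lemma cinner_diff_right: "cinner x (y - z) = cinner x y - cinner x (z :: 'h::complex_hilbert)"
  using cinner_add_right[of x y "- z"] by (simp add: cinner_minus_right)

lemma cinner_zero_left [simp]: "cinner 0 (y :: 'h::complex_hilbert) = 0"
  using cinner_scaleC_left[of 0 0 y] by simp

lemma cinner_zero_right [simp]: "cinner (y :: 'h::complex_hilbert) 0 = 0"
  using cinner_scaleC_right[of y 0 0] by simp

lemma cinner_sum_left: "cinner (\<Sum>i\<in>I. f i) y = (\<Sum>i\<in>I. cinner (f i) (y :: 'h::complex_hilbert))"
  by (induction I rule: infinite_finite_induct) (auto simp: cinner_add_left)

lemma cinner_sum_right: "cinner y (\<Sum>i\<in>I. f i) = (\<Sum>i\<in>I. cinner (y :: 'h::complex_hilbert) (f i))"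
  by (induction I rule: infinite_finite_induct) (auto simp: cinner_add_right)

lemma cinner_self: "cinner x x = of_real ((norm (x :: 'h::complex_hilbert))\<^sup>2)"
proof (rule complex_eqI)
  have "Im (cinner x x) = - Im (cinner x x)"
    using arg_cong[OF cinner_commute[of x x], of Im] by simp
  then show "Im (cinner x x) = Im (of_real ((norm x)\<^sup>2))"
    by simp
qed (simp add: Re_cinner power2_norm_eq_inner)

lemma cinner_self_eq_0 [simp]: "cinner x x = 0 \<longleftrightarrow> (x :: 'h::complex_hilbert) = 0"
  by (simp add: cinner_self)

lemma cinner_ext: "(\<And>y. cinner x y = cinner x' y) \<Longrightarrow> x = (x' :: 'h::complex_hilbert)"
  by (metis cinner_diff_left cinner_self_eq_0 diff_self eq_iff_diff_eq_0)

lemma norm_cinner_le: "cmod (cinner x y) \<le> norm x * norm (y :: 'h::complex_hilbert)"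
proof (cases "cinner x y = 0")
  case False
  \<comment> \<open>This phase rotates the inner product to its modulus, which reduces the complex
    Cauchy-Schwarz inequality to the real one.\<close>
  define c where "c = cnj (cinner x y) / of_real (cmod (cinner x y))"
  have c: "cmod c = 1"
    using False by (simp add: c_def norm_divide)
  have "cinner x y * cnj (cinner x y) = of_real (cmod (cinner x y)) * of_real (cmod (cinner x y))"
    by (simp only: complex_norm_square[symmetric] power2_eq_square of_real_mult)
  then have "c * cinner x y = of_real (cmod (cinner x y))"
    using False by (simp add: c_def mult.commute)
  then have "cmod (cinner x y) = Re (cinner (c *\<^sub>C x) y)"
    by (simp add: cinner_scaleC_left)
  also have "\<dots> \<le> norm (c *\<^sub>C x) * norm y"
    by (simp add: Re_cinner norm_cauchy_schwarz)
  finally show ?thesis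
    by (simp add: norm_scaleC c)
qed simp

lemma bounded_bilinear_cinner: "bounded_bilinear (cinner :: 'h::complex_hilbert \<Rightarrow> _)"
proof (rule bounded_bilinear.intro)
  show "\<exists>K. \<forall>x y :: 'h. norm (cinner x y) \<le> norm x * norm y * K"
    by (rule exI[of _ 1]) (simp add: norm_cinner_le)
qed (simp_all add: cinner_add_left cinner_add_right cinner_scaleC_left cinner_scaleC_right
    scaleR_conv_of_real flip: scaleC_of_real)

lemmas bounded_linear_cinner_left = bounded_bilinear.bounded_linear_left[OF bounded_bilinear_cinner]
lemmas bounded_linear_cinner_right = bounded_bilinear.bounded_linear_right[OF bounded_bilinear_cinner]
lemmas continuous_on_cinner [continuous_intros] =
  bounded_bilinear.continuous_on[OF bounded_bilinear_cinner]
lemmas tendsto_cinner_left = bounded_linear.tendsto[OF bounded_linear_cinner_left]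
lemmas tendsto_cinner_right = bounded_linear.tendsto[OF bounded_linear_cinner_right]

section \<open>Complex-linear and self-adjoint operators\<close>

lemma bounded_opsD: "T \<in> bounded_ops \<Longrightarrow> T (c *\<^sub>C x) = c *\<^sub>C T x"
  by (auto simp: bounded_ops_def)

lemma bounded_ops_0 [simp]: "0 \<in> bounded_ops"
  and bounded_ops_id [simp]: "id_blinfun \<in> bounded_ops"
  by (auto simp: bounded_ops_def)

lemma bounded_ops_add: "S \<in> bounded_ops \<Longrightarrow> T \<in> bounded_ops \<Longrightarrow> S + T \<in> bounded_ops"
  by (auto simp: bounded_ops_def blinfun.add_left scaleC_add_right)

lemma bounded_ops_diff: "S \<in> bounded_ops \<Longrightarrow> T \<in> bounded_ops \<Longrightarrow> S - T \<in> bounded_ops"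
  by (auto simp: bounded_ops_def blinfun.diff_left scaleC_diff_right)

lemma bounded_ops_scaleC: "S \<in> bounded_ops \<Longrightarrow> c *\<^sub>C S \<in> bounded_ops"
  by (auto simp: bounded_ops_def scaleC_blinfun.rep_eq scaleC_scaleC mult.commute)

lemma bounded_ops_compose: "S \<in> bounded_ops \<Longrightarrow> T \<in> bounded_ops \<Longrightarrow> S o\<^sub>L T \<in> bounded_ops"
  by (auto simp: bounded_ops_def)

text \<open>Stated through the inner product because the existence of \<open>adj\<close> is proved
  only on \<open>ell2\<close>, while square roots and signs are built in every
  \<open>complex_hilbert\<close>.\<close>

definition self_adjoint :: "('h::complex_hilbert \<Rightarrow>\<^sub>L 'h) \<Rightarrow> bool" where
  "self_adjoint T \<longleftrightarrow> (\<forall>x y. cinner (T x) y = cinner x (T y))"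

lemma self_adjointD: "self_adjoint T \<Longrightarrow> cinner (T x) y = cinner x (T y)"
  by (auto simp: self_adjoint_def)

text \<open>Operators are a priori only real linear. Symmetry for the complex inner product supplies
  the rest: a scalar on \<open>x\<close> can be pulled out once \<open>T\<close> has moved to the
  other side.\<close>

lemma self_adjoint_bounded_ops: "self_adjoint T \<Longrightarrow> T \<in> bounded_ops"
  unfolding bounded_ops_def self_adjoint_def
  by (simp, intro allI cinner_ext) (simp add: cinner_scaleC_left)

lemma self_adjoint_norm: "self_adjoint T \<Longrightarrow> (norm (T x))\<^sup>2 = Re (cinner (T (T x)) x)"
  by (metis Re_complex_of_real cinner_self self_adjointD)

lemma self_adjoint_compose:
  "self_adjoint S \<Longrightarrow> self_adjoint T \<Longrightarrow> S o\<^sub>L T = T o\<^sub>L S \<Longrightarrow> self_adjoint (S o\<^sub>L T)"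
  unfolding self_adjoint_def by (metis blinfun_apply_blinfun_compose)

lemma self_adjoint_add: "self_adjoint S \<Longrightarrow> self_adjoint T \<Longrightarrow> self_adjoint (S + T)"
  and self_adjoint_diff: "self_adjoint S \<Longrightarrow> self_adjoint T \<Longrightarrow> self_adjoint (S - T)"
  and self_adjoint_id: "self_adjoint id_blinfun"
  and self_adjoint_0: "self_adjoint 0"
  by (auto simp: self_adjoint_def blinfun.bilinear_simps cinner_add_left cinner_add_right
      cinner_diff_left cinner_diff_right)

lemma self_adjoint_scaleR: "self_adjoint T \<Longrightarrow> self_adjoint (r *\<^sub>R T)"
  by (auto simp: self_adjoint_def blinfun.scaleR_left cinner_scaleC_left cinner_scaleC_right
      simp flip: scaleC_of_real)

lemma self_adjoint_sum: "(\<And>i. i \<in> I \<Longrightarrow> self_adjoint (T i)) \<Longrightarrow> self_adjoint (\<Sum>i\<in>I. T i)"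
  by (induction I rule: infinite_finite_induct) (auto intro: self_adjoint_add self_adjoint_0)

lemma self_adjoint_limit:
  fixes S :: "'h::complex_hilbert \<Rightarrow>\<^sub>L 'h"
  assumes "\<And>n :: nat. self_adjoint (T n)" "\<And>x. (\<lambda>n. T n x) \<longlonglongrightarrow> S x"
  shows "self_adjoint S"
  unfolding self_adjoint_def
proof (intro allI)
  fix x y
  have "(\<lambda>n. cinner (T n x) y) \<longlonglongrightarrow> cinner (S x) y"
    by (intro tendsto_cinner_left assms)
  moreover have "(\<lambda>n. cinner (T n x) y) \<longlonglongrightarrow> cinner x (S y)"
    unfolding self_adjointD[OF assms(1)] by (intro tendsto_cinner_right assms)
  ultimately show "cinner (S x) y = cinner x (S y)"
    by (rule LIMSEQ_unique)
qed

lemma blinfun_apply_limit: "T \<longlonglongrightarrow> S \<Longrightarrow> (\<lambda>n. blinfun_apply (T n) x) \<longlonglongrightarrow> S x"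
  by (intro tendsto_intros)

text \<open>Two operators \<open>S1\<close> and \<open>S2\<close> instead of one, because signs must
  carry intertwining relations and not only commutation.\<close>

lemma commute_strong_limit:
  assumes "\<And>n :: nat. S1 o\<^sub>L T n = T n o\<^sub>L S2" "\<And>x. (\<lambda>n. blinfun_apply (T n) x) \<longlonglongrightarrow> blinfun_apply U x"
  shows "S1 o\<^sub>L U = U o\<^sub>L S2"
proof (rule blinfun_eqI)
  fix x
  have "(\<lambda>n. S1 (T n x)) \<longlonglongrightarrow> S1 (U x)"
    by (intro tendsto_intros assms)
  moreover have "S1 (T n x) = T n (S2 x)" for n
    by (metis assms(1) blinfun_apply_blinfun_compose)
  then have "(\<lambda>n. S1 (T n x)) \<longlonglongrightarrow> U (S2 x)"
    using assms(2) by simp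
  ultimately show "(S1 o\<^sub>L U) x = (U o\<^sub>L S2) x"
    by (simp add: LIMSEQ_unique)
qed

subsection \<open>Square roots and signs\<close>

text \<open>The iterates are polynomials in \<open>B\<close> with nonnegative coefficients, hence dominated by the same
  iteration for the number \<open>1\<close>; their limit \<open>S\<close> satisfies \<open>(1 - S)\<^sup>2 = 1 - B\<close>.\<close>

fun sqrt_iter :: "('h::complex_hilbert \<Rightarrow>\<^sub>L 'h) \<Rightarrow> nat \<Rightarrow> ('h \<Rightarrow>\<^sub>L 'h)" where
  "sqrt_iter B 0 = 0"
| "sqrt_iter B (Suc n) = (1/2) *\<^sub>R (B + (sqrt_iter B n o\<^sub>L sqrt_iter B n))"

fun sqrt_bound :: "nat \<Rightarrow> real" where
  "sqrt_bound 0 = 0"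
| "sqrt_bound (Suc n) = (1 + (sqrt_bound n)\<^sup>2) / 2"

lemma sqrt_bound_range: "0 \<le> sqrt_bound n \<and> sqrt_bound n \<le> 1"
proof (induction n)
  case (Suc n)
  then show ?case by (auto simp: power_le_one)
qed auto

lemma sqrt_bound_mono: "sqrt_bound n \<le> sqrt_bound (Suc n)"
  using sum_squares_bound[of 1 "sqrt_bound n"] by (simp add: power2_eq_square)

lemmas compose_linear =
  bounded_bilinear.add_left[OF bounded_bilinear_blinfun_compose]
  bounded_bilinear.add_right[OF bounded_bilinear_blinfun_compose]
  bounded_bilinear.diff_left[OF bounded_bilinear_blinfun_compose]
  bounded_bilinear.diff_right[OF bounded_bilinear_blinfun_compose]
  bounded_bilinear.minus_left[OF bounded_bilinear_blinfun_compose]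
  bounded_bilinear.minus_right[OF bounded_bilinear_blinfun_compose]
  bounded_bilinear.scaleR_left[OF bounded_bilinear_blinfun_compose]
  bounded_bilinear.scaleR_right[OF bounded_bilinear_blinfun_compose]
  bounded_bilinear.zero_left[OF bounded_bilinear_blinfun_compose]
  bounded_bilinear.zero_right[OF bounded_bilinear_blinfun_compose]

lemma compose_assoc: "(R o\<^sub>L S) o\<^sub>L T = R o\<^sub>L (S o\<^sub>L T)"
  by (rule blinfun_eqI) simp

lemma compose_id [simp]: "T o\<^sub>L id_blinfun = T" "id_blinfun o\<^sub>L T = T"
  by (rule blinfun_eqI, simp)+

lemma commute_compose:
  assumes "T o\<^sub>L R = R o\<^sub>L T" "T o\<^sub>L S = S o\<^sub>L T"
  shows "T o\<^sub>L (R o\<^sub>L S) = (R o\<^sub>L S) o\<^sub>L T"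
  by (metis assms compose_assoc)

lemma sqrt_iter_commute:
  assumes "T o\<^sub>L B = B o\<^sub>L T"
  shows "T o\<^sub>L sqrt_iter B n = sqrt_iter B n o\<^sub>L T"
proof (induction n)
  case (Suc n)
  then show ?case
    using commute_compose[OF Suc.IH Suc.IH] assms by (simp add: compose_linear)
qed (simp add: compose_linear)

lemma sqrt_iter_norm:
  assumes "norm B \<le> 1"
  shows "norm (sqrt_iter B n) \<le> sqrt_bound n"
proof (induction n)
  case (Suc n)
  have "norm (sqrt_iter B n o\<^sub>L sqrt_iter B n) \<le> (sqrt_bound n)\<^sup>2"
    unfolding power2_eq_square using sqrt_bound_range[of n] Suc
    by (meson mult_mono norm_blinfun_compose norm_ge_zero order_trans)
  then show ?case
    using norm_triangle_ineq[of B "sqrt_iter B n o\<^sub>L sqrt_iter B n"] assms by simp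
qed simp

text \<open>Consecutive iterates commute, so the difference of their squares factors as (S - T)(S +
  T). The scalar iteration satisfies the same identity with equality, which closes the
  induction.\<close>

lemma sqrt_iter_diff:
  assumes "norm B \<le> 1"
  shows "norm (sqrt_iter B (Suc n) - sqrt_iter B n) \<le> sqrt_bound (Suc n) - sqrt_bound n"
proof (induction n)
  case (Suc n)
  let ?S = "sqrt_iter B (Suc n)" and ?T = "sqrt_iter B n"
  have comm: "?S o\<^sub>L ?T = ?T o\<^sub>L ?S"
    by (intro sqrt_iter_commute HOL.sym[OF sqrt_iter_commute] HOL.refl)
  have "sqrt_iter B (Suc (Suc n)) - ?S = (1/2) *\<^sub>R ((?S o\<^sub>L ?S) - (?T o\<^sub>L ?T))"
    unfolding sqrt_iter.simps(2)[of B "Suc n"] sqrt_iter.simps(2)[of B n]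
    by (simp add: algebra_simps del: sqrt_iter.simps)
  also have "(?S o\<^sub>L ?S) - (?T o\<^sub>L ?T) = (?S - ?T) o\<^sub>L (?S + ?T)"
    by (simp only: compose_linear comm) simp
  finally have eq: "norm (sqrt_iter B (Suc (Suc n)) - ?S) = norm ((?S - ?T) o\<^sub>L (?S + ?T)) / 2"
    by simp
  have "norm ((?S - ?T) o\<^sub>L (?S + ?T)) \<le> norm (?S - ?T) * norm (?S + ?T)"
    by (rule norm_blinfun_compose)
  also have "\<dots> \<le> (sqrt_bound (Suc n) - sqrt_bound n) * (sqrt_bound (Suc n) + sqrt_bound n)"
    using sqrt_bound_mono[of n] norm_triangle_ineq[of ?S ?T]
      sqrt_iter_norm[OF assms, of n] sqrt_iter_norm[OF assms, of "Suc n"]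
    by (intro mult_mono Suc.IH) (linarith | simp)+
  also have "\<dots> = 2 * (sqrt_bound (Suc (Suc n)) - sqrt_bound (Suc n))"
    unfolding sqrt_bound.simps(2)[of "Suc n"] sqrt_bound.simps(2)[of n]
    by (simp add: power2_eq_square algebra_simps)
  finally show ?case
    using eq by (simp del: sqrt_iter.simps sqrt_bound.simps)
qed (use assms in simp)

lemma sqrt_exists:
  fixes B :: "'h::complex_hilbert \<Rightarrow>\<^sub>L 'h"
  assumes B: "self_adjoint B" "norm B \<le> 1"
  obtains R where "self_adjoint R" "R o\<^sub>L R = id_blinfun - B"
    "\<And>T. T o\<^sub>L B = B o\<^sub>L T \<Longrightarrow> T o\<^sub>L R = R o\<^sub>L T"
proof -
  have diff: "norm (sqrt_iter B (n + k) - sqrt_iter B n) \<le> sqrt_bound (n + k) - sqrt_bound n" for n k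
  proof (induction k)
    case (Suc k)
    have "norm (sqrt_iter B (n + Suc k) - sqrt_iter B n)
      \<le> norm (sqrt_iter B (Suc (n + k)) - sqrt_iter B (n + k)) + norm (sqrt_iter B (n + k) - sqrt_iter B n)"
      by (metis add_Suc_right diff_add_cancel add_diff_eq norm_triangle_ineq)
    also have "\<dots> \<le> sqrt_bound (n + Suc k) - sqrt_bound n"
      using sqrt_iter_diff[OF B(2), of "n + k"] Suc by (simp del: sqrt_iter.simps sqrt_bound.simps)
    finally show ?case .
  qed simp
  have "convergent sqrt_bound"
    using sqrt_bound_range sqrt_bound_mono incseq_convergent[of sqrt_bound 1]
    by (meson convergentI incseq_SucI)
  then have Cb: "Cauchy sqrt_bound"
    by (rule convergent_Cauchy)
  have "Cauchy (sqrt_iter B)"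
  proof (rule CauchyI')
    fix e :: real assume "e > 0"
    from CauchyD[OF Cb this] obtain N where
      N: "\<And>m n. m \<ge> N \<Longrightarrow> n \<ge> N \<Longrightarrow> norm (sqrt_bound m - sqrt_bound n) < e"
      by blast
    have "dist (sqrt_iter B m) (sqrt_iter B n) < e" if "m \<ge> N" "n > m" for m n
      using diff[of m "n - m"] N[of n m] that by (simp add: dist_norm norm_minus_commute)
    then show "\<exists>M. \<forall>m\<ge>M. \<forall>n>m. dist (sqrt_iter B m) (sqrt_iter B n) < e"
      by blast
  qed
  then obtain S where S: "sqrt_iter B \<longlonglongrightarrow> S"
    using Cauchy_convergent convergent_def by blast
  have Sx: "(\<lambda>n. sqrt_iter B n x) \<longlonglongrightarrow> S x" for x
    by (rule blinfun_apply_limit[OF S])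
  have comm: "T o\<^sub>L S = S o\<^sub>L T" if "T o\<^sub>L B = B o\<^sub>L T" for T
    by (rule commute_strong_limit[OF sqrt_iter_commute[OF that] Sx])
  have "(\<lambda>n. sqrt_iter B (Suc n)) \<longlonglongrightarrow> (1/2) *\<^sub>R (B + (S o\<^sub>L S))"
    unfolding sqrt_iter.simps
    by (intro tendsto_intros bounded_bilinear.tendsto[OF bounded_bilinear_blinfun_compose] S)
  then have "S = (1/2) *\<^sub>R (B + (S o\<^sub>L S))"
    using S LIMSEQ_Suc LIMSEQ_unique by blast
  then have "2 *\<^sub>R S = 2 *\<^sub>R (1/2) *\<^sub>R (B + (S o\<^sub>L S))"
    by (rule arg_cong)
  then have SS: "B + (S o\<^sub>L S) = 2 *\<^sub>R S"
    by simp
  have saS: "self_adjoint S"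
  proof (rule self_adjoint_limit[OF _ Sx])
    show "self_adjoint (sqrt_iter B n)" for n
      by (induction n)
        (auto intro!: self_adjoint_scaleR self_adjoint_add self_adjoint_compose B self_adjoint_0)
  qed
  show thesis
  proof (rule that[of "id_blinfun - S"])
    show "self_adjoint (id_blinfun - S)"
      by (intro self_adjoint_diff saS self_adjoint_id)
    show "(id_blinfun - S) o\<^sub>L (id_blinfun - S) = id_blinfun - B"
      using SS by (simp add: compose_linear algebra_simps scaleR_2)
  qed (use comm in \<open>auto simp: compose_linear\<close>)
qed

section \<open>Signs of injective self-adjoint contractions\<close>

fun op_power :: "('h::real_normed_vector \<Rightarrow>\<^sub>L 'h) \<Rightarrow> nat \<Rightarrow> ('h \<Rightarrow>\<^sub>L 'h)" where
  "op_power B 0 = id_blinfun"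
| "op_power B (Suc n) = B o\<^sub>L op_power B n"

lemma op_power_add: "op_power B (m + n) = op_power B m o\<^sub>L op_power B n"
  by (induction m) (auto simp: compose_assoc)

lemma op_power_commute: "T o\<^sub>L B = B o\<^sub>L T \<Longrightarrow> T o\<^sub>L op_power B n = op_power B n o\<^sub>L T"
  by (induction n) (auto simp: commute_compose)

lemma self_adjoint_op_power: "self_adjoint B \<Longrightarrow> self_adjoint (op_power B n)"
  by (induction n) (auto intro!: self_adjoint_compose self_adjoint_id op_power_commute)

text \<open>The numbers \<open>\<parallel>B\<^sup>n x\<parallel>\<^sup>2 = \<langle>B\<^sup>2\<^sup>n x, x\<rangle>\<close> decrease, which makes \<open>B\<^sup>2\<^sup>n x\<close> a Cauchy sequence; its limit
  is fixed by \<open>B\<^sup>2\<close>.\<close>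

lemma op_power_tendsto_0:
  fixes B :: "'h::complex_hilbert \<Rightarrow>\<^sub>L 'h"
  assumes B: "self_adjoint B" "norm B \<le> 1" and fixp: "\<And>x. B (B x) = x \<Longrightarrow> x = 0"
  shows "(\<lambda>n. op_power B (2 * n) x) \<longlonglongrightarrow> 0"
proof -
  define q where "q n = (norm (op_power B n x))\<^sup>2" for n
  have sa: "self_adjoint (op_power B n)" for n
    by (rule self_adjoint_op_power[OF B(1)])
  have "decseq q"
  proof (rule decseq_SucI)
    show "q (Suc n) \<le> q n" for n
      using norm_blinfun[of B "op_power B n x"] mult_right_mono[OF B(2), of "norm (op_power B n x)"]
      by (simp add: q_def power_mono)
  qed
  then have "convergent q"
    using decseq_convergent[of q 0] by (auto simp: q_def convergent_def)
  then have Cq: "Cauchy q"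
    by (rule convergent_Cauchy)
  \<comment> \<open>Self-adjointness moves all powers of \<open>B\<close> to one side, so the mixed
    term depends on \<open>m + n\<close> only. As \<open>q\<close> converges, the right-hand side
    becomes small.\<close>
  have eq: "(norm (op_power B (2 * m) x - op_power B (2 * n) x))\<^sup>2 = q (2 * m) + q (2 * n) - 2 * q (m + n)"
    for m n
  proof -
    have "2 * n + 2 * m = m + n + (m + n)" by simp
    then have "op_power B (2 * n) (op_power B (2 * m) x) = op_power B (m + n + (m + n)) x"
      by (metis blinfun_apply_blinfun_compose op_power_add)
    then have "inner (op_power B (2 * m) x) (op_power B (2 * n) x) = Re (cinner (op_power B (m + n + (m + n)) x) x)"
      by (metis Re_cinner sa self_adjointD)
    also have "\<dots> = q (m + n)"
      by (simp add: q_def self_adjoint_norm[OF sa] op_power_add[of _ "m + n" "m + n"])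
    finally show ?thesis
      by (simp add: q_def power2_norm_eq_inner inner_diff inner_commute)
  qed
  have "Cauchy (\<lambda>n. op_power B (2 * n) x)"
  proof (rule CauchyI)
    fix e :: real assume "e > 0"
    then have "e\<^sup>2 / 2 > 0" by simp
    from CauchyD[OF Cq this] obtain N where
      N: "\<And>m n. m \<ge> N \<Longrightarrow> n \<ge> N \<Longrightarrow> norm (q m - q n) < e\<^sup>2 / 2"
      by blast
    have "norm (op_power B (2 * m) x - op_power B (2 * n) x) < e" if "m \<ge> N" "n \<ge> N" for m n
    proof -
      have "(norm (op_power B (2 * m) x - op_power B (2 * n) x))\<^sup>2 < e\<^sup>2"
        unfolding eq using N[of "2 * m" "m + n"] N[of "2 * n" "m + n"] that
        unfolding real_norm_def by linarith
      then show ?thesis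
        using \<open>e > 0\<close> by (simp add: power_less_imp_less_base)
    qed
    then show "\<exists>M. \<forall>m\<ge>M. \<forall>n\<ge>M. norm (op_power B (2 * m) x - op_power B (2 * n) x) < e"
      by blast
  qed
  then obtain y where y: "(\<lambda>n. op_power B (2 * n) x) \<longlonglongrightarrow> y"
    using Cauchy_convergent convergent_def by blast
  have "(\<lambda>n. B (B (op_power B (2 * n) x))) \<longlonglongrightarrow> B (B y)"
    by (intro tendsto_intros y)
  moreover have "(\<lambda>n. B (B (op_power B (2 * n) x))) \<longlonglongrightarrow> y"
    using LIMSEQ_Suc[OF y] by simp
  ultimately have "B (B y) = y"
    by (rule LIMSEQ_unique)
  with fixp y show ?thesis by auto
qed

lemma strong_limit_exists:
  fixes T :: "nat \<Rightarrow> 'h::complex_hilbert \<Rightarrow>\<^sub>L 'h"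
  assumes "\<And>x. Cauchy (\<lambda>n. T n x)" "\<And>n x. norm (T n x) \<le> K * norm x"
  obtains U where "\<And>x. (\<lambda>n. T n x) \<longlonglongrightarrow> blinfun_apply U x"
proof -
  define u where "u x = lim (\<lambda>n. T n x)" for x
  have u: "(\<lambda>n. T n x) \<longlonglongrightarrow> u x" for x
    unfolding u_def using assms(1) Cauchy_convergent convergent_LIMSEQ_iff by blast
  have "bounded_linear u"
  proof (rule bounded_linear_intro)
    fix x y r
    have "(\<lambda>n. T n (x + y)) \<longlonglongrightarrow> u x + u y"
      unfolding blinfun.add_right by (intro tendsto_intros u)
    then show "u (x + y) = u x + u y"
      using u LIMSEQ_unique by blast
    have "(\<lambda>n. T n (r *\<^sub>R x)) \<longlonglongrightarrow> r *\<^sub>R u x"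
      unfolding blinfun.scaleR_right by (intro tendsto_intros u)
    then show "u (r *\<^sub>R x) = r *\<^sub>R u x"
      using u LIMSEQ_unique by blast
    show "norm (u x) \<le> norm x * K"
      using assms(2) by (intro LIMSEQ_le_const2[OF tendsto_norm[OF u]]) (auto simp: mult.commute)
  qed
  then have "blinfun_apply (Blinfun u) = u"
    by (rule bounded_linear_Blinfun_apply)
  with u that show thesis by metis
qed

text \<open>\<open>W = sgn X\<close> is the strong limit of \<open>X R (\<Sum>k<2n. B\<^sup>k)\<close>, where \<open>B = 1 - X\<^sup>2\<close> and \<open>R = \<bar>X\<bar>\<close>; since
  \<open>\<parallel>X y\<parallel> = \<parallel>R y\<parallel>\<close> and \<open>R\<^sup>2 (\<Sum>k<2n. B\<^sup>k) = 1 - B\<^sup>2\<^sup>n\<close>, convergence follows from \<open>B\<^sup>2\<^sup>n \<rightarrow> 0\<close>.\<close>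

lemma sign_exists:
  fixes X :: "'h::complex_hilbert \<Rightarrow>\<^sub>L 'h"
  assumes X: "self_adjoint X" "norm X \<le> 1" and inj: "\<And>x. X x = 0 \<Longrightarrow> x = 0"
  obtains W where "self_adjoint W" "W o\<^sub>L W = id_blinfun"
    "\<And>S T. S o\<^sub>L X = X o\<^sub>L T \<Longrightarrow> T o\<^sub>L (X o\<^sub>L X) = (X o\<^sub>L X) o\<^sub>L T \<Longrightarrow> S o\<^sub>L W = W o\<^sub>L T"
proof -
  define B where "B = id_blinfun - (X o\<^sub>L X)"
  have saB: "self_adjoint B"
    unfolding B_def by (intro self_adjoint_diff self_adjoint_id self_adjoint_compose X HOL.refl)
  have contr: "norm (X x) \<le> norm x" for x
    using norm_blinfun[of X x] mult_right_mono[OF X(2), of "norm x"] by simp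
  have "norm (B x) \<le> norm x" for x
  proof -
    have "inner x (X (X x)) = (norm (X x))\<^sup>2"
      by (metis Re_cinner X(1) power2_norm_eq_inner self_adjointD)
    then have "(norm (B x))\<^sup>2 = (norm x)\<^sup>2 - 2 * (norm (X x))\<^sup>2 + (norm (X (X x)))\<^sup>2"
      by (simp add: B_def blinfun.diff_left power2_norm_eq_inner inner_diff inner_commute)
    moreover have "(norm (X (X x)))\<^sup>2 \<le> (norm (X x))\<^sup>2"
      by (intro power_mono contr) simp
    ultimately have "(norm (B x))\<^sup>2 \<le> (norm x)\<^sup>2"
      using zero_le_power2[of "norm (X x)"] by linarith
    then show ?thesis by simp
  qed
  then have nB: "norm B \<le> 1"
    by (intro norm_blinfun_bound) auto
  from sqrt_exists[OF saB nB] obtain R where R: "self_adjoint R" "R o\<^sub>L R = id_blinfun - B"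
    and Rcomm: "\<And>T. T o\<^sub>L B = B o\<^sub>L T \<Longrightarrow> T o\<^sub>L R = R o\<^sub>L T"
    by metis
  have RR: "R o\<^sub>L R = X o\<^sub>L X"
    using R(2) by (simp add: B_def)
  \<comment> \<open>A vector fixed by B^2 would give X^2 y = 2 y for y = X^2 x, which a contraction
    allows only for y = 0; injectivity of \<open>X\<close> then gives x = 0.\<close>
  have BB0: "x = 0" if "B (B x) = x" for x
  proof -
    let ?y = "X (X x)"
    have "X (X ?y) = 2 *\<^sub>R ?y"
      using that by (simp add: B_def blinfun.bilinear_simps scaleR_2 algebra_simps)
    then have "norm (2 *\<^sub>R ?y) \<le> norm ?y"
      by (metis contr order_trans)
    then have "?y = 0" by simp
    then show ?thesis by (rule inj[OF inj])
  qed
  have nXR: "norm (X x) = norm (R x)" for x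
  proof -
    have "R (R x) = X (X x)"
      by (simp flip: blinfun_apply_blinfun_compose add: RR)
    then have "(norm (X x))\<^sup>2 = (norm (R x))\<^sup>2"
      by (simp only: self_adjoint_norm[OF R(1)] self_adjoint_norm[OF X(1)])
    then show ?thesis by simp
  qed
  \<comment> \<open>Partial sums of the Neumann series for the inverse of X^2 = 1 - B. The length is
    even because \<open>op_power_tendsto_0\<close> concerns even powers.\<close>
  define G where "G n = (\<Sum>k<2*n. op_power B k)" for n :: nat
  have geo: "(R o\<^sub>L R) o\<^sub>L (\<Sum>k<n. op_power B k) = id_blinfun - op_power B n" for n
    unfolding R(2) by (induction n) (auto simp: compose_linear)
  have Gcomm: "T o\<^sub>L G n = G n o\<^sub>L T" if "T o\<^sub>L B = B o\<^sub>L T" for T n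
    unfolding G_def bounded_bilinear.sum_left[OF bounded_bilinear_blinfun_compose]
      bounded_bilinear.sum_right[OF bounded_bilinear_blinfun_compose]
    by (simp add: op_power_commute[OF that])
  have XB: "X o\<^sub>L B = B o\<^sub>L X"
    by (simp add: B_def compose_linear compose_assoc)
  define V where "V n = X o\<^sub>L (R o\<^sub>L G n)" for n
  have Vn: "norm (V m x - V n x) = norm (op_power B (2 * m) x - op_power B (2 * n) x)" for m n x
  proof -
    have "norm (V m x - V n x) = norm (X (R (G m x - G n x)))"
      by (simp add: V_def blinfun.diff_right)
    then have "norm (V m x - V n x) = norm (((R o\<^sub>L R) o\<^sub>L G m) x - ((R o\<^sub>L R) o\<^sub>L G n) x)"
      unfolding nXR by (simp add: blinfun.diff_right)
    also have "\<dots> = norm (op_power B (2 * m) x - op_power B (2 * n) x)"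
      unfolding geo G_def by (simp add: blinfun.diff_left norm_minus_commute)
    finally show ?thesis .
  qed
  have V0: "norm (V n x) = norm (x - op_power B (2 * n) x)" for n x
    using Vn[of n x 0] by (simp add: V_def G_def compose_linear norm_minus_commute)
  have B0: "(\<lambda>n. op_power B (2 * n) x) \<longlonglongrightarrow> 0" for x
    by (rule op_power_tendsto_0[OF saB nB BB0])
  have nBk: "norm (op_power B k x) \<le> norm x" for k x
  proof (induction k)
    case (Suc k)
    have "norm (B (op_power B k x)) \<le> norm (op_power B k x)"
      using norm_blinfun[of B "op_power B k x"] mult_right_mono[OF nB, of "norm (op_power B k x)"]
      by simp
    with Suc show ?case by simp
  qed simp
  have CV: "Cauchy (\<lambda>n. V n x)" for x
    using LIMSEQ_imp_Cauchy[OF B0[of x]] unfolding Cauchy_def dist_norm Vn .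
  have "norm (V n x) \<le> 2 * norm x" for n x
    unfolding V0 using norm_triangle_ineq4[of x "op_power B (2 * n) x"] nBk[of "2 * n" x] by linarith
  from strong_limit_exists[OF CV this] obtain W where W: "\<And>x. (\<lambda>n. V n x) \<longlonglongrightarrow> blinfun_apply W x"
    by blast
  have iso: "norm (W x) = norm x" for x
  proof -
    have "(\<lambda>n. norm (V n x)) \<longlonglongrightarrow> norm (x - 0)"
      unfolding V0 by (intro tendsto_intros B0)
    then show ?thesis
      using LIMSEQ_unique[OF tendsto_norm[OF W]] by simp
  qed
  have saG: "self_adjoint (G n)" for n
    unfolding G_def
    by (intro self_adjoint_sum self_adjoint_op_power saB)
  have saV: "self_adjoint (V n)" for n
    unfolding V_def
  proof (intro self_adjoint_compose X R saG)
    show *: "R o\<^sub>L G n = G n o\<^sub>L R"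
      by (rule Gcomm) (rule HOL.sym[OF Rcomm[OF HOL.refl]])
    show "X o\<^sub>L (R o\<^sub>L G n) = R o\<^sub>L G n o\<^sub>L X"
      by (intro commute_compose Rcomm Gcomm XB)
  qed
  have saW: "self_adjoint W"
    by (rule self_adjoint_limit[OF saV W])
  show thesis
  proof (rule that[OF saW])
    show "W o\<^sub>L W = id_blinfun"
    proof -
      \<comment> \<open>\<open>W\<close> is isometric, so the quadratic form of \<open>D\<close>
        vanishes. Testing it on \<open>D x + x\<close> leaves only the mixed terms and forces D x =
        0.\<close>
      define D where "D = (W o\<^sub>L W) - id_blinfun"
      have D: "self_adjoint D"
        unfolding D_def by (intro self_adjoint_diff self_adjoint_compose saW self_adjoint_id HOL.refl)
      have z: "inner (D x) x = 0" for x
        using self_adjoint_norm[OF saW, of x]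
        by (simp add: iso D_def blinfun.diff_left cinner_diff_left cinner_self flip: Re_cinner)
      have "D x = 0" for x
      proof -
        have "inner (D (D x)) x = inner (D x) (D x)"
          by (metis Re_cinner D self_adjointD)
        then have "inner (D (D x + x)) (D x + x) = 2 * inner (D x) (D x)"
          using z[of x] z[of "D x"] by (simp add: blinfun.add_right inner_add)
        with z[of "D x + x"] show ?thesis by simp
      qed
      then have "D = 0"
        by (auto intro: blinfun_eqI)
      then show ?thesis
        by (simp add: D_def)
    qed
    fix S T
    assume ST: "S o\<^sub>L X = X o\<^sub>L T" "T o\<^sub>L (X o\<^sub>L X) = (X o\<^sub>L X) o\<^sub>L T"
    then have TB: "T o\<^sub>L B = B o\<^sub>L T"
      by (simp add: B_def compose_linear)
    \<comment> \<open>\<open>R\<close> and \<open>G n\<close> depend on \<open>X\<close> only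
      through its square, with which \<open>T\<close> commutes; the single factor \<open>X\<close>
      is what turns \<open>T\<close> into \<open>S\<close>.\<close>
    have "S o\<^sub>L V n = V n o\<^sub>L T" for n
      unfolding V_def
      by (metis ST(1) Gcomm[OF TB] Rcomm[OF TB] compose_assoc)
    then show "S o\<^sub>L W = W o\<^sub>L T"
      by (rule commute_strong_limit[OF _ W])
  qed
qed


section \<open>Operators on square-summable functions\<close>

lemmas ell2_simps [simp] = zero_ell2.rep_eq plus_ell2.rep_eq uminus_ell2.rep_eq minus_ell2.rep_eq
  scaleC_ell2.rep_eq scaleR_ell2.rep_eq

lemma ell2_eqI: "(\<And>x. ell2_apply f x = ell2_apply g x) \<Longrightarrow> f = g"
  by (metis ell2_apply_inject ext)

lemma ell2_apply_sum [simp]: "ell2_apply (\<Sum>i\<in>I. f i) x = (\<Sum>i\<in>I. ell2_apply (f i) x)"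
  by (induction I rule: infinite_finite_induct) auto

lemma cinner_point_mass_right [simp]: "cinner f (point_mass k) = ell2_apply f k"
proof -
  have "(\<Sum>\<^sub>\<infinity>x. ell2_apply f x * cnj (ell2_apply (point_mass k) x)) = (\<Sum>\<^sub>\<infinity>x\<in>{k}. ell2_apply f x)"
    by (rule infsum_cong_neutral) (auto simp: point_mass.rep_eq)
  then show ?thesis
    by (simp add: cinner_ell2_def)
qed

lemma cinner_point_mass_left [simp]: "cinner (point_mass k) f = cnj (ell2_apply f k)"
  by (metis cinner_commute cinner_point_mass_right)

lemma norm_point_mass [simp]: "norm (point_mass k) = 1"
proof -
  have "complex_of_real ((norm (point_mass k :: 'a ell2))\<^sup>2) = of_real 1"
    by (subst cinner_self[symmetric]) (simp add: point_mass.rep_eq)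
  then have "(norm (point_mass k :: 'a ell2))\<^sup>2 = 1"
    by (simp only: of_real_eq_iff)
  then show ?thesis
    using norm_ge_zero[of "point_mass k :: 'a ell2"] by (simp add: power2_eq_1_iff del: norm_ge_zero)
qed

lemma ell2_finite_approx:
  assumes "e > 0"
  obtains F where "finite F" "norm (f - (\<Sum>k\<in>F. ell2_apply f k *\<^sub>C point_mass k)) < e"
proof -
  define p where "p F = (\<Sum>k\<in>F. ell2_apply f k *\<^sub>C point_mass k)" for F
  have norm_p: "(norm (f - p F))\<^sup>2 = (norm f)\<^sup>2 - (\<Sum>k\<in>F. (cmod (ell2_apply f k))\<^sup>2)" if "finite F" for F
  proof -
    have app: "ell2_apply (p F) x = (if x \<in> F then ell2_apply f x else 0)" for x
      using that by (simp add: p_def point_mass.rep_eq if_distrib sum.delta cong: if_cong)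
    have sq: "ell2_apply f k * cnj (ell2_apply f k) = of_real ((cmod (ell2_apply f k))\<^sup>2)" for k
      by (simp only: complex_norm_square)
    have "cinner (p F) (p F) = (\<Sum>k\<in>F. of_real ((cmod (ell2_apply f k))\<^sup>2))"
      by (subst (1) p_def) (auto simp: cinner_sum_left cinner_scaleC_left app sq intro!: sum.cong)
    moreover have "cinner (p F) f = (\<Sum>k\<in>F. of_real ((cmod (ell2_apply f k))\<^sup>2))"
      by (subst p_def) (auto simp: cinner_sum_left cinner_scaleC_left sq)
    ultimately have "inner (p F) (p F) = (\<Sum>k\<in>F. (cmod (ell2_apply f k))\<^sup>2)"
      "inner (p F) f = (\<Sum>k\<in>F. (cmod (ell2_apply f k))\<^sup>2)"
      by (simp_all flip: Re_cinner of_real_sum)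
    then show ?thesis
      by (simp add: power2_norm_eq_inner inner_diff inner_commute)
  qed
  have "\<exists>F. finite F \<and> (norm f)\<^sup>2 - e\<^sup>2 < (\<Sum>k\<in>F. (cmod (ell2_apply f k))\<^sup>2)"
  proof (rule ccontr)
    assume "\<not> ?thesis"
    then have "(norm f)\<^sup>2 \<le> (norm f)\<^sup>2 - e\<^sup>2"
      unfolding norm_ell2_squared[of f] using square_summable_ell2[of f]
      by (intro infsum_le_finite_sums) (auto simp: not_less square_summable_def)
    with assms show False by simp
  qed
  then obtain F where F: "finite F" "(norm (f - p F))\<^sup>2 < e\<^sup>2"
    using norm_p by fastforce
  with assms have "norm (f - p F) < e"
    by (simp add: power_less_imp_less_base)
  with F(1) that show thesis
    unfolding p_def by blast
qed

text \<open>Finite combinations of point masses are dense. Identities and limits that are linear and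
  closed in \<open>f\<close> thus need checking on single group elements only.\<close>

lemma ell2_closed_induct:
  assumes "closed {f. P f}" "P 0" "\<And>f g. P f \<Longrightarrow> P g \<Longrightarrow> P (f + g)" "\<And>c f. P f \<Longrightarrow> P (c *\<^sub>C f)"
    and point: "\<And>k. P (point_mass k)"
  shows "P f"
proof -
  have "P (\<Sum>k\<in>F. g k *\<^sub>C point_mass k)" for F g
    by (induction F rule: infinite_finite_induct) (auto intro: assms)
  then have "\<exists>y\<in>{f. P f}. dist y f < e" if "e > 0" for e
    by (metis ell2_finite_approx[OF that, of f] dist_norm dist_commute mem_Collect_eq)
  then have "f \<in> closure {f. P f}"
    by (simp add: closure_approachable)
  then show ?thesis
    using assms(1) by simp
qed

lemma continuous_on_blinfun_apply: "continuous_on S (blinfun_apply T)"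
  by (simp add: blinfun.bounded_linear_right linear_continuous_on)

lemma ell2_op_eqI:
  fixes S T :: "'a ell2 \<Rightarrow>\<^sub>L 'a ell2"
  assumes "S \<in> bounded_ops" "T \<in> bounded_ops" "\<And>k. S (point_mass k) = T (point_mass k)"
  shows "S = T"
proof (rule blinfun_eqI)
  fix f show "S f = T f"
    by (rule ell2_closed_induct[where P = "\<lambda>f. S f = T f"])
      (auto simp: blinfun.add_right bounded_opsD[OF assms(1)] bounded_opsD[OF assms(2)] assms(3)
        intro!: closed_Collect_eq continuous_on_blinfun_apply)
qed

subsection \<open>Adjoints\<close>

lemma adj_eqI:
  fixes S T :: "'h::complex_hilbert \<Rightarrow>\<^sub>L 'h"
  assumes "S \<in> bounded_ops" "\<And>x y. cinner (T x) y = cinner x (S y)"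
  shows "adj T = S"
  unfolding adj_def
proof (rule the_equality)
  fix S' assume S': "S' \<in> bounded_ops \<and> (\<forall>x y. cinner (T x) y = cinner x (S' y))"
  show "S' = S"
    by (intro blinfun_eqI cinner_ext) (metis S' assms(2) cinner_commute)
qed (use assms in auto)

lemma self_adjoint_adj: "self_adjoint T \<Longrightarrow> adj T = T"
  by (intro adj_eqI self_adjoint_bounded_ops) (auto simp: self_adjointD)

text \<open>The coordinates of \<open>T\<^sup>* y\<close> are \<open>\<langle>y, T \<delta>\<^sub>k\<rangle>\<close>.\<close>

lemma adj_exists:
  fixes T :: "'a ell2 \<Rightarrow>\<^sub>L 'a ell2"
  assumes T: "T \<in> bounded_ops"
  shows "adj T \<in> bounded_ops \<and> (\<forall>x y. cinner (T x) y = cinner x (adj T y))"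
proof -
  define s where "s y k = cinner y (T (point_mass k))" for y k
  have bound: "(\<Sum>k\<in>F. (cmod (s y k))\<^sup>2) \<le> (norm T * norm y)\<^sup>2" if F: "finite F" for F y
  proof -
    \<comment> \<open>The truncation of \<open>s y\<close> to \<open>F\<close> serves as test
      vector: its squared norm equals the inner product of \<open>y\<close> with \<open>T g\<close>,
      hence is at most a constant times the norm of \<open>g\<close>. Cancelling one factor bounds
      the partial sums uniformly in \<open>F\<close>.\<close>
    define g where "g = (\<Sum>k\<in>F. s y k *\<^sub>C point_mass k)"
    define q where "q = (\<Sum>k\<in>F. (cmod (s y k))\<^sup>2)"
    have q0: "q \<ge> 0"
      unfolding q_def by (intro sum_nonneg) auto
    have app: "ell2_apply g k = (if k \<in> F then s y k else 0)" for k
      using F by (simp add: g_def point_mass.rep_eq if_distrib sum.delta cong: if_cong)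
    have sq: "s y k * cnj (s y k) = of_real ((cmod (s y k))\<^sup>2)" for k
      by (simp only: complex_norm_square)
    have "cinner g g = of_real q"
      by (subst (1) g_def) (auto simp: cinner_sum_left cinner_scaleC_left app sq q_def intro!: sum.cong)
    then have gq: "(norm g)\<^sup>2 = q"
      by (simp only: cinner_self of_real_eq_iff)
    have "T g = (\<Sum>k\<in>F. s y k *\<^sub>C T (point_mass k))"
      by (simp add: g_def blinfun.sum_right bounded_opsD[OF T])
    then have "cinner y (T g) = (\<Sum>k\<in>F. s y k * cnj (s y k))"
      by (simp add: cinner_sum_right cinner_scaleC_right s_def mult.commute)
    then have "cinner y (T g) = of_real q"
      by (simp only: sq q_def of_real_sum)
    then have "q = cmod (cinner y (T g))"
      using q0 by simp
    also have "\<dots> \<le> norm y * (norm T * norm g)"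
      by (meson norm_cinner_le norm_blinfun order_trans mult_left_mono norm_ge_zero)
    finally have "(norm g)\<^sup>2 \<le> (norm T * norm y) * norm g"
      by (simp add: gq mult_ac)
    then have "norm g \<le> norm T * norm y"
      by (cases "norm g = 0") (auto simp: power2_eq_square)
    then show ?thesis
      unfolding q_def[symmetric] gq[symmetric] by (intro power_mono) auto
  qed
  define S where "S y = Abs_ell2 (s y)" for y
  have Sapp: "ell2_apply (S y) k = s y k" for y k
    using ell2_from_finite_bounds(1)[OF bound] by (simp add: S_def Abs_ell2_inverse)
  have nS: "norm (S y) \<le> norm y * norm T" for y
    using ell2_from_finite_bounds(2)[OF bound, of y] unfolding S_def
    by (metis mult.commute norm_ge_zero power2_le_imp_le zero_le_mult_iff)
  have "bounded_linear S"
  proof (rule bounded_linear_intro[OF _ _ nS])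
    show "S (x + y) = S x + S y" for x y
      by (rule ell2_eqI) (simp add: Sapp s_def cinner_add_left)
    show "S (r *\<^sub>R x) = r *\<^sub>R S x" for r x
      by (rule ell2_eqI) (simp add: Sapp s_def cinner_scaleC_left flip: scaleC_of_real)
  qed
  then have BS: "blinfun_apply (Blinfun S) = S"
    by (rule bounded_linear_Blinfun_apply)
  have "Blinfun S \<in> bounded_ops"
    unfolding bounded_ops_def mem_Collect_eq BS
    by (intro allI ell2_eqI) (simp add: Sapp s_def cinner_scaleC_left)
  moreover have "cinner (T x) y = cinner x (S y)" for x y
  proof (rule ell2_closed_induct[where P = "\<lambda>x. cinner (T x) y = cinner x (S y)"])
    show "closed {x. cinner (T x) y = cinner x (S y)}"
      by (intro closed_Collect_eq continuous_on_cinner continuous_on_blinfun_apply continuous_on_const continuous_on_id)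
    show "cinner (T (point_mass k)) y = cinner (point_mass k) (S y)" for k
      by (simp add: Sapp s_def) (metis cinner_commute)
  qed (auto simp: cinner_add_left cinner_scaleC_left blinfun.add_right bounded_opsD[OF T])
  ultimately show ?thesis
    using adj_eqI[of "Blinfun S" T] by (simp add: BS)
qed

lemma adj_bounded_ops [simp]: "T \<in> bounded_ops \<Longrightarrow> adj T \<in> bounded_ops"
  for T :: "'a ell2 \<Rightarrow>\<^sub>L 'a ell2"
  using adj_exists by blast

lemma cinner_adj_right: "T \<in> bounded_ops \<Longrightarrow> cinner x (adj T y) = cinner (T x) y"
  for T :: "'a ell2 \<Rightarrow>\<^sub>L 'a ell2"
  using adj_exists[of T] by simp

lemma cinner_adj_left: "T \<in> bounded_ops \<Longrightarrow> cinner (adj T x) y = cinner x (T y)"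
  for T :: "'a ell2 \<Rightarrow>\<^sub>L 'a ell2"
  by (metis cinner_adj_right cinner_commute)

lemma adj_adj [simp]: "T \<in> bounded_ops \<Longrightarrow> adj (adj T) = T"
  for T :: "'a ell2 \<Rightarrow>\<^sub>L 'a ell2"
  by (rule adj_eqI) (auto simp: cinner_adj_left)

lemma adj_compose: "S \<in> bounded_ops \<Longrightarrow> T \<in> bounded_ops \<Longrightarrow> adj (S o\<^sub>L T) = adj T o\<^sub>L adj S"
  for T :: "'a ell2 \<Rightarrow>\<^sub>L 'a ell2"
  by (rule adj_eqI) (auto simp: cinner_adj_right intro: bounded_ops_compose)

lemma adj_id [simp]: "adj id_blinfun = id_blinfun"
  by (rule adj_eqI) auto

lemma adj_zero [simp]: "adj 0 = 0"
  by (rule adj_eqI) auto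

lemma norm_adj_le:
  fixes T :: "'a ell2 \<Rightarrow>\<^sub>L 'a ell2"
  assumes T: "T \<in> bounded_ops"
  shows "norm (adj T) \<le> norm T"
proof (rule norm_blinfun_bound)
  fix x
  have "(norm (adj T x))\<^sup>2 = cmod (cinner (T (adj T x)) x)"
    using arg_cong[OF cinner_self[of "adj T x"], of cmod]
    by (simp add: cinner_adj_right[OF T] norm_power)
  also have "\<dots> \<le> (norm T * norm (adj T x)) * norm x"
    by (meson norm_cinner_le norm_blinfun order_trans mult_right_mono norm_ge_zero)
  finally show "norm (adj T x) \<le> norm T * norm x"
    by (cases "norm (adj T x) = 0") (auto simp: power2_eq_square mult_ac)
qed simp

subsection \<open>Restriction to a subset\<close>

lift_definition restrict_ell2 :: "'a set \<Rightarrow> 'a ell2 \<Rightarrow> 'a ell2" is "\<lambda>C f x. if x \<in> C then f x else 0"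
proof -
  fix C :: "'a set" and f :: "'a \<Rightarrow> complex"
  assume "square_summable f"
  then show "square_summable (\<lambda>x. if x \<in> C then f x else 0)"
    unfolding square_summable_def by (rule summable_on_comparison_test) auto
qed

lemma norm_restrict_ell2: "norm (restrict_ell2 C f) \<le> norm f"
proof -
  have "(norm (restrict_ell2 C f))\<^sup>2 \<le> (norm f)\<^sup>2"
    unfolding norm_ell2_squared
    using square_summable_ell2[of f] square_summable_ell2[of "restrict_ell2 C f"]
    by (intro infsum_mono) (auto simp: restrict_ell2.rep_eq square_summable_def)
  then show ?thesis by simp
qed

lift_definition restrict_op :: "'a set \<Rightarrow> 'a ell2 \<Rightarrow>\<^sub>L 'a ell2" is restrict_ell2
  by (rule bounded_linear_intro[where K = 1])
    (auto intro!: ell2_eqI simp: restrict_ell2.rep_eq norm_restrict_ell2)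

lemma restrict_op_apply [simp]:
  "ell2_apply (restrict_op C f) x = (if x \<in> C then ell2_apply f x else 0)"
  by (simp add: restrict_op.rep_eq restrict_ell2.rep_eq)

lemma norm_restrict_op: "norm (restrict_op C f) \<le> norm f"
  by (simp add: restrict_op.rep_eq norm_restrict_ell2)

lemma self_adjoint_restrict_op: "self_adjoint (restrict_op C)"
  unfolding self_adjoint_def cinner_ell2_def by (auto intro!: infsum_cong)

lemma restrict_op_bounded_ops [simp]: "restrict_op C \<in> bounded_ops"
  by (rule self_adjoint_bounded_ops[OF self_adjoint_restrict_op])

lemma restrict_op_point_mass: "restrict_op C (point_mass k) = (if k \<in> C then point_mass k else 0)"
  by (rule ell2_eqI) (auto simp: point_mass.rep_eq)

lemma restrict_op_restrict_op [simp]: "restrict_op C (restrict_op D f) = restrict_op (C \<inter> D) f"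
  by (rule ell2_eqI) auto

lemma restrict_op_pythagoras:
  "(norm f)\<^sup>2 = (norm (restrict_op C f))\<^sup>2 + (norm (f - restrict_op C f))\<^sup>2"
proof -
  have "inner (restrict_op C f) f = inner (restrict_op C f) (restrict_op C f)"
    using self_adjointD[OF self_adjoint_restrict_op, of C "restrict_op C f" f]
    by (simp flip: Re_cinner)
  then show ?thesis
    by (simp add: power2_norm_eq_inner inner_diff inner_commute)
qed

lemma restrict_op_disjoint_sum:
  assumes "finite I" "disjoint_family_on C I"
  shows "(\<Sum>i\<in>I. (norm (restrict_op (C i) f))\<^sup>2) = (norm (restrict_op (\<Union>i\<in>I. C i) f))\<^sup>2"
    and "(\<Sum>i\<in>I. restrict_op (C i) f) = restrict_op (\<Union>i\<in>I. C i) f"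
proof -
  show eq: "(\<Sum>i\<in>I. restrict_op (C i) f) = restrict_op (\<Union>i\<in>I. C i) f"
    using assms
  proof (induction I rule: finite_induct)
    case (insert i I)
    then have IH: "(\<Sum>i\<in>I. restrict_op (C i) f) = restrict_op (\<Union>i\<in>I. C i) f"
      by (intro insert.IH) (auto simp: disjoint_family_on_def)
    have "C i \<inter> C j = {}" if "j \<in> I" for j
      using disjoint_family_onD[OF insert.prems, of i j] insert.hyps(2) that by auto
    then have "x \<notin> C i" if "x \<in> C j" "j \<in> I" for x j
      using that by blast
    then show ?case
      unfolding sum.insert[OF insert(1,2)] IH by (intro ell2_eqI) auto
  next
    case empty
    show ?case by (rule ell2_eqI) simp
  qed
  have "norm (\<Sum>i\<in>I. restrict_op (C i) f) ^ 2 = (\<Sum>i\<in>I. (norm (restrict_op (C i) f))\<^sup>2)"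
  proof (rule norm_sum_Pythagorean[OF assms(1)])
    show "pairwise (\<lambda>i j. orthogonal (restrict_op (C i) f) (restrict_op (C j) f)) I"
    proof (rule pairwiseI)
      fix i j assume ij: "i \<in> I" "j \<in> I" "i \<noteq> j"
      have "cinner (restrict_op (C i) f) (restrict_op (C j) f) = cinner f (restrict_op (C i \<inter> C j) f)"
        by (simp add: self_adjointD[OF self_adjoint_restrict_op])
      also have "restrict_op (C i \<inter> C j) f = 0"
        using disjoint_family_onD[OF assms(2) ij] by (intro ell2_eqI) simp
      finally show "orthogonal (restrict_op (C i) f) (restrict_op (C j) f)"
        by (simp add: orthogonal_def flip: Re_cinner)
    qed
  qed
  with eq show "(\<Sum>i\<in>I. (norm (restrict_op (C i) f))\<^sup>2) = (norm (restrict_op (\<Union>i\<in>I. C i) f))\<^sup>2"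
    by simp
qed

lemma restrict_op_disjoint_bound:
  assumes "finite I" "disjoint_family_on C I"
  shows "(\<Sum>i\<in>I. (norm (restrict_op (C i) f))\<^sup>2) \<le> (norm f)\<^sup>2"
  unfolding restrict_op_disjoint_sum(1)[OF assms] by (intro power_mono norm_restrict_op) simp

text \<open>Bessel's inequality makes the squared norms summable. The masa property, the mixing
  estimate and both injectivity arguments for signs rest on this: each produces a sequence of
  disjoint sets and compares the masses on them.\<close>

lemma restrict_op_disjoint_tendsto:
  fixes C :: "nat \<Rightarrow> 'a set"
  assumes "disjoint_family C"
  shows "(\<lambda>n. norm (restrict_op (C n) f)) \<longlonglongrightarrow> 0"
proof -
  have "summable (\<lambda>n. (norm (restrict_op (C n) f))\<^sup>2)"
    using restrict_op_disjoint_bound[OF _ disjoint_family_on_mono[OF _ assms], of _ f]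
    by (intro summableI_nonneg_bounded[where x = "(norm f)\<^sup>2"]) auto
  then have "(\<lambda>n. sqrt ((norm (restrict_op (C n) f))\<^sup>2)) \<longlonglongrightarrow> sqrt 0"
    by (intro tendsto_real_sqrt summable_LIMSEQ_zero)
  then show ?thesis by simp
qed

section \<open>Commutants\<close>

lemma commutant_bounded_ops: "T \<in> commutant S \<Longrightarrow> T \<in> bounded_ops"
  by (simp add: commutant_def)

lemma commutantD: "T \<in> commutant S \<Longrightarrow> s \<in> S \<Longrightarrow> T o\<^sub>L s = s o\<^sub>L T"
  by (simp add: commutant_def)

lemma commutantI: "T \<in> bounded_ops \<Longrightarrow> (\<And>s. s \<in> S \<Longrightarrow> T o\<^sub>L s = s o\<^sub>L T) \<Longrightarrow> T \<in> commutant S"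
  by (simp add: commutant_def)

lemma commutant_antimono: "S \<subseteq> S' \<Longrightarrow> commutant S' \<subseteq> commutant S"
  by (auto simp: commutant_def)

lemma subset_bicommutant: "S \<subseteq> bounded_ops \<Longrightarrow> S \<subseteq> commutant (commutant S)"
  by (auto simp: commutant_def)

lemma tricommutant: "S \<subseteq> bounded_ops \<Longrightarrow> commutant (commutant (commutant S)) = commutant S"
  by (metis commutant_antimono commutant_bounded_ops subsetI subset_antisym subset_bicommutant)

lemma commutant_id [simp]: "id_blinfun \<in> commutant S"
  by (simp add: commutant_def)

lemma commutant_zero [simp]: "0 \<in> commutant S"
  by (simp add: commutant_def compose_linear)

lemma commutant_add: "R \<in> commutant S \<Longrightarrow> T \<in> commutant S \<Longrightarrow> R + T \<in> commutant S"
  by (simp add: commutant_def compose_linear bounded_ops_add)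

lemma commutant_diff: "R \<in> commutant S \<Longrightarrow> T \<in> commutant S \<Longrightarrow> R - T \<in> commutant S"
  by (simp add: commutant_def compose_linear bounded_ops_diff)

lemma commutant_compose: "R \<in> commutant S \<Longrightarrow> T \<in> commutant S \<Longrightarrow> R o\<^sub>L T \<in> commutant S"
  by (auto simp: commutant_def bounded_ops_compose) (metis compose_assoc)

lemma compose_scaleC_left: "(c *\<^sub>C S) o\<^sub>L T = c *\<^sub>C (S o\<^sub>L T)"
  by (rule blinfun_eqI) (simp add: scaleC_blinfun.rep_eq)

lemma compose_scaleC_right: "S \<in> bounded_ops \<Longrightarrow> S o\<^sub>L (c *\<^sub>C T) = c *\<^sub>C (S o\<^sub>L T)"
  by (rule blinfun_eqI) (simp add: scaleC_blinfun.rep_eq bounded_opsD)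

lemma commutant_scaleC: "S \<subseteq> bounded_ops \<Longrightarrow> T \<in> commutant S \<Longrightarrow> c *\<^sub>C T \<in> commutant S"
  by (auto simp: commutant_def bounded_ops_scaleC compose_scaleC_left compose_scaleC_right)

lemma commutant_adj:
  fixes S :: "('a ell2 \<Rightarrow>\<^sub>L 'a ell2) set"
  assumes "S \<subseteq> bounded_ops" "\<And>s. s \<in> S \<Longrightarrow> adj s \<in> S" "T \<in> commutant S"
  shows "adj T \<in> commutant S"
proof (rule commutantI)
  fix s assume s: "s \<in> S"
  with assms have sT: "s \<in> bounded_ops" "T \<in> bounded_ops"
    by (auto dest: commutant_bounded_ops)
  have "adj (T o\<^sub>L adj s) = adj (adj s o\<^sub>L T)"
    using commutantD[OF assms(3) assms(2)[OF s]] by simp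
  then show "adj T o\<^sub>L s = s o\<^sub>L adj T"
    by (simp add: adj_compose sT)
qed (use assms(3) in \<open>auto dest: commutant_bounded_ops\<close>)

text \<open>Adjoints are put in by hand, since the commutant of a self-adjoint set is again
  self-adjoint. Minimality holds because every competing \<open>N\<close> is its own
  bicommutant.\<close>

lemma generated_vna_eq_bicommutant:
  fixes S :: "('a ell2 \<Rightarrow>\<^sub>L 'a ell2) set"
  assumes S: "S \<subseteq> bounded_ops"
  shows "generated_vna S = commutant (commutant (S \<union> adj ` S))"
proof -
  let ?S = "S \<union> adj ` S"
  have bo: "?S \<subseteq> bounded_ops"
    using S by auto
  have ad: "adj s \<in> ?S" if "s \<in> ?S" for s
    using that S by auto
  have c: "commutant ?S \<subseteq> bounded_ops"
    by (auto dest: commutant_bounded_ops)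
  have "adj T \<in> commutant (commutant ?S)" if "T \<in> commutant (commutant ?S)" for T
    using that by (intro commutant_adj[OF c] commutant_adj[OF bo ad])
  then have "von_neumann_algebra (commutant (commutant ?S))"
    unfolding von_neumann_algebra_def by (auto simp: tricommutant[OF bo])
  moreover have "S \<subseteq> commutant (commutant ?S)"
    using subset_bicommutant[OF bo] by auto
  moreover have "commutant (commutant ?S) \<subseteq> N" if "von_neumann_algebra N" "S \<subseteq> N" for N
  proof -
    have "?S \<subseteq> N"
      using that by (auto simp: von_neumann_algebra_def)
    then have "commutant (commutant ?S) \<subseteq> commutant (commutant N)"
      by (intro commutant_antimono)
    with that show ?thesis
      by (simp add: von_neumann_algebra_def)
  qed
  ultimately show ?thesis
    unfolding generated_vna_def by blast
qed

section \<open>Convolution operators\<close>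

lemma left_regular_apply [simp]: "ell2_apply (left_regular g f) h = ell2_apply f (- g + h)"
  by (simp add: left_regular.rep_eq left_translate.rep_eq)

lemma left_regular_bounded_ops [simp]: "left_regular g \<in> bounded_ops"
  by (auto simp: bounded_ops_def intro: ell2_eqI)

lemma left_regular_point_mass: "left_regular g (point_mass k) = point_mass (g + k)"
proof (rule ell2_eqI)
  show "ell2_apply (left_regular g (point_mass k)) h = ell2_apply (point_mass (g + k)) h" for h
    using add.assoc[of g "- g" h] by (auto simp: point_mass.rep_eq add.assoc[symmetric])
qed

lemma left_regular_add: "left_regular (g + h) = left_regular g o\<^sub>L left_regular h"
  by (rule ell2_op_eqI)
    (auto simp: left_regular_point_mass add.assoc intro: bounded_ops_compose)

lemma left_regular_zero [simp]: "left_regular 0 = id_blinfun"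
  by (rule ell2_op_eqI) (auto simp: left_regular_point_mass)

lemma norm_left_regular_apply [simp]: "norm (left_regular g f) = norm f"
  by (simp add: left_regular.rep_eq norm_left_translate)

lemma bij_plus_left: "bij (\<lambda>h. g + h)" for g :: "'g::group_add"
  by (rule bij_betwI[where g = "\<lambda>h. - g + h"]) (auto simp: add.assoc[symmetric])

lemma bij_plus_right: "bij (\<lambda>h. h + g)" for g :: "'g::group_add"
  by (rule bij_betwI[where g = "\<lambda>h. h - g"]) auto

lemma adj_left_regular [simp]: "adj (left_regular g) = left_regular (- g)"
proof (rule adj_eqI)
  fix x y :: "'a ell2"
  have "cinner (left_regular g x) y =
      (\<Sum>\<^sub>\<infinity>h. ell2_apply x (- g + (g + h)) * cnj (ell2_apply y (g + h)))"
    unfolding cinner_ell2_def left_regular_apply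
    by (rule infsum_reindex_bij_betw[OF bij_plus_left, symmetric])
  also have "\<dots> = cinner x (left_regular (- g) y)"
    by (simp add: cinner_ell2_def add.assoc[symmetric])
  finally show "cinner (left_regular g x) y = cinner x (left_regular (- g) y)" .
qed simp

section \<open>Right translations and the operators commuting with them\<close>

lift_definition right_translate :: "'g::group_add \<Rightarrow> 'g ell2 \<Rightarrow> 'g ell2"
  is "\<lambda>g f h. f (h + g)"
proof -
  fix g :: 'g and f :: "'g \<Rightarrow> complex"
  assume "square_summable f"
  then show "square_summable (\<lambda>h. f (h + g))"
    using summable_on_reindex_bij_betw[OF bij_plus_right, of "\<lambda>x. (cmod (f x))\<^sup>2" g]
    by (simp add: square_summable_def)
qed

lemma norm_right_translate: "norm (right_translate g f) = norm f"
proof -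
  have "(norm (right_translate g f))\<^sup>2 = (norm f)\<^sup>2"
    using infsum_reindex_bij_betw[OF bij_plus_right, of "\<lambda>x. (cmod (ell2_apply f x))\<^sup>2" g]
    by (simp add: norm_ell2_squared right_translate.rep_eq)
  then show ?thesis by simp
qed

lift_definition right_regular :: "'g::group_add \<Rightarrow> 'g ell2 \<Rightarrow>\<^sub>L 'g ell2" is right_translate
proof (rule bounded_linear_intro[where K = 1])
  fix g :: 'g and f h :: "'g ell2" and r :: real
  show "right_translate g (f + h) = right_translate g f + right_translate g h" by transfer simp
  show "right_translate g (r *\<^sub>R f) = r *\<^sub>R right_translate g f" by transfer simp
  show "norm (right_translate g f) \<le> norm f * 1" by (simp add: norm_right_translate)
qed

lemma right_regular_apply [simp]: "ell2_apply (right_regular g f) h = ell2_apply f (h + g)"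
  by (simp add: right_regular.rep_eq right_translate.rep_eq)

lemma norm_right_regular [simp]: "norm (right_regular g f) = norm f"
  by (simp add: right_regular.rep_eq norm_right_translate)

lemma right_regular_bounded_ops [simp]: "right_regular g \<in> bounded_ops"
  by (auto simp: bounded_ops_def intro: ell2_eqI)

lemma right_regular_point_mass: "right_regular g (point_mass k) = point_mass (k - g)"
  by (rule ell2_eqI) (auto simp: point_mass.rep_eq eq_diff_eq)

lemma left_right_commute: "left_regular g o\<^sub>L right_regular h = right_regular h o\<^sub>L left_regular g"
  by (rule blinfun_eqI, rule ell2_eqI) (simp add: add.assoc)

text \<open>Every point mass is a right translate of the one at 0, so the whole matrix of
  \<open>T\<close> is determined by its column at 0.\<close>

lemma convolver_point_mass:
  assumes "T \<in> commutant (range right_regular)"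
  shows "ell2_apply (T (point_mass g)) h = ell2_apply (T (point_mass 0)) (h - g)"
proof -
  have "T (point_mass g) = (T o\<^sub>L right_regular (- g)) (point_mass 0)"
    by (simp add: right_regular_point_mass)
  also have "\<dots> = right_regular (- g) (T (point_mass 0))"
    by (subst commutantD[OF assms]) auto
  finally show ?thesis by simp
qed

lemma diff_minus_plus: "h - (- m + h) = m" for h m :: "'g::group_add"
  by (simp add: diff_conv_add_uminus minus_add add.assoc[symmetric] del: add_uminus_conv_diff)

lemma convolver_apply:
  assumes "T \<in> commutant (range right_regular)"
  shows "ell2_apply (T f) h = (\<Sum>\<^sub>\<infinity>m. ell2_apply f (- m + h) * ell2_apply (T (point_mass 0)) m)"
proof -
  have T: "T \<in> bounded_ops"
    using assms by (rule commutant_bounded_ops)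
  have bij: "bij (\<lambda>m. - m + h)"
    by (rule bij_betwI[where g = "\<lambda>k. h - k"]) (auto simp: diff_minus_plus)
  have "ell2_apply (T f) h = cinner f (adj T (point_mass h))"
    by (simp add: cinner_adj_right[OF T])
  also have "\<dots> = (\<Sum>\<^sub>\<infinity>k. ell2_apply f k * cnj (cinner (adj T (point_mass h)) (point_mass k)))"
    by (simp add: cinner_ell2_def[of f])
  also have "\<dots> = (\<Sum>\<^sub>\<infinity>k. ell2_apply f k * ell2_apply (T (point_mass 0)) (h - k))"
    unfolding cinner_adj_left[OF T] cinner_point_mass_left complex_cnj_cnj
      convolver_point_mass[OF assms, of _ h] ..
  also have "\<dots> = (\<Sum>\<^sub>\<infinity>m. ell2_apply f (- m + h) * ell2_apply (T (point_mass 0)) (h - (- m + h)))"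
    by (rule infsum_reindex_bij_betw[OF bij, symmetric])
  finally show ?thesis
    by (simp add: diff_minus_plus)
qed

text \<open>Formally \<open>T\<close> is the sum of its coefficients times left translations, and
  \<open>S\<close> commutes with each translation that occurs. As this series need not converge in
  operator norm, the identity is verified on matrix entries, where square-summability suffices. The
  restriction to occurring \<open>m\<close> matters: besides the commutant theorem for the full
  group, it yields the description and the commutativity of the cyclic subalgebra.\<close>

lemma convolver_commute:
  assumes T: "T \<in> commutant (range right_regular)"
    and S: "S \<in> bounded_ops" "\<And>m. ell2_apply (T (point_mass 0)) m \<noteq> 0 \<Longrightarrow> S o\<^sub>L left_regular m = left_regular m o\<^sub>L S"
  shows "T o\<^sub>L S = S o\<^sub>L T"
proof (rule ell2_op_eqI)
  have Tb: "T \<in> bounded_ops"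
    using T by (rule commutant_bounded_ops)
  show "T o\<^sub>L S \<in> bounded_ops" "S o\<^sub>L T \<in> bounded_ops"
    using Tb S by (auto intro: bounded_ops_compose)
  fix g
  show "(T o\<^sub>L S) (point_mass g) = (S o\<^sub>L T) (point_mass g)"
  proof (rule ell2_eqI)
    fix h
    let ?t = "ell2_apply (T (point_mass 0))"
    have "ell2_apply (S (T (point_mass g))) h = cinner (T (point_mass g)) (adj S (point_mass h))"
      by (simp add: cinner_adj_right[OF S(1)])
    also have "\<dots> = (\<Sum>\<^sub>\<infinity>k. ?t (k - g) * cnj (cinner (adj S (point_mass h)) (point_mass k)))"
      unfolding cinner_ell2_def[of "T (point_mass g)"] cinner_point_mass_right
        convolver_point_mass[OF T, of g] ..
    also have "\<dots> = (\<Sum>\<^sub>\<infinity>k. ?t (k - g) * ell2_apply (S (point_mass k)) h)"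
      unfolding cinner_adj_left[OF S(1)] cinner_point_mass_left complex_cnj_cnj ..
    also have "\<dots> = (\<Sum>\<^sub>\<infinity>m. ?t (m + g - g) * ell2_apply (S (point_mass (m + g))) h)"
      by (rule infsum_reindex_bij_betw[OF bij_plus_right, symmetric])
    also have "\<dots> = (\<Sum>\<^sub>\<infinity>m. ell2_apply (S (point_mass g)) (- m + h) * ?t m)"
    proof (rule infsum_cong)
      fix m
      have "S (point_mass (m + g)) = left_regular m (S (point_mass g))" if "?t m \<noteq> 0"
        using S(2)[OF that] by (metis blinfun_apply_blinfun_compose left_regular_point_mass)
      then show "?t (m + g - g) * ell2_apply (S (point_mass (m + g))) h
          = ell2_apply (S (point_mass g)) (- m + h) * ?t m"
        by (cases "?t m = 0") auto
    qed
    also have "\<dots> = ell2_apply (T (S (point_mass g))) h"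
      by (rule convolver_apply[OF T, symmetric])
    finally show "ell2_apply ((T o\<^sub>L S) (point_mass g)) h = ell2_apply ((S o\<^sub>L T) (point_mass g)) h"
      by simp
  qed
qed

lemma group_vna_eq_bicommutant: "group_vna = commutant (commutant (range (left_regular :: 'g::group_add \<Rightarrow> _)))"
proof -
  have "adj ` range (left_regular :: 'g \<Rightarrow> _) \<subseteq> range left_regular" by auto
  then have "range left_regular \<union> adj ` range left_regular = range (left_regular :: 'g \<Rightarrow> _)" by blast
  then show ?thesis
    unfolding group_vna_def by (subst generated_vna_eq_bicommutant) auto
qed

theorem group_vna_eq: "group_vna = commutant (range (right_regular :: 'g::group_add \<Rightarrow> _))"
proof -
  let ?L = "range (left_regular :: 'g \<Rightarrow> _)" and ?R = "range (right_regular :: 'g \<Rightarrow> _)"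
  have "?R \<subseteq> commutant ?L"
    by (auto intro!: commutantI simp: left_right_commute)
  then have "commutant (commutant ?L) \<subseteq> commutant ?R"
    by (rule commutant_antimono)
  moreover have "commutant ?R \<subseteq> commutant (commutant ?L)"
  proof
    fix T assume T: "T \<in> commutant ?R"
    show "T \<in> commutant (commutant ?L)"
    proof (rule commutantI)
      fix S assume S: "S \<in> commutant ?L"
      show "T o\<^sub>L S = S o\<^sub>L T"
        by (rule convolver_commute[OF T commutant_bounded_ops[OF S] commutantD[OF S]]) auto
    qed (rule commutant_bounded_ops[OF T])
  qed
  ultimately show ?thesis
    unfolding group_vna_eq_bicommutant by (rule subset_antisym)
qed


lemma adj_right_regular [simp]: "adj (right_regular g) = right_regular (- g)"
proof (rule adj_eqI)
  fix x y :: "'a ell2"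
  have "cinner (right_regular g x) y =
      (\<Sum>\<^sub>\<infinity>h. ell2_apply x ((h - g) + g) * cnj (ell2_apply y (h - g)))"
    using infsum_reindex_bij_betw[OF bij_plus_right, of "\<lambda>h. ell2_apply x (h + g) * cnj (ell2_apply y h)" "- g"]
    by (simp add: cinner_ell2_def)
  also have "\<dots> = cinner x (right_regular (- g) y)"
    by (simp add: cinner_ell2_def)
  finally show "cinner (right_regular g x) y = cinner x (right_regular (- g) y)" .
qed simp

lemma group_vna_bounded_ops: "T \<in> group_vna \<Longrightarrow> T \<in> bounded_ops"
  by (simp add: group_vna_eq commutant_bounded_ops)

lemma right_range_bounded_ops: "range right_regular \<subseteq> bounded_ops"
  by auto

lemma group_vna_id: "id_blinfun \<in> group_vna"
  and group_vna_add: "S \<in> group_vna \<Longrightarrow> T \<in> group_vna \<Longrightarrow> S + T \<in> group_vna"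
  and group_vna_diff: "S \<in> group_vna \<Longrightarrow> T \<in> group_vna \<Longrightarrow> S - T \<in> group_vna"
  and group_vna_compose: "S \<in> group_vna \<Longrightarrow> T \<in> group_vna \<Longrightarrow> S o\<^sub>L T \<in> group_vna"
  and group_vna_scaleC: "T \<in> group_vna \<Longrightarrow> c *\<^sub>C T \<in> group_vna"
  and group_vna_adj: "T \<in> group_vna \<Longrightarrow> adj T \<in> group_vna"
  and group_vna_left_regular: "left_regular g \<in> group_vna"
  unfolding group_vna_eq
  by (auto intro: commutant_add commutant_diff commutant_compose commutant_scaleC commutant_adj
      right_range_bounded_ops commutantI left_right_commute)

lemmas group_vna_closed = group_vna_id group_vna_add group_vna_diff group_vna_compose
  group_vna_scaleC group_vna_adj group_vna_left_regular

section \<open>Fourier coefficients, trace and 2-norm\<close>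

abbreviation coeff :: "('g::group_add ell2 \<Rightarrow>\<^sub>L 'g ell2) \<Rightarrow> 'g \<Rightarrow> complex" where
  "coeff T \<equiv> ell2_apply (T (point_mass 0))"

lemma coeff_adj:
  assumes "T \<in> group_vna"
  shows "coeff (adj T) h = cnj (coeff T (- h))"
proof -
  have "coeff (adj T) h = cinner (adj T (point_mass 0)) (point_mass h)"
    by simp
  also have "\<dots> = cnj (ell2_apply (T (point_mass h)) 0)"
    unfolding cinner_adj_left[OF group_vna_bounded_ops[OF assms]] by simp
  also have "\<dots> = cnj (coeff T (- h))"
    using convolver_point_mass[of T h 0] assms by (simp add: group_vna_eq)
  finally show ?thesis .
qed

lemma group_vna_eqI:
  assumes "S \<in> group_vna" "T \<in> group_vna" "S (point_mass 0) = T (point_mass 0)"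
  shows "S = T"
proof (rule ell2_op_eqI)
  show "S (point_mass k) = T (point_mass k)" for k
    using assms convolver_point_mass[of S k] convolver_point_mass[of T k]
    by (intro ell2_eqI) (simp add: group_vna_eq)
qed (use assms in \<open>auto dest: group_vna_bounded_ops\<close>)

lemma bij_uminus: "bij (uminus :: 'g::group_add \<Rightarrow> 'g)"
  by (rule bij_betwI[where g = "\<lambda>h. - h"]) auto

lemma norm_adj_point_mass:
  assumes "T \<in> group_vna"
  shows "norm (adj T (point_mass 0)) = norm (T (point_mass 0))"
proof -
  have "(norm (adj T (point_mass 0)))\<^sup>2 = (norm (T (point_mass 0)))\<^sup>2"
    using infsum_reindex_bij_betw[OF bij_uminus, of "\<lambda>h. (cmod (coeff T h))\<^sup>2"]
    by (simp add: norm_ell2_squared coeff_adj[OF assms])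
  then show ?thesis by simp
qed

lemma group_trace_eq: "group_trace T = coeff T 0"
  by (simp add: group_trace_def)

lemma group_trace_compose:
  assumes "S \<in> group_vna" "T \<in> group_vna"
  shows "group_trace (S o\<^sub>L T) = (\<Sum>\<^sub>\<infinity>h. coeff T h * coeff S (- h))"
proof -
  have "group_trace (S o\<^sub>L T) = cinner (T (point_mass 0)) (adj S (point_mass 0))"
    using group_vna_bounded_ops[OF assms(1)] by (simp add: group_trace_def cinner_adj_right del: cinner_point_mass_right)
  then show ?thesis
    by (simp add: cinner_ell2_def coeff_adj[OF assms(1)])
qed

lemma group_trace_commute:
  assumes "S \<in> group_vna" "T \<in> group_vna"
  shows "group_trace (S o\<^sub>L T) = group_trace (T o\<^sub>L S)"
  using infsum_reindex_bij_betw[OF bij_uminus, of "\<lambda>h. coeff T h * coeff S (- h)"]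
  by (simp add: group_trace_compose assms mult.commute)

text \<open>The passage from trace estimates to estimates on one vector of
  \<open>ell2\<close>.\<close>

lemma norm2_group_trace: "T \<in> bounded_ops \<Longrightarrow> norm2 group_trace T = norm (T (point_mass 0))"
  by (simp add: norm2_def group_trace_def cinner_adj_left cinner_self del: cinner_point_mass_right)

lemma norm_point_mass_image_le: "norm (blinfun_apply T (point_mass k)) \<le> norm T"
  using norm_blinfun[of T "point_mass k"] by simp

subsection \<open>Subgroups and conditional expectations\<close>

definition add_subgroup :: "'g::group_add set \<Rightarrow> bool" where
  "add_subgroup H \<longleftrightarrow> 0 \<in> H \<and> (\<forall>x\<in>H. \<forall>y\<in>H. x + y \<in> H) \<and> (\<forall>x\<in>H. - x \<in> H)"

lemma add_subgroupD:
  assumes "add_subgroup H"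
  shows "0 \<in> H" "x \<in> H \<Longrightarrow> y \<in> H \<Longrightarrow> x + y \<in> H" "x \<in> H \<Longrightarrow> - x \<in> H"
  using assms by (auto simp: add_subgroup_def)

lemma add_subgroup_plus_iff: "add_subgroup H \<Longrightarrow> x \<in> H \<Longrightarrow> x + y \<in> H \<longleftrightarrow> y \<in> H"
  by (metis add_subgroupD(2,3) minus_add_cancel)

lemma add_subgroup_uminus_iff: "add_subgroup H \<Longrightarrow> - x \<in> H \<longleftrightarrow> x \<in> H"
  by (metis add_subgroupD(3) minus_minus)

text \<open>Cosets on this side are the sets preserved by left multiplication with \<open>H\<close>,
  so convolvers supported on \<open>H\<close> are block diagonal along them.\<close>

definition rcoset :: "'g::group_add set \<Rightarrow> 'g \<Rightarrow> 'g set" where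
  "rcoset H g = {k. k - g \<in> H}"

lemma rcoset_zero [simp]: "rcoset H 0 = H"
  by (simp add: rcoset_def)

lemma rcoset_self: "add_subgroup H \<Longrightarrow> g \<in> rcoset H g"
  by (simp add: rcoset_def add_subgroupD)

lemma rcoset_eq:
  assumes H: "add_subgroup H" and "k \<in> rcoset H g"
  shows "rcoset H k = rcoset H g"
proof -
  have "x - g \<in> H \<longleftrightarrow> x - k \<in> H" for x
  proof -
    have "x - k = (x - g) - (k - g)"
      by (simp add: diff_diff_eq2 algebra_simps)
    moreover have "x - g = (x - k) + (k - g)"
      by (simp add: algebra_simps)
    ultimately show ?thesis
      using assms by (metis add_subgroupD(2,3) diff_conv_add_uminus mem_Collect_eq rcoset_def)
  qed
  then show ?thesis
    by (simp add: rcoset_def)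
qed

lemma rcoset_disjoint: "add_subgroup H \<Longrightarrow> disjoint_family_on (\<lambda>C. C) (range (rcoset H))"
  by (auto simp: disjoint_family_on_def) (metis rcoset_eq)+

definition subgroup_vna :: "'g::group_add set \<Rightarrow> ('g ell2 \<Rightarrow>\<^sub>L 'g ell2) set" where
  "subgroup_vna H = {T \<in> group_vna. \<forall>h. coeff T h \<noteq> 0 \<longrightarrow> h \<in> H}"

lemma subgroup_vna_subset: "subgroup_vna H \<subseteq> group_vna"
  by (auto simp: subgroup_vna_def)

lemma subgroup_vna_iff:
  "T \<in> subgroup_vna H \<longleftrightarrow> T \<in> group_vna \<and> restrict_op H (T (point_mass 0)) = T (point_mass 0)"
proof -
  have "restrict_op H (T (point_mass 0)) = T (point_mass 0) \<longleftrightarrow> (\<forall>h. coeff T h \<noteq> 0 \<longrightarrow> h \<in> H)"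
    by (metis ell2_eqI restrict_op_apply)
  then show ?thesis
    by (auto simp: subgroup_vna_def)
qed

text \<open>\<open>T\<close> moves mass from \<open>h\<close> to \<open>k + h\<close> with
  \<open>k\<close> in its support. The lemma serves three gradings of the group: by cosets of
  \<open>H\<close>, by parity of an exponent sum, and by the dihedral action.\<close>

lemma restrict_op_intertwine:
  assumes T: "T \<in> group_vna" and CD: "\<And>k h. coeff T k \<noteq> 0 \<Longrightarrow> h \<in> C \<longleftrightarrow> k + h \<in> D"
  shows "restrict_op D o\<^sub>L T = T o\<^sub>L restrict_op C"
proof (rule ell2_op_eqI)
  fix h
  have app: "ell2_apply (T (point_mass h)) k = coeff T (k - h)" for k
    using T convolver_point_mass[of T h k] by (simp add: group_vna_eq)
  have "h \<in> C \<longleftrightarrow> k \<in> D" if "coeff T (k - h) \<noteq> 0" for k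
    using CD[OF that, of h] by simp
  then show "(restrict_op D o\<^sub>L T) (point_mass h) = (T o\<^sub>L restrict_op C) (point_mass h)"
    by (intro ell2_eqI) (auto simp: restrict_op_point_mass app)
qed (use T in \<open>auto intro!: bounded_ops_compose dest: group_vna_bounded_ops\<close>)

lemma subgroup_vna_restrict_op:
  assumes H: "add_subgroup H" and T: "T \<in> subgroup_vna H"
  shows "restrict_op (rcoset H g) (T f) = T (restrict_op (rcoset H g) f)"
proof -
  have "restrict_op (rcoset H g) o\<^sub>L T = T o\<^sub>L restrict_op (rcoset H g)"
  proof (rule restrict_op_intertwine)
    fix k h assume "coeff T k \<noteq> 0"
    with T have "k \<in> H"
      by (auto simp: subgroup_vna_def)
    then show "h \<in> rcoset H g \<longleftrightarrow> k + h \<in> rcoset H g"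
      by (simp add: rcoset_def add_diff_eq[symmetric] add_subgroup_plus_iff[OF H])
  qed (use T in \<open>auto simp: subgroup_vna_def\<close>)
  then show ?thesis
    by (metis blinfun_apply_blinfun_compose)
qed

lemmas subgroup_vna_restrict_subgroup = subgroup_vna_restrict_op[where g = 0, simplified]

lemma subgroup_vna_id: "add_subgroup H \<Longrightarrow> id_blinfun \<in> subgroup_vna H"
  by (simp add: subgroup_vna_iff group_vna_closed restrict_op_point_mass add_subgroupD)

lemma subgroup_vna_zero: "0 \<in> subgroup_vna H"
  by (simp add: subgroup_vna_iff group_vna_eq)

lemma subgroup_vna_add: "S \<in> subgroup_vna H \<Longrightarrow> T \<in> subgroup_vna H \<Longrightarrow> S + T \<in> subgroup_vna H"
  and subgroup_vna_diff: "S \<in> subgroup_vna H \<Longrightarrow> T \<in> subgroup_vna H \<Longrightarrow> S - T \<in> subgroup_vna H"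
  and subgroup_vna_scaleC: "T \<in> subgroup_vna H \<Longrightarrow> c *\<^sub>C T \<in> subgroup_vna H"
  by (simp_all add: subgroup_vna_iff group_vna_closed blinfun.bilinear_simps scaleC_blinfun.rep_eq
      bounded_opsD[OF restrict_op_bounded_ops])

lemma subgroup_vna_compose:
  assumes "add_subgroup H" "S \<in> subgroup_vna H" "T \<in> subgroup_vna H"
  shows "S o\<^sub>L T \<in> subgroup_vna H"
  using assms subgroup_vna_restrict_subgroup[OF assms(1,2), of "T (point_mass 0)"]
  by (simp add: subgroup_vna_iff group_vna_closed)

lemma subgroup_vna_adj: "add_subgroup H \<Longrightarrow> T \<in> subgroup_vna H \<Longrightarrow> adj T \<in> subgroup_vna H"
  by (auto simp: subgroup_vna_def group_vna_closed coeff_adj)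
    (metis add_subgroup_uminus_iff)

lemma subgroup_vna_left_regular: "g \<in> H \<Longrightarrow> left_regular g \<in> subgroup_vna H"
  by (simp add: subgroup_vna_iff group_vna_closed left_regular_point_mass restrict_op_point_mass)

text \<open>The block diagonal part of \<open>T\<close> with respect to the right cosets of \<open>H\<close>.\<close>

definition expect :: "'g::group_add set \<Rightarrow> ('g ell2 \<Rightarrow>\<^sub>L 'g ell2) \<Rightarrow> ('g ell2 \<Rightarrow>\<^sub>L 'g ell2)" where
  "expect H T = Blinfun (\<lambda>f. Abs_ell2 (\<lambda>h. ell2_apply (T (restrict_op (rcoset H h) f)) h))"

text \<open>Cutting down Fourier coefficients directly would control 2-norms only. In block form the
  operator norm is controlled as well: each block is bounded by the norm of \<open>T\<close>, and
  different blocks act between orthogonal pieces.\<close>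

lemma expect_bounds:
  assumes H: "add_subgroup H"
  shows "ell2_apply (expect H T f) h = ell2_apply (T (restrict_op (rcoset H h) f)) h"
    and "norm (expect H T) \<le> norm T"
proof -
  define e where "e f = Abs_ell2 (\<lambda>h. ell2_apply (T (restrict_op (rcoset H h) f)) h)" for f
  have bound: "(\<Sum>h\<in>F. (cmod (ell2_apply (T (restrict_op (rcoset H h) f)) h))\<^sup>2) \<le> (norm T * norm f)\<^sup>2"
    if F: "finite F" for F f
  proof -
    have "(\<Sum>h\<in>F. (cmod (ell2_apply (T (restrict_op (rcoset H h) f)) h))\<^sup>2)
      = (\<Sum>C\<in>rcoset H ` F. \<Sum>h\<in>{h\<in>F. rcoset H h = C}. (cmod (ell2_apply (T (restrict_op C f)) h))\<^sup>2)"
      by (subst sum.image_gen[OF F, of _ "rcoset H"]) (auto intro!: sum.cong)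
    also have "\<dots> \<le> (\<Sum>C\<in>rcoset H ` F. (norm T)\<^sup>2 * (norm (restrict_op C f))\<^sup>2)"
    proof (rule sum_mono)
      fix C
      have "(\<Sum>h\<in>{h\<in>F. rcoset H h = C}. (cmod (ell2_apply (T (restrict_op C f)) h))\<^sup>2) \<le> (norm (T (restrict_op C f)))\<^sup>2"
        using F by (intro sum_le_norm_ell2_squared) auto
      also have "\<dots> \<le> (norm T * norm (restrict_op C f))\<^sup>2"
        by (intro power_mono norm_blinfun) auto
      finally show "(\<Sum>h\<in>{h\<in>F. rcoset H h = C}. (cmod (ell2_apply (T (restrict_op C f)) h))\<^sup>2)
        \<le> (norm T)\<^sup>2 * (norm (restrict_op C f))\<^sup>2"
        by (simp add: power_mult_distrib)
    qed
    also have "\<dots> \<le> (norm T)\<^sup>2 * (norm f)\<^sup>2"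
      unfolding sum_distrib_left[symmetric]
      using F disjoint_family_on_mono[OF _ rcoset_disjoint[OF H], of "rcoset H ` F"]
      by (intro mult_left_mono restrict_op_disjoint_bound[where C = "\<lambda>C. C"]) auto
    finally show ?thesis
      by (simp add: power_mult_distrib)
  qed
  have app: "ell2_apply (e f) h = ell2_apply (T (restrict_op (rcoset H h) f)) h" for f h
    using ell2_from_finite_bounds(1)[OF bound] by (simp add: e_def Abs_ell2_inverse)
  have nE: "norm (e f) \<le> norm T * norm f" for f
    unfolding e_def by (rule power2_le_imp_le[OF ell2_from_finite_bounds(2)[OF bound]]) auto
  have "bounded_linear e"
    by (rule bounded_linear_intro[where K = "norm T"])
      (auto intro!: ell2_eqI simp: app blinfun.bilinear_simps nE mult.commute[of "norm _" "norm T"])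
  then have BE: "blinfun_apply (expect H T) = e"
    unfolding expect_def e_def[symmetric] by (rule bounded_linear_Blinfun_apply)
  show "ell2_apply (expect H T f) h = ell2_apply (T (restrict_op (rcoset H h) f)) h"
    unfolding BE by (rule app)
  show "norm (expect H T) \<le> norm T"
    by (rule norm_blinfun_bound) (auto simp: BE nE)
qed

lemmas expect_apply = expect_bounds(1) and norm_expect_le = expect_bounds(2)

lemma restrict_op_expect:
  assumes H: "add_subgroup H"
  shows "restrict_op (rcoset H g) (expect H T f)
    = restrict_op (rcoset H g) (T (restrict_op (rcoset H g) f))"
  by (rule ell2_eqI) (simp add: expect_apply[OF H] rcoset_eq[OF H])

lemma expect_point_mass:
  assumes H: "add_subgroup H"
  shows "expect H T (point_mass 0) = restrict_op H (T (point_mass 0))"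
  by (rule ell2_eqI)
    (simp add: expect_apply[OF H] restrict_op_point_mass rcoset_def add_subgroup_uminus_iff[OF H])

lemma expect_subgroup_vna:
  assumes H: "add_subgroup H" and T: "T \<in> group_vna"
  shows "expect H T \<in> subgroup_vna H"
proof -
  have "expect H T \<in> commutant (range right_regular)"
  proof (rule commutantI)
    show "expect H T \<in> bounded_ops"
      unfolding bounded_ops_def
      by (auto intro!: ell2_eqI simp: expect_apply[OF H] bounded_opsD[OF restrict_op_bounded_ops]
        bounded_opsD[OF group_vna_bounded_ops[OF T]])
    fix s :: "'a ell2 \<Rightarrow>\<^sub>L 'a ell2" assume "s \<in> range right_regular"
    then obtain g where s: "s = right_regular g" by blast
    have Tg: "T (right_regular g f) = right_regular g (T f)" for f
      using T commutantD[of T "range right_regular" "right_regular g"]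
      by (metis blinfun_apply_blinfun_compose group_vna_eq rangeI)
    have "k + g - (h + g) = k - h" for k h :: 'a
      by (metis add_diff_cancel diff_add_eq_diff_diff_swap)
    then have "restrict_op (rcoset H h) (right_regular g f)
        = right_regular g (restrict_op (rcoset H (h + g)) f)" for h f
      by (intro ell2_eqI) (simp add: rcoset_def)
    then show "expect H T o\<^sub>L s = s o\<^sub>L expect H T"
      unfolding s by (intro blinfun_eqI ell2_eqI) (simp add: expect_apply[OF H] Tg)
  qed
  then show ?thesis
    by (simp add: subgroup_vna_iff group_vna_eq expect_point_mass[OF H])
qed

lemma sum_nonneg_Reals: "(\<And>i. i \<in> I \<Longrightarrow> f i \<in> \<real>\<^sub>\<ge>\<^sub>0) \<Longrightarrow> (\<Sum>i\<in>I. f i) \<in> (\<real>\<^sub>\<ge>\<^sub>0 :: complex set)"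
  by (induction I rule: infinite_finite_induct) (auto intro: nonneg_Reals_add_I)

text \<open>A finitely supported vector splits over finitely many cosets, and the quadratic form of
  the block diagonal part is the sum of the forms of \<open>T\<close> on the pieces. Density and
  closedness of the nonnegative reals do the rest.\<close>

lemma expect_positive:
  fixes H :: "'g::group_add set"
  assumes H: "add_subgroup H" and T: "T \<in> group_vna" "positive_op T"
  shows "positive_op (expect H T)"
proof -
  let ?E = "expect H T"
  have E: "?E \<in> subgroup_vna H"
    by (rule expect_subgroup_vna[OF H T(1)])
  have fin: "cinner (?E g) g \<in> \<real>\<^sub>\<ge>\<^sub>0" if g: "g = (\<Sum>k\<in>F. c k *\<^sub>C point_mass k)" and F: "finite F"
    for g F and c :: "'g \<Rightarrow> complex"
  proof -
    let ?D = "rcoset H ` F"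
    have D: "finite ?D" "disjoint_family_on (\<lambda>C. C) ?D"
      using F disjoint_family_on_mono[OF _ rcoset_disjoint[OF H], of ?D] by auto
    have "restrict_op (\<Union>?D) g = g"
    proof -
      have "restrict_op (\<Union>?D) (point_mass k) = point_mass k" if "k \<in> F" for k
        using that rcoset_self[OF H, of k] by (auto simp: restrict_op_point_mass)
      then show ?thesis
        by (simp add: g blinfun.sum_right bounded_opsD[OF restrict_op_bounded_ops])
    qed
    then have "(\<Sum>C\<in>?D. restrict_op C g) = g"
      using restrict_op_disjoint_sum(2)[OF D, of g] by simp
    then have "cinner (?E g) g = cinner (?E (\<Sum>C\<in>?D. restrict_op C g)) g"
      by simp
    also have "\<dots> = (\<Sum>C\<in>?D. cinner (?E (restrict_op C g)) g)"
      by (simp add: blinfun.sum_right cinner_sum_left)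
    also have "\<dots> = (\<Sum>C\<in>?D. cinner (T (restrict_op C g)) (restrict_op C g))"
    proof (rule sum.cong[OF HOL.refl])
      fix C assume "C \<in> ?D"
      then obtain k where C: "C = rcoset H k" by blast
      have "?E (restrict_op C g) = restrict_op C (?E (restrict_op C g))"
        unfolding C subgroup_vna_restrict_op[OF H E] by simp
      also have "\<dots> = restrict_op C (T (restrict_op C g))"
        unfolding C restrict_op_expect[OF H] by simp
      finally show "cinner (?E (restrict_op C g)) g = cinner (T (restrict_op C g)) (restrict_op C g)"
        by (simp add: self_adjointD[OF self_adjoint_restrict_op])
    qed
    also have "\<dots> \<in> \<real>\<^sub>\<ge>\<^sub>0"
      using T(2) by (intro sum_nonneg_Reals) (auto simp: positive_op_def)
    finally show ?thesis .
  qed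
  have "cinner (?E f) f \<in> \<real>\<^sub>\<ge>\<^sub>0" for f
  proof -
    have cont: "continuous_on UNIV (\<lambda>f. cinner (?E f) f)"
      by (intro continuous_on_cinner continuous_on_blinfun_apply continuous_on_id)
    have "closed ((\<lambda>f. cinner (?E f) f) -` \<real>\<^sub>\<ge>\<^sub>0)"
      by (rule closed_vimage[OF closed_nonneg_Reals_complex cont])
    moreover have "f \<in> closure ((\<lambda>f. cinner (?E f) f) -` \<real>\<^sub>\<ge>\<^sub>0)"
      unfolding closure_approachable
    proof (intro allI impI)
      fix e :: real assume "e > 0"
      from ell2_finite_approx[OF this, of f] obtain F where
        "finite F" "norm (f - (\<Sum>k\<in>F. ell2_apply f k *\<^sub>C point_mass k)) < e" by blast
      with fin[OF HOL.refl this(1)] show "\<exists>y\<in>(\<lambda>f. cinner (?E f) f) -` \<real>\<^sub>\<ge>\<^sub>0. dist y f < e"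
        by (intro bexI[of _ "\<Sum>k\<in>F. ell2_apply f k *\<^sub>C point_mass k"])
          (auto simp: dist_norm norm_minus_commute)
    qed
    ultimately show ?thesis
      by simp
  qed
  then show ?thesis
    using E by (auto simp: positive_op_def subgroup_vna_def dest: group_vna_bounded_ops)
qed

lemma expect_trace_preserving:
  assumes H: "add_subgroup H"
  shows "is_trace_preserving_cond_exp group_trace group_vna (subgroup_vna H) (expect H)"
  unfolding is_trace_preserving_cond_exp_def
proof (intro conjI ballI allI impI)
  note [simp] = expect_point_mass[OF H]
  have E: "expect H x \<in> group_vna" if "x \<in> group_vna" for x
    using expect_subgroup_vna[OF H that] subgroup_vna_subset by blast
  fix x :: "'a ell2 \<Rightarrow>\<^sub>L 'a ell2" assume x: "x \<in> group_vna"
  show "expect H x \<in> subgroup_vna H"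
    by (rule expect_subgroup_vna[OF H x])
  show "expect H (x + y) = expect H x + expect H y" if "y \<in> group_vna" for y
    using x that by (intro group_vna_eqI) (simp_all add: E group_vna_closed blinfun.bilinear_simps)
  show "expect H (c *\<^sub>C x) = c *\<^sub>C expect H x" for c
    using x by (intro group_vna_eqI)
      (simp_all add: E group_vna_closed scaleC_blinfun.rep_eq bounded_opsD[OF restrict_op_bounded_ops])
  show "group_trace (expect H x) = group_trace x"
    by (simp add: group_trace_eq add_subgroupD[OF H])
  show "positive_op (expect H x)" if "positive_op x"
    by (rule expect_positive[OF H x that])
  fix p q assume p: "p \<in> subgroup_vna H" and q: "q \<in> subgroup_vna H"
  then have pq: "p \<in> group_vna" "q \<in> group_vna"
    using subgroup_vna_subset by auto
  show "expect H (p o\<^sub>L x o\<^sub>L q) = p o\<^sub>L expect H x o\<^sub>L q"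
  proof (rule group_vna_eqI)
    let ?d = "point_mass 0 :: 'a ell2"
    have qd: "restrict_op H (q ?d) = q ?d"
      using q by (simp add: subgroup_vna_iff)
    \<comment> \<open>\<open>q ?d\<close> is supported on \<open>H\<close>, and on this coset the
      expectation is the compression of \<open>x\<close>.\<close>
    have "restrict_op H (expect H x (q ?d)) = restrict_op H (x (q ?d))"
      using restrict_op_expect[OF H, of 0 x "q ?d"] qd by simp
    moreover have "restrict_op H (expect H x (q ?d)) = expect H x (q ?d)"
      by (simp add: subgroup_vna_restrict_subgroup[OF H expect_subgroup_vna[OF H x]] qd)
    ultimately show "expect H (p o\<^sub>L x o\<^sub>L q) ?d = (p o\<^sub>L expect H x o\<^sub>L q) ?d"
      by (simp add: subgroup_vna_restrict_subgroup[OF H p])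
  qed (use pq x in \<open>auto intro!: E group_vna_closed\<close>)
next
  fix x assume "x \<in> subgroup_vna H"
  then show "expect H x = x"
    using expect_subgroup_vna[OF H, of x] subgroup_vna_subset[of H]
    by (intro group_vna_eqI) (auto simp: expect_point_mass[OF H] subgroup_vna_iff)
qed

text \<open>Two trace preserving conditional expectations \<open>E\<close>, \<open>F\<close> satisfy \<open>tr (E x d) = tr (x d) = tr (F x d)\<close>
  for \<open>d \<in> N\<close>; take \<open>d = (E x - F x)\<^sup>*\<close>.\<close>

lemma cond_exp_eqI:
  assumes N: "N \<subseteq> group_vna" "id_blinfun \<in> N" "\<And>x. x \<in> N \<Longrightarrow> adj x \<in> N"
      "\<And>x y. x \<in> N \<Longrightarrow> y \<in> N \<Longrightarrow> x - y \<in> N"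
    and E: "is_trace_preserving_cond_exp group_trace group_vna N E"
    and x: "x \<in> group_vna"
  shows "cond_exp group_trace group_vna N x = E x"
proof -
  note N1 = subsetD[OF N(1)]
  let ?E = "restrict E group_vna"
  have E': "is_trace_preserving_cond_exp group_trace group_vna N ?E"
    using E unfolding is_trace_preserving_cond_exp_def
    by (auto simp: group_vna_closed N1)
  have uniq: "F = ?E" if F: "F \<in> extensional group_vna" "is_trace_preserving_cond_exp group_trace group_vna N F" for F
  proof (rule extensionalityI[OF F(1)])
    fix x :: "'a ell2 \<Rightarrow>\<^sub>L 'a ell2" assume x: "x \<in> group_vna"
    have tr: "group_trace (G x o\<^sub>L d) = group_trace (x o\<^sub>L d)"
      if G: "is_trace_preserving_cond_exp group_trace group_vna N G" and d: "d \<in> N" for G d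
    proof -
      have "G (id_blinfun o\<^sub>L x o\<^sub>L d) = id_blinfun o\<^sub>L G x o\<^sub>L d"
        using G x d N(2) unfolding is_trace_preserving_cond_exp_def by blast
      then have "G (x o\<^sub>L d) = G x o\<^sub>L d"
        by simp
      then show ?thesis
        using G group_vna_compose[OF x N1[OF d]] unfolding is_trace_preserving_cond_exp_def by metis
    qed
    define d where "d = F x - ?E x"
    have d: "d \<in> N" "adj d \<in> N"
      using F(2) E' x N unfolding d_def is_trace_preserving_cond_exp_def by auto
    have dM: "d \<in> group_vna" "adj d \<in> group_vna" "d \<in> bounded_ops"
      using N1 d group_vna_bounded_ops by auto
    have "group_trace (d o\<^sub>L adj d) = 0"
      using tr[OF F(2) d(2)] tr[OF E' d(2)]
      by (simp add: d_def group_trace_eq compose_linear blinfun.bilinear_simps)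
    then have "adj d (point_mass 0) = 0"
      using dM(3) by (simp add: group_trace_def cinner_adj_left[symmetric] cinner_self
          flip: cinner_adj_right del: cinner_point_mass_right)
    then have "adj d = 0"
      using dM by (intro group_vna_eqI) (auto simp: group_vna_eq)
    then have "d = 0"
      using dM(3) by (metis adj_adj adj_zero)
    then show "F x = ?E x"
      by (simp add: d_def)
  qed auto
  have "cond_exp group_trace group_vna N = ?E"
    unfolding cond_exp_def by (rule the_equality) (use E' uniq in auto)
  with x show ?thesis by simp
qed

lemma cond_exp_subgroup_vna:
  "add_subgroup H \<Longrightarrow> x \<in> group_vna \<Longrightarrow>
    cond_exp group_trace group_vna (subgroup_vna H) x = expect H x"
  by (rule cond_exp_eqI)
    (auto intro: subgroup_vna_id subgroup_vna_adj subgroup_vna_diff expect_trace_preserving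
      simp: subsetD[OF subgroup_vna_subset])

lemma unitaryD:
  assumes "is_unitary u"
  shows "adj u (u x) = x" "u (adj u x) = x" "u \<in> bounded_ops"
  using assms unfolding is_unitary_def
  by (metis blinfun_apply_blinfun_compose blinfun_apply_id_blinfun id_apply)+

text \<open>Conjugation by \<open>u\<close> is a trace preserving automorphism of the group algebra
  that carries the subalgebra onto its conjugate. It transports the expectation, and uniqueness
  identifies the result.\<close>

lemma cond_exp_conjugate:
  fixes u :: "'g::group_add ell2 \<Rightarrow>\<^sub>L 'g ell2"
  assumes H: "add_subgroup H" and u: "u \<in> group_vna" "is_unitary u" and x: "x \<in> group_vna"
  shows "cond_exp group_trace group_vna (conjugate u (subgroup_vna H)) x
    = u o\<^sub>L expect H (adj u o\<^sub>L x o\<^sub>L u) o\<^sub>L adj u"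
proof -
  let ?N = "subgroup_vna H"
  let ?c = "\<lambda>x. u o\<^sub>L x o\<^sub>L adj u" and ?d = "\<lambda>x. adj u o\<^sub>L x o\<^sub>L u"
  note uu = unitaryD[OF u(2)]
  note N1 = subsetD[OF subgroup_vna_subset[of H]]
  have au: "adj u \<in> group_vna"
    using u by (intro group_vna_closed)
  have cM: "?c y \<in> group_vna" and dM: "?d y \<in> group_vna" if "y \<in> group_vna" for y
    using that u au by (auto intro!: group_vna_closed)
  have dc: "?d (?c y) = y" for y
    by (rule blinfun_eqI) (simp add: uu)
  have tr: "group_trace (?c y) = group_trace y" "group_trace (?d y) = group_trace y" if "y \<in> group_vna" for y
  proof -
    have eq: "adj u o\<^sub>L (u o\<^sub>L y) = y" "u o\<^sub>L (adj u o\<^sub>L y) = y"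
      by (rule blinfun_eqI, simp add: uu)+
    show "group_trace (?c y) = group_trace y"
      using group_trace_commute[of "u o\<^sub>L y" "adj u"] that u au by (simp add: group_vna_closed eq)
    show "group_trace (?d y) = group_trace y"
      using group_trace_commute[of "adj u o\<^sub>L y" u] that u au by (simp add: group_vna_closed eq)
  qed
  have E: "is_trace_preserving_cond_exp group_trace group_vna ?N (expect H)"
    by (rule expect_trace_preserving[OF H])
  have EM: "expect H y \<in> group_vna" if "y \<in> group_vna" for y
    using expect_subgroup_vna[OF H that] N1 by blast
  have "is_trace_preserving_cond_exp group_trace group_vna (conjugate u ?N) (\<lambda>x. ?c (expect H (?d x)))"
    unfolding is_trace_preserving_cond_exp_def
  proof (intro conjI ballI allI impI)
    fix x :: "'g ell2 \<Rightarrow>\<^sub>L 'g ell2" assume x: "x \<in> group_vna"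
    show "?c (expect H (?d x)) \<in> conjugate u ?N"
      unfolding conjugate_def using expect_subgroup_vna[OF H dM[OF x]] by blast
    show "?c (expect H (?d (x + y))) = ?c (expect H (?d x)) + ?c (expect H (?d y))"
      if y: "y \<in> group_vna" for y
    proof -
      have "expect H (?d x + ?d y) = expect H (?d x) + expect H (?d y)"
        using E dM[OF x] dM[OF y] unfolding is_trace_preserving_cond_exp_def by blast
      then show ?thesis
        by (simp add: compose_linear)
    qed
    show "?c (expect H (?d (c *\<^sub>C x))) = c *\<^sub>C ?c (expect H (?d x))" for c
    proof -
      have "expect H (c *\<^sub>C ?d x) = c *\<^sub>C expect H (?d x)"
        using E dM[OF x] unfolding is_trace_preserving_cond_exp_def by blast
      then show ?thesis
        using uu(3) by (simp add: compose_scaleC_left compose_scaleC_right)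
    qed
    show "group_trace (?c (expect H (?d x))) = group_trace x"
      using E dM[OF x] tr EM x unfolding is_trace_preserving_cond_exp_def by metis
    show "positive_op (?c (expect H (?d x)))" if "positive_op x"
    proof -
      have "positive_op (?d x)"
        using that x dM[OF x] uu(3) unfolding positive_op_def
        by (auto dest: group_vna_bounded_ops simp: cinner_adj_left)
      then have "positive_op (expect H (?d x))"
        using E dM[OF x] unfolding is_trace_preserving_cond_exp_def by blast
      moreover have "cinner (?c y f) f = cinner (y (adj u f)) (adj u f)" for y f
        by (simp add: cinner_adj_right[OF uu(3)])
      ultimately show ?thesis
        using cM[OF EM[OF dM[OF x]]] unfolding positive_op_def
        by (auto dest: group_vna_bounded_ops)
    qed
    fix p q assume p: "p \<in> conjugate u ?N" and q: "q \<in> conjugate u ?N"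
    then obtain p' q' where pq: "p' \<in> ?N" "q' \<in> ?N" "p = ?c p'" "q = ?c q'"
      unfolding conjugate_def by blast
    have "?d (p o\<^sub>L x o\<^sub>L q) = p' o\<^sub>L ?d x o\<^sub>L q'"
      unfolding pq by (rule blinfun_eqI) (simp add: uu)
    moreover have "expect H (p' o\<^sub>L ?d x o\<^sub>L q') = p' o\<^sub>L expect H (?d x) o\<^sub>L q'"
      using E dM[OF x] pq(1,2) unfolding is_trace_preserving_cond_exp_def by blast
    ultimately show "?c (expect H (?d (p o\<^sub>L x o\<^sub>L q))) = p o\<^sub>L ?c (expect H (?d x)) o\<^sub>L q"
      unfolding pq(3,4) by (intro blinfun_eqI) (simp add: uu)
  next
    fix x assume "x \<in> conjugate u ?N"
    then obtain y where y: "y \<in> ?N" "x = ?c y"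
      unfolding conjugate_def by blast
    then show "?c (expect H (?d x)) = x"
      using E unfolding y(2) dc is_trace_preserving_cond_exp_def by auto
  qed
  moreover have "conjugate u ?N \<subseteq> group_vna"
    using cM N1 by (auto simp: conjugate_def)
  moreover have "id_blinfun \<in> conjugate u ?N"
    unfolding conjugate_def
    by (rule image_eqI[OF _ subgroup_vna_id[OF H]]) (rule blinfun_eqI, simp add: uu)
  moreover have "adj y \<in> conjugate u ?N" if "y \<in> conjugate u ?N" for y
  proof -
    obtain z where z: "z \<in> ?N" "y = ?c z"
      using \<open>y \<in> conjugate u ?N\<close> unfolding conjugate_def by blast
    then have "adj y = ?c (adj z)"
      using uu(3) group_vna_bounded_ops[OF N1[OF z(1)]]
      by (simp add: adj_compose bounded_ops_compose compose_assoc)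
    then show ?thesis
      using subgroup_vna_adj[OF H z(1)] by (auto simp: conjugate_def)
  qed
  moreover have "y - z \<in> conjugate u ?N" if "y \<in> conjugate u ?N" "z \<in> conjugate u ?N" for y z
  proof -
    obtain y' z' where "y' \<in> ?N" "z' \<in> ?N" "y = ?c y'" "z = ?c z'"
      using \<open>y \<in> conjugate u ?N\<close> \<open>z \<in> conjugate u ?N\<close> unfolding conjugate_def by blast
    then show ?thesis
      unfolding conjugate_def
      by (intro image_eqI[of _ _ "y' - z'"]) (auto simp: compose_linear subgroup_vna_diff)
  qed
  ultimately show ?thesis
    using x by (intro cond_exp_eqI)
qed

subsection \<open>Cyclic subgroups\<close>

definition zpow :: "'g::group_add \<Rightarrow> int \<Rightarrow> 'g" where
  "zpow a n = (if 0 \<le> n then ((\<lambda>x. a + x) ^^ nat n) 0 else ((\<lambda>x. - a + x) ^^ nat (- n)) 0)"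

lemma zpow_zero [simp]: "zpow a 0 = 0"
  by (simp add: zpow_def)

lemma zpow_one [simp]: "zpow a 1 = a"
  by (simp add: zpow_def)

lemma zpow_succ: "zpow a (n + 1) = a + zpow a n"
proof (cases "0 \<le> n")
  case True
  then show ?thesis
    by (simp add: zpow_def nat_add_distrib)
next
  case False
  then have "nat (- n) = Suc (nat (- (n + 1)))" by simp
  then have "((\<lambda>x. - a + x) ^^ nat (- n)) 0 = - a + ((\<lambda>x. - a + x) ^^ nat (- (n + 1))) 0"
    by simp
  then show ?thesis
    using False by (auto simp: zpow_def add.assoc[symmetric])
qed

lemma zpow_add: "zpow a (m + n) = zpow a m + zpow a n"
proof (induction m rule: int_induct[where k = 0])
  case (step1 i)
  then show ?case
    using zpow_succ[of a "i + n"] zpow_succ[of a i] by (simp add: add.assoc add.commute[of 1] add.left_commute[of 1])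
next
  case (step2 i)
  have "a + zpow a (i - 1 + n) = a + (zpow a (i - 1) + zpow a n)"
    using step2 zpow_succ[of a "i - 1 + n"] zpow_succ[of a "i - 1"] by (simp add: add.assoc algebra_simps)
  then show ?case by simp
qed simp

lemma zpow_uminus: "zpow a (- n) = - zpow a n"
  by (metis add.right_inverse minus_unique zpow_add zpow_zero)

lemma add_subgroup_zpow: "add_subgroup (range (zpow a))"
  unfolding add_subgroup_def
  by (auto simp flip: zpow_add zpow_uminus intro: range_eqI[of _ _ 0])

text \<open>Restriction to the subgroup commutes with translation by \<open>a\<close> and its
  inverse, hence with the bicommutant, whose elements therefore have Fourier support in the
  subgroup. The converse is an instance of \<open>convolver_commute\<close>.\<close>

lemma generated_vna_cyclic: "generated_vna {left_regular a} = subgroup_vna (range (zpow a))"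
proof -
  let ?S = "{left_regular a, left_regular (- a)}" and ?H = "range (zpow a)"
  note H = add_subgroup_zpow[of a]
  have "generated_vna {left_regular a} = commutant (commutant ?S)"
    by (subst generated_vna_eq_bicommutant) (auto simp: insert_commute)
  moreover have "commutant (commutant ?S) = subgroup_vna ?H"
  proof (intro subset_antisym subsetI)
    fix T assume T: "T \<in> commutant (commutant ?S)"
    have "commutant (commutant ?S) \<subseteq> group_vna"
      unfolding group_vna_eq_bicommutant by (intro commutant_antimono) auto
    then have TM: "T \<in> group_vna" using T by blast
    have "restrict_op ?H \<in> commutant ?S"
    proof (rule commutantI)
      fix s assume "s \<in> ?S"
      then obtain g where g: "g \<in> ?H" "s = left_regular g"
        using zpow_one[of a] zpow_uminus[of a 1] by (metis empty_iff insert_iff rangeI)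
      then have "- g + h \<in> ?H \<longleftrightarrow> h \<in> ?H" for h
        using H add_subgroup_plus_iff add_subgroup_uminus_iff by metis
      then show "restrict_op ?H o\<^sub>L s = s o\<^sub>L restrict_op ?H"
        unfolding g(2) by (intro blinfun_eqI ell2_eqI) simp
    qed simp
    then have "T o\<^sub>L restrict_op ?H = restrict_op ?H o\<^sub>L T"
      by (rule commutantD[OF T])
    then have "restrict_op ?H (T (point_mass 0)) = T (restrict_op ?H (point_mass 0))"
      by (metis blinfun_apply_blinfun_compose)
    then show "T \<in> subgroup_vna ?H"
      using TM by (simp add: subgroup_vna_iff restrict_op_point_mass add_subgroupD[OF H] del: range_eqI)
  next
    fix T assume T: "T \<in> subgroup_vna ?H"
    show "T \<in> commutant (commutant ?S)"
    proof (rule commutantI)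
      show "T \<in> bounded_ops"
        using T by (auto simp: subgroup_vna_def dest: group_vna_bounded_ops)
      fix s assume s: "s \<in> commutant ?S"
      have sa: "s o\<^sub>L left_regular a = left_regular a o\<^sub>L s" "s o\<^sub>L left_regular (- a) = left_regular (- a) o\<^sub>L s"
        using commutantD[OF s] by auto
      have comm: "s o\<^sub>L left_regular (zpow a n) = left_regular (zpow a n) o\<^sub>L s" for n
      proof (induction n rule: int_induct[where k = 0])
        case (step1 n)
        have "left_regular (zpow a (n + 1)) = left_regular a o\<^sub>L left_regular (zpow a n)"
          by (simp add: zpow_succ left_regular_add)
        with commute_compose[OF sa(1) step1(2)] show ?case by simp
      next
        case (step2 n)
        have "zpow a (n - 1) = - a + zpow a n"
          using zpow_succ[of a "n - 1"] by (simp add: add.assoc[symmetric])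
        then have "left_regular (zpow a (n - 1)) = left_regular (- a) o\<^sub>L left_regular (zpow a n)"
          by (simp add: left_regular_add)
        with commute_compose[OF sa(2) step2(2)] show ?case by simp
      qed simp
      show "T o\<^sub>L s = s o\<^sub>L T"
      proof (rule convolver_commute)
        show "T \<in> commutant (range right_regular)"
          using T by (simp add: subgroup_vna_def group_vna_eq)
        show "s \<in> bounded_ops" by (rule commutant_bounded_ops[OF s])
        fix m assume "coeff T m \<noteq> 0"
        then have "m \<in> ?H"
          using T by (simp add: subgroup_vna_def del: range_eqI)
        then show "s o\<^sub>L left_regular m = left_regular m o\<^sub>L s"
          using comm by auto
      qed
    qed
  qed
  ultimately show ?thesis by simp
qed


section \<open>Malnormal cyclic subgroups\<close>

text \<open>Since the condition is on \<open>n \<noteq> 0\<close> and not on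
  \<open>zpow a n \<noteq> 0\<close>, it forces \<open>a\<close> to have infinite order as soon as
  some \<open>g\<close> lies outside the subgroup.\<close>

definition malnormal_cyclic :: "'g::group_add \<Rightarrow> bool" where
  "malnormal_cyclic a \<longleftrightarrow>
    (\<forall>g n. g \<notin> range (zpow a) \<longrightarrow> n \<noteq> 0 \<longrightarrow> g + zpow a n - g \<notin> range (zpow a))"

lemma add_right_cancel_neg: "x + k + - k = x" "x + - k + k = x" for k x :: "'g::group_add"
  by simp_all

lemma conjugate_eq_imp_commute:
  fixes g h k :: "'g::group_add"
  assumes "g + h - g = k + h - k"
  shows "- k + g + h = h + (- k + g)"
proof -
  have "- k + g + h = - k + (g + h - g) + g"
    by (simp only: diff_conv_add_uminus add.assoc[symmetric] add_right_cancel_neg)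
  also have "\<dots> = h + (- k + g)"
    unfolding assms by (simp only: diff_conv_add_uminus add.assoc[symmetric] left_minus add_0_left)
  finally show ?thesis .
qed

lemma zpow_commute: "zpow a m + zpow a n = zpow a n + zpow a m"
  by (metis add.commute zpow_add)

lemma zpow_diff: "zpow a m - zpow a n = zpow a (m - n)"
  by (metis diff_conv_add_uminus zpow_add zpow_uminus)

section \<open>The cyclic subalgebra is maximal abelian\<close>

lemma abelian_subgroup_vna_zpow: "abelian (subgroup_vna (range (zpow a)))"
  unfolding abelian_def
proof (intro ballI)
  let ?A = "subgroup_vna (range (zpow a))"
  have conv: "T \<in> commutant (range right_regular)" "T \<in> bounded_ops"
    "coeff T m \<noteq> 0 \<Longrightarrow> m \<in> range (zpow a)" if "T \<in> ?A" for T m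
    using that by (auto simp: subgroup_vna_def group_vna_eq commutant_bounded_ops simp del: image_iff)
  have comm: "T o\<^sub>L left_regular m = left_regular m o\<^sub>L T" if T: "T \<in> ?A" and m: "m \<in> range (zpow a)" for T m
  proof (rule convolver_commute[OF conv(1)[OF T]])
    fix k assume "coeff T k \<noteq> 0"
    with conv(3)[OF T] m show "left_regular m o\<^sub>L left_regular k = left_regular k o\<^sub>L left_regular m"
      by (metis left_regular_add rangeE zpow_commute)
  qed simp
  fix S T assume S: "S \<in> ?A" and T: "T \<in> ?A"
  show "S o\<^sub>L T = T o\<^sub>L S"
    by (rule convolver_commute[OF conv(1)[OF S] conv(2)[OF T] comm[OF T conv(3)[OF S]]])
qed

lemma coeff_conjugate_invariant:
  assumes x: "x \<in> group_vna" and comm: "x o\<^sub>L left_regular g = left_regular g o\<^sub>L x"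
  shows "coeff x (g + h - g) = coeff x h"
proof -
  have "x (point_mass g) = left_regular g (x (point_mass 0))"
    using arg_cong[OF comm, of "\<lambda>T. blinfun_apply T (point_mass 0)"] by (simp add: left_regular_point_mass)
  then show ?thesis
    using convolver_point_mass[of x g "g + h"] x by (simp add: group_vna_eq add.assoc[symmetric])
qed

text \<open>Coefficients of \<open>x\<close> in the relative commutant are constant on the infinite sets
  \<open>{a\<^sup>n h a\<^sup>-\<^sup>n}\<close>, hence vanish there.\<close>

lemma masa_zpow:
  assumes mal: "malnormal_cyclic a"
  shows "masa group_vna (subgroup_vna (range (zpow a)))"
proof -
  let ?H = "range (zpow a)"
  let ?A = "subgroup_vna ?H"
  note H = add_subgroup_zpow[of a]
  have "B \<subseteq> ?A" if B: "B \<subseteq> group_vna" "abelian B" "?A \<subseteq> B" for B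
  proof
    fix x assume xB: "x \<in> B"
    then have x: "x \<in> group_vna" using B(1) by blast
    have "h \<in> ?H" if nz: "coeff x h \<noteq> 0" for h
    proof (rule ccontr)
      assume h: "h \<notin> ?H"
      define p where "p n = zpow a (int n) + h - zpow a (int n)" for n
      have px: "coeff x (p n) = coeff x h" for n
      proof -
        have "left_regular (zpow a (int n)) \<in> B"
          using subgroup_vna_left_regular[of "zpow a (int n)" ?H] B(3) by blast
        then have "x o\<^sub>L left_regular (zpow a (int n)) = left_regular (zpow a (int n)) o\<^sub>L x"
          using B(2) xB unfolding abelian_def by blast
        then show ?thesis
          unfolding p_def by (rule coeff_conjugate_invariant[OF x])
      qed
      have "m = n" if "p m = p n" for m n
      proof (rule ccontr)
        assume "m \<noteq> n"
        let ?k = "int m - int n"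
        \<comment> \<open>Two equal conjugates put a nontrivial power of \<open>a\<close> into the
          centralizer of \<open>h\<close>, against malnormality.\<close>
        have "zpow a ?k + h = h + zpow a ?k"
        proof -
          have "- zpow a (int n) + zpow a (int m) + h = h + (- zpow a (int n) + zpow a (int m))"
            using that unfolding p_def by (rule conjugate_eq_imp_commute)
          then show ?thesis
            by (simp flip: zpow_uminus zpow_add add: add.commute[of "- int n"])
        qed
        then have "h + zpow a ?k - h = zpow a ?k"
          by (metis add_diff_cancel)
        with mal h \<open>m \<noteq> n\<close> show False
          unfolding malnormal_cyclic_def by (metis rangeI eq_iff_diff_eq_0 of_nat_eq_iff)
      qed
      then have "disjoint_family (\<lambda>n. {p n})"
        by (auto simp: disjoint_family_on_def)
      then have lim: "(\<lambda>n. norm (restrict_op {p n} (x (point_mass 0)))) \<longlonglongrightarrow> 0"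
        by (rule restrict_op_disjoint_tendsto)
      have "cmod (coeff x h) \<le> norm (restrict_op {p n} (x (point_mass 0)))" for n
        using cmod_ell2_apply_le_norm[of "restrict_op {p n} (x (point_mass 0))" "p n"] by (simp add: px)
      then have "cmod (coeff x h) \<le> 0"
        by (intro LIMSEQ_le_const[OF lim]) auto
      with nz show False by simp
    qed
    with x show "x \<in> ?A"
      by (simp add: subgroup_vna_def del: image_iff)
  qed
  moreover have "star_subalgebra ?A"
    unfolding star_subalgebra_def
    by (intro conjI ballI allI subgroup_vna_zero subgroup_vna_add subgroup_vna_scaleC
        subgroup_vna_compose[OF H] subgroup_vna_adj[OF H])
      (auto simp: subgroup_vna_def group_vna_bounded_ops)
  ultimately show ?thesis
    unfolding masa_def using subgroup_vna_subset[of ?H] abelian_subgroup_vna_zpow[of a] by blast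
qed

section \<open>Mixing of the powers of the generator\<close>

lemma tendsto_0_closed:
  fixes T :: "nat \<Rightarrow> 'a::real_normed_vector \<Rightarrow>\<^sub>L 'b::real_normed_vector"
  assumes "\<And>n f. norm (T n f) \<le> K * norm f"
  shows "closed {f. (\<lambda>n. norm (T n f)) \<longlonglongrightarrow> 0}"
proof -
  have "f \<in> {f. (\<lambda>n. norm (T n f)) \<longlonglongrightarrow> 0}" if f: "f \<in> closure {f. (\<lambda>n. norm (T n f)) \<longlonglongrightarrow> 0}" for f
  proof (rule CollectI, rule LIMSEQ_I)
    fix e :: real assume e: "e > 0"
    \<comment> \<open>\<open>K\<close> may be zero or negative, and the argument divides by the
      bound.\<close>
    define K' where "K' = \<bar>K\<bar> + 1"
    have K': "K' > 0" "K \<le> K'" by (auto simp: K'_def)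
    from f e K'(1) obtain g where g: "(\<lambda>n. norm (T n g)) \<longlonglongrightarrow> 0" "dist g f < e / (2 * K')"
      unfolding closure_approachable by (metis divide_pos_pos mem_Collect_eq mult_pos_pos zero_less_numeral)
    from LIMSEQ_D[OF g(1), of "e / 2"] e obtain N where N: "\<And>n. n \<ge> N \<Longrightarrow> norm (T n g) < e / 2"
      by auto
    have "norm (T n f) < e" if "n \<ge> N" for n
    proof -
      have "norm (T n f) \<le> norm (T n g) + norm (T n (f - g))"
        by (metis blinfun.diff_right norm_triangle_sub)
      also have "norm (T n (f - g)) \<le> K' * norm (f - g)"
        using assms[of n "f - g"] mult_right_mono[OF K'(2), of "norm (f - g)"] by simp
      also have "K' * norm (f - g) \<le> e / 2"
        using g(2) K'(1) by (simp add: dist_norm norm_minus_commute field_simps)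
      finally show ?thesis
        using N[OF that] by simp
    qed
    then show "\<exists>N. \<forall>n\<ge>N. norm (norm (T n f) - 0) < e"
      by auto
  qed
  then show ?thesis
    by (metis closure_subset subsetI subset_antisym closure_closed closed_closure)
qed

text \<open>For \<open>f = \<delta>\<^sub>k\<close> the norms in question are those of restrictions of \<open>x \<delta>\<^sub>0\<close> to the sets
  \<open>H k\<^sup>-\<^sup>1 a\<^sup>-\<^sup>n\<close>, which are disjoint by malnormality.\<close>

lemma malnormal_mixing:
  assumes mal: "malnormal_cyclic a" and x: "x \<in> group_vna" and f: "restrict_op (range (zpow a)) f = 0"
  shows "(\<lambda>n. norm (restrict_op (range (zpow a)) (x (left_regular (zpow a (int n)) f)))) \<longlonglongrightarrow> 0"
proof -
  let ?H = "range (zpow a)"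
  note H = add_subgroup_zpow[of a]
  \<comment> \<open>The hypothesis that \<open>f\<close> vanishes on the subgroup is absorbed into
    the last factor, because the density argument ranges over all of \<open>ell2\<close>.\<close>
  define T where "T n = restrict_op ?H o\<^sub>L (x o\<^sub>L (left_regular (zpow a (int n)) o\<^sub>L (id_blinfun - restrict_op ?H)))" for n
  have nT: "norm (T n f) \<le> norm x * norm f" for n f
  proof -
    have "norm (T n f) \<le> norm (x (left_regular (zpow a (int n)) (f - restrict_op ?H f)))"
      unfolding T_def by (simp add: norm_restrict_op blinfun.diff_left)
    also have "\<dots> \<le> norm x * norm (f - restrict_op ?H f)"
      by (metis norm_blinfun norm_left_regular_apply)
    also have "norm (f - restrict_op ?H f) \<le> norm f"
      using restrict_op_pythagoras[of f ?H] by (metis le_add_same_cancel2 norm_ge_zero power2_le_imp_le zero_le_power2)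
    finally show ?thesis
      by (simp add: mult_left_mono)
  qed
  have Tb: "T n \<in> bounded_ops" for n
    unfolding T_def using x by (intro bounded_ops_compose bounded_ops_diff) (auto dest: group_vna_bounded_ops)
  have "(\<lambda>n. norm (T n f)) \<longlonglongrightarrow> 0"
  proof (rule ell2_closed_induct[where P = "\<lambda>f. (\<lambda>n. norm (T n f)) \<longlonglongrightarrow> 0"])
    show "closed {f. (\<lambda>n. norm (T n f)) \<longlonglongrightarrow> 0}"
      by (rule tendsto_0_closed[OF nT])
    show "(\<lambda>n. norm (T n (f + g))) \<longlonglongrightarrow> 0"
      if "(\<lambda>n. norm (T n f)) \<longlonglongrightarrow> 0" "(\<lambda>n. norm (T n g)) \<longlonglongrightarrow> 0" for f g
      using tendsto_add[OF that[THEN tendsto_norm_zero_cancel]]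
      by (simp add: blinfun.add_right tendsto_norm_zero)
    show "(\<lambda>n. norm (T n (c *\<^sub>C f))) \<longlonglongrightarrow> 0" if "(\<lambda>n. norm (T n f)) \<longlonglongrightarrow> 0" for c f
      using tendsto_mult_left_zero[OF that, of "cmod c"]
      by (simp add: bounded_opsD[OF Tb] norm_scaleC mult.commute)
    fix k
    show "(\<lambda>n. norm (T n (point_mass k))) \<longlonglongrightarrow> 0"
    proof (cases "k \<in> ?H")
      case True
      then show ?thesis
        by (simp add: T_def blinfun.diff_left restrict_op_point_mass)
    next
      case k: False
      define C where "C n = {m. m + (zpow a (int n) + k) \<in> ?H}" for n
      have "norm (T n (point_mass k)) = norm (restrict_op (C n) (x (point_mass 0)))" for n
      proof -
        let ?g = "zpow a (int n) + k"
        have "T n (point_mass k) = restrict_op ?H (x (point_mass ?g))"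
          using k by (simp add: T_def blinfun.diff_left restrict_op_point_mass left_regular_point_mass)
        also have "\<dots> = right_regular (- ?g) (restrict_op (C n) (x (point_mass 0)))"
        proof (rule ell2_eqI)
          fix h
          have "ell2_apply (x (point_mass ?g)) h = coeff x (h - ?g)"
            using convolver_point_mass[of x ?g h] x by (simp add: group_vna_eq)
          moreover have "h - ?g \<in> C n \<longleftrightarrow> h \<in> ?H"
            unfolding C_def mem_Collect_eq diff_add_cancel ..
          ultimately show "ell2_apply (restrict_op ?H (x (point_mass ?g))) h
              = ell2_apply (right_regular (- ?g) (restrict_op (C n) (x (point_mass 0)))) h"
            by (simp del: image_iff minus_add)
        qed
        finally show ?thesis by simp
      qed
      moreover have "disjoint_family C"
        unfolding disjoint_family_on_def
      proof (intro ballI impI, rule ccontr)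
        fix m n :: nat assume "m \<noteq> n" "C m \<inter> C n \<noteq> {}"
        then obtain g where g: "g + (zpow a (int m) + k) \<in> ?H" "g + (zpow a (int n) + k) \<in> ?H"
          unfolding C_def by blast
        \<comment> \<open>The common element \<open>g\<close> lies outside the subgroup and yet
          conjugates a nontrivial power of \<open>a\<close> into it.\<close>
        have "g \<notin> ?H"
        proof
          assume "g \<in> ?H"
          then have "k \<in> ?H"
            using g(1) add_subgroup_plus_iff[OF H] by (metis rangeI)
          with k show False ..
        qed
        have "(g + (zpow a (int m) + k)) - (g + (zpow a (int n) + k)) \<in> ?H"
          using g add_subgroupD[OF H] by (metis diff_conv_add_uminus)
        also have "(g + (zpow a (int m) + k)) - (g + (zpow a (int n) + k))
            = g + (zpow a (int m) - zpow a (int n)) - g"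
          by (simp only: diff_conv_add_uminus minus_add add.assoc[symmetric] add_right_cancel_neg)
        finally show False
          using mal \<open>g \<notin> ?H\<close> \<open>m \<noteq> n\<close> unfolding malnormal_cyclic_def zpow_diff by auto
      qed
      ultimately show ?thesis
        using restrict_op_disjoint_tendsto by simp
    qed
  qed simp
  then show ?thesis
    using f by (simp add: T_def blinfun.diff_left)
qed

text \<open>Pythagoras for the image of the point mass at 0; it trades the distance from the
  subalgebra for the mass on \<open>H\<close>.\<close>

lemma norm2_diff_expect:
  assumes H: "add_subgroup H" and x: "x \<in> group_vna"
  shows "(norm2 group_trace (x - expect H x))\<^sup>2
    = (norm (x (point_mass 0)))\<^sup>2 - (norm (restrict_op H (x (point_mass 0))))\<^sup>2"
proof -
  have "x - expect H x \<in> bounded_ops"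
    using group_vna_bounded_ops[OF x] group_vna_bounded_ops[OF subsetD[OF subgroup_vna_subset expect_subgroup_vna[OF H x]]]
    by (rule bounded_ops_diff)
  then have "norm2 group_trace (x - expect H x) = norm (x (point_mass 0) - restrict_op H (x (point_mass 0)))"
    by (simp add: norm2_group_trace blinfun.diff_left expect_point_mass[OF H])
  then show ?thesis
    using restrict_op_pythagoras[of "x (point_mass 0)" H] by simp
qed

section \<open>Strong singularity and the Popa invariant\<close>

lemma norm2_nonneg: "x \<in> bounded_ops \<Longrightarrow> 0 \<le> norm2 group_trace x"
  by (simp add: norm2_group_trace)

text \<open>The test element x = u a^n \<open>adj u\<close> lies in the conjugated algebra, so the
  squared norm of \<open>\<phi> x\<close> is 1 minus the squared 2-norm of E(x). Mixing replaces
  E(x) by E(u) a^n E(\<open>adj u\<close>) up to \<open>e n\<close>. The factors commute, and all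
  but E(u) are contractions, so this has 2-norm at most \<open>c\<close>, the 2-norm of E(u). In the
  limit 1 - c^2 \<le> S^2, and 1 - c^2 is the squared 2-norm of u - E(u).\<close>

lemma strongly_singular_zpow:
  assumes mal: "malnormal_cyclic a"
  shows "strongly_singular_masa group_trace group_vna (subgroup_vna (range (zpow a)))"
  unfolding strongly_singular_masa_def
proof (intro conjI ballI impI masa_zpow[OF mal])
  let ?H = "range (zpow a)"
  let ?A = "subgroup_vna ?H" and ?d = "point_mass 0 :: 'a ell2" and ?w = "\<lambda>n. left_regular (zpow a (int n))"
  note H = add_subgroup_zpow[of a]
  note E = expect_subgroup_vna[OF H]
  have EM: "expect ?H x \<in> group_vna" if "x \<in> group_vna" for x
    using E[OF that] subgroup_vna_subset by blast
  fix u :: "'a ell2 \<Rightarrow>\<^sub>L 'a ell2" assume u: "u \<in> group_vna" "is_unitary u"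
  note uu = unitaryD[OF u(2)]
  have au: "adj u \<in> group_vna"
    using u(1) by (rule group_vna_adj)
  have nu: "norm (u x) = norm x" "norm (adj u x) = norm x" for x
  proof -
    have *: "(norm (u x))\<^sup>2 = (norm x)\<^sup>2" for x
      by (metis cinner_adj_right cinner_self of_real_eq_iff uu(1,3))
    then show "norm (u x) = norm x" for x
      by (metis norm_ge_zero power2_eq_imp_eq)
    then show "norm (adj u x) = norm x"
      by (metis uu(2))
  qed
  have nle: "norm u \<le> 1" "norm (adj u) \<le> 1"
    by (rule norm_blinfun_bound; simp add: nu)+
  define S where "S = norm_inf2 group_trace group_vna
    (\<lambda>x. cond_exp group_trace group_vna (conjugate u ?A) x - cond_exp group_trace group_vna ?A x)"
  define \<phi> where "\<phi> x = (u o\<^sub>L expect ?H (adj u o\<^sub>L x o\<^sub>L u) o\<^sub>L adj u) - expect ?H x" for x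
  have S: "S = (SUP x\<in>{x \<in> group_vna. norm x \<le> 1}. norm2 group_trace (\<phi> x))"
    unfolding S_def norm_inf2_def \<phi>_def
    by (intro SUP_cong) (auto simp: cond_exp_subgroup_vna[OF H] cond_exp_conjugate[OF H u])
  have conjM: "u o\<^sub>L x o\<^sub>L adj u \<in> group_vna" "adj u o\<^sub>L x o\<^sub>L u \<in> group_vna" if "x \<in> group_vna" for x
    using that u(1) au by (auto intro!: group_vna_compose)
  have \<phi>M: "\<phi> x \<in> group_vna" if "x \<in> group_vna" for x
    unfolding \<phi>_def using that by (intro group_vna_diff conjM EM)
  have n3: "norm (r o\<^sub>L x o\<^sub>L s) \<le> norm x" if "norm r \<le> 1" "norm s \<le> 1" for r x s :: "'a ell2 \<Rightarrow>\<^sub>L 'a ell2"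
  proof -
    have "norm (r o\<^sub>L x o\<^sub>L s) \<le> norm r * norm x * norm s"
      by (meson norm_blinfun_compose order_trans mult_right_mono norm_ge_zero)
    also have "\<dots> \<le> 1 * norm x * 1"
      using that by (intro mult_mono) auto
    finally show ?thesis by simp
  qed
  \<comment> \<open>A supremum of reals dominates its members only if the set is bounded; the crude
    bound 2 is enough.\<close>
  have bdd: "bdd_above ((\<lambda>x. norm2 group_trace (\<phi> x)) ` {x \<in> group_vna. norm x \<le> 1})"
  proof (rule bdd_aboveI2)
    fix x assume x: "x \<in> {x \<in> group_vna. norm (x :: 'a ell2 \<Rightarrow>\<^sub>L 'a ell2) \<le> 1}"
    have "norm2 group_trace (\<phi> x) \<le> norm (\<phi> x)"
      using x \<phi>M norm_point_mass_image_le by (simp add: norm2_group_trace group_vna_bounded_ops)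
    also have "\<dots> \<le> norm (u o\<^sub>L expect ?H (adj u o\<^sub>L x o\<^sub>L u) o\<^sub>L adj u) + norm (expect ?H x)"
      unfolding \<phi>_def by (rule norm_triangle_ineq4)
    also have "\<dots> \<le> 1 + 1"
      using x n3[OF nle, of "expect ?H (adj u o\<^sub>L x o\<^sub>L u)"] norm_expect_le[OF H, of "adj u o\<^sub>L x o\<^sub>L u"]
        n3[OF nle(2,1), of x] norm_expect_le[OF H, of x]
      by (intro add_mono) auto
    finally show "norm2 group_trace (\<phi> x) \<le> 1 + 1" .
  qed
  define c where "c = norm (restrict_op ?H (u ?d))"
  \<comment> \<open>The contribution of the part of \<open>adj u ?d\<close> that lies off the
    subgroup.\<close>
  define e where "e n = norm (restrict_op ?H (u (?w n (adj u ?d - restrict_op ?H (adj u ?d)))))" for n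
  have e: "e \<longlonglongrightarrow> 0"
    unfolding e_def by (rule malnormal_mixing[OF mal u(1)]) (simp add: blinfun.diff_right)
  have S0: "0 \<le> S" and key: "1 - S\<^sup>2 \<le> (c + e n)\<^sup>2" for n
  proof -
    define x where "x = u o\<^sub>L ?w n o\<^sub>L adj u"
    have wA: "?w n \<in> ?A"
      by (rule subgroup_vna_left_regular) simp
    have w: "?w n \<in> group_vna"
      by (rule group_vna_left_regular)
    have x: "x \<in> group_vna" "norm x \<le> 1"
      unfolding x_def using conjM[OF w] by (auto intro!: norm_blinfun_bound simp: nu)
    have "adj u o\<^sub>L x o\<^sub>L u = ?w n"
      by (rule blinfun_eqI) (simp add: x_def uu)
    moreover have "expect ?H (?w n) = ?w n"
      using expect_trace_preserving[OF H] wA unfolding is_trace_preserving_cond_exp_def by blast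
    ultimately have \<phi>x: "\<phi> x = x - expect ?H x"
      by (simp add: \<phi>_def flip: x_def)
    have le: "norm2 group_trace (x - expect ?H x) \<le> S"
      unfolding S \<phi>x[symmetric] by (rule cSUP_upper[OF _ bdd]) (simp add: x)
    have n0: "0 \<le> norm2 group_trace (x - expect ?H x)"
      using \<phi>M[OF x(1)] by (intro norm2_nonneg group_vna_bounded_ops) (simp add: \<phi>x)
    then show "0 \<le> S"
      using le by linarith
    have "norm (x ?d) = 1"
      by (simp add: x_def nu)
    then have "(norm2 group_trace (x - expect ?H x))\<^sup>2 = 1 - (norm (restrict_op ?H (x ?d)))\<^sup>2"
      by (simp add: norm2_diff_expect[OF H x(1)])
    moreover have "(norm2 group_trace (x - expect ?H x))\<^sup>2 \<le> S\<^sup>2"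
      by (intro power_mono le n0)
    moreover have "norm (restrict_op ?H (x ?d)) \<le> c + e n"
    proof -
      define v where "v = restrict_op ?H (adj u ?d)"
      have v: "v = expect ?H (adj u) ?d"
        by (simp add: v_def expect_point_mass[OF H])
      have wv: "restrict_op ?H (?w n v) = ?w n v"
        unfolding subgroup_vna_restrict_subgroup[OF H wA] by (simp add: v_def)
      have "restrict_op ?H (u (?w n v)) = restrict_op ?H (expect ?H u (?w n v))"
        using restrict_op_expect[OF H, of 0 u "?w n v"] wv by simp
      also have "\<dots> = expect ?H u (?w n v)"
        by (simp only: subgroup_vna_restrict_subgroup[OF H E[OF u(1)]] wv)
      also have "\<dots> = (expect ?H u o\<^sub>L (?w n o\<^sub>L expect ?H (adj u))) ?d"
        by (simp add: v)
      \<comment> \<open>Commuting E(u) to the right places it next to \<open>?d\<close>, where its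
        norm is \<open>c\<close>; what stays on the left is contractive.\<close>
      also have "expect ?H u o\<^sub>L (?w n o\<^sub>L expect ?H (adj u)) = (?w n o\<^sub>L expect ?H (adj u)) o\<^sub>L expect ?H u"
        using abelian_subgroup_vna_zpow[of a] E[OF u(1)] subgroup_vna_compose[OF H wA E[OF au]]
        unfolding abelian_def by blast
      finally have "norm (restrict_op ?H (u (?w n v))) = norm (expect ?H (adj u) (expect ?H u ?d))"
        by simp
      also have "\<dots> \<le> norm (expect ?H (adj u)) * norm (expect ?H u ?d)"
        by (rule norm_blinfun)
      also have "\<dots> \<le> 1 * norm (expect ?H u ?d)"
        using norm_expect_le[OF H, of "adj u"] nle(2) by (intro mult_right_mono) auto
      finally have "norm (restrict_op ?H (u (?w n v))) \<le> c"
        by (simp add: c_def expect_point_mass[OF H])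
      moreover have "restrict_op ?H (x ?d) = restrict_op ?H (u (?w n v))
          + restrict_op ?H (u (?w n (adj u ?d - v)))"
        by (simp add: x_def blinfun.diff_right)
      then have "norm (restrict_op ?H (x ?d)) \<le> norm (restrict_op ?H (u (?w n v))) + e n"
        unfolding e_def v_def[symmetric] by (metis norm_triangle_ineq)
      ultimately show ?thesis by linarith
    qed
    then have "(norm (restrict_op ?H (x ?d)))\<^sup>2 \<le> (c + e n)\<^sup>2"
      by (intro power_mono) auto
    ultimately show "1 - S\<^sup>2 \<le> (c + e n)\<^sup>2"
      by linarith
  qed
  have "1 - S\<^sup>2 \<le> (c + 0)\<^sup>2"
    by (rule LIMSEQ_le_const[OF tendsto_power[OF tendsto_add[OF tendsto_const e]]]) (use key in auto)
  moreover have "(norm2 group_trace (u - expect ?H u))\<^sup>2 = 1 - c\<^sup>2"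
    by (simp add: norm2_diff_expect[OF H u(1)] nu c_def)
  ultimately have "(norm2 group_trace (u - expect ?H u))\<^sup>2 \<le> S\<^sup>2"
    by simp
  then have "norm2 group_trace (u - expect ?H u) \<le> S"
    using S0 by (rule power2_le_imp_le)
  then show "norm2 group_trace (u - cond_exp group_trace group_vna ?A u) \<le> norm_inf2 group_trace group_vna
    (\<lambda>x. cond_exp group_trace group_vna (conjugate u ?A) x - cond_exp group_trace group_vna ?A x)"
    by (simp add: cond_exp_subgroup_vna[OF H u(1)] S_def)
qed

text \<open>Let \<open>p\<close> and \<open>q\<close> be the initial and final projections of
  \<open>v\<close>. Every \<open>x\<close> in the conjugated algebra satisfies q x = x, so on the
  unit ball its 2-norm is at most that of \<open>q\<close>, which by traciality is that of
  \<open>p\<close>. Conversely v a^n \<open>adj v\<close> has 2-norm exactly that of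
  \<open>p\<close>, since a^n commutes with \<open>p\<close>, and its mass on H tends to 0.\<close>

lemma popa_delta_dist_zpow:
  assumes mal: "malnormal_cyclic a"
    and v: "popa_admissible group_vna (subgroup_vna (range (zpow a))) v"
  shows "delta_dist group_trace group_vna (conjugate v (subgroup_vna (range (zpow a)))) (subgroup_vna (range (zpow a)))
    = norm2 group_trace (adj v o\<^sub>L v)"
proof -
  let ?H = "range (zpow a)"
  let ?A = "subgroup_vna ?H" and ?d = "point_mass 0 :: 'a ell2" and ?w = "\<lambda>n. left_regular (zpow a (int n))"
  note H = add_subgroup_zpow[of a]
  note E = expect_subgroup_vna[OF H]
  define p q where "p = adj v o\<^sub>L v" and "q = v o\<^sub>L adj v"
  have vM: "v \<in> group_vna" and pi: "is_projection p" and pA: "p \<in> ?A" and qA: "q \<in> ?A" and qp: "q o\<^sub>L p = 0"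
    using v by (auto simp: popa_admissible_def partial_isometry_def p_def q_def)
  have vb: "v \<in> bounded_ops"
    using vM by (rule group_vna_bounded_ops)
  have avM: "adj v \<in> group_vna"
    using vM by (rule group_vna_adj)
  have pb: "p \<in> bounded_ops" "p o\<^sub>L p = p" "adj p = p"
    using pi by (auto simp: is_projection_def)
  have commA: "x o\<^sub>L y = y o\<^sub>L x" if "x \<in> ?A" "y \<in> ?A" for x y
    using abelian_subgroup_vna_zpow[of a] that unfolding abelian_def by blast
  have norm_v: "(norm (v f))\<^sup>2 = Re (cinner (p f) f)" for f
    using cinner_self[of "v f"] by (simp add: p_def cinner_adj_left[OF vb])
  have p_norm: "Re (cinner (p f) f) = (norm (p f))\<^sup>2" for f
  proof -
    have "cinner (p (p f)) f = cinner (p f) (p f)"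
      using cinner_adj_left[OF pb(1), of "p f" f] by (simp add: pb(3))
    then show ?thesis
      by (metis Re_complex_of_real blinfun_apply_blinfun_compose cinner_self pb(2))
  qed
  have nv: "norm (v f) = norm (p f)" for f
    using norm_v[of f] p_norm[of f] by simp
  have vp: "v o\<^sub>L p = v"
  proof (rule blinfun_eqI)
    fix f
    have "p (p f) = p f"
      by (metis blinfun_apply_blinfun_compose pb(2))
    then have "norm (v (p f - f)) = 0"
      unfolding nv by (simp add: blinfun.diff_right)
    then show "(v o\<^sub>L p) f = v f"
      by (simp add: blinfun.diff_right)
  qed
  have pav: "p o\<^sub>L adj v = adj v"
    using arg_cong[OF vp, of adj] by (simp add: adj_compose vb pb)
  have qv: "q o\<^sub>L v = v"
    using vp by (simp add: q_def p_def compose_assoc)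
  have avq: "adj v o\<^sub>L q = adj v"
    using pav by (simp add: q_def p_def compose_assoc)
  have adjq: "adj q = q"
    by (simp add: q_def adj_compose vb)
  have contr_p: "norm (p f) \<le> norm f" for f
  proof -
    have "(norm (p f))\<^sup>2 \<le> norm (p f) * norm f"
      using p_norm[of f] complex_Re_le_cmod[of "cinner (p f) f"] norm_cinner_le[of "p f" f] by linarith
    then show ?thesis
      by (cases "norm (p f) = 0") (auto simp: power2_eq_square)
  qed
  have v1: "norm v \<le> 1"
    using contr_p by (intro norm_blinfun_bound) (auto simp: nv)
  have av1: "norm (adj v) \<le> 1"
    using norm_adj_le[OF vb] v1 by linarith
  have nav: "norm (adj v ?d) = norm (p ?d)"
    using norm_adj_point_mass[OF vM] by (simp add: nv)
  have nq: "norm (q ?d) = norm (p ?d)"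
  proof -
    have "q o\<^sub>L q = q"
      using qv by (simp add: q_def compose_assoc[symmetric])
    then have "q (q ?d) = q ?d"
      by (metis blinfun_apply_blinfun_compose)
    moreover have "cinner (q ?d) (q ?d) = cinner (q (q ?d)) ?d"
      by (metis adjq bounded_ops_compose adj_bounded_ops cinner_adj_left q_def vb)
    ultimately have "cinner (q ?d) (q ?d) = cinner (adj v ?d) (adj v ?d)"
      by (simp add: q_def cinner_adj_right[OF vb] del: cinner_point_mass_right)
    then show ?thesis
      by (simp add: cinner_self nav del: of_real_power flip: of_real_power)
  qed
  have conjM: "v o\<^sub>L x o\<^sub>L adj v \<in> group_vna" if "x \<in> ?A" for x
    using that subgroup_vna_subset[of ?H] vM avM by (auto intro!: group_vna_compose)
  define B where "B = {x \<in> conjugate v ?A. norm x \<le> 1}"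
  have BM: "x \<in> group_vna" if "x \<in> B" for x
    using that conjM by (auto simp: B_def conjugate_def)
  define D where "D = delta_dist group_trace group_vna (conjugate v ?A) ?A"
  have D: "D = (SUP x\<in>B. norm2 group_trace (x - expect ?H x))"
    unfolding D_def delta_dist_def B_def[symmetric]
    by (intro SUP_cong) (auto simp: cond_exp_subgroup_vna[OF H] BM)
  have n2p: "norm2 group_trace (adj v o\<^sub>L v) = norm (p ?d)"
    by (simp add: norm2_group_trace pb(1) flip: p_def)
  have diffM: "x - expect ?H x \<in> bounded_ops" if "x \<in> group_vna" for x
    using that E[OF that] subgroup_vna_subset[of ?H] by (intro bounded_ops_diff group_vna_bounded_ops) auto
  have upper: "norm2 group_trace (x - expect ?H x) \<le> norm (p ?d)" if x: "x \<in> B" for x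
  proof -
    have xM: "x \<in> group_vna"
      by (rule BM[OF x])
    obtain y where y: "y \<in> ?A" "x = v o\<^sub>L y o\<^sub>L adj v" "norm x \<le> 1"
      using x by (auto simp: B_def conjugate_def)
    have xb: "x \<in> bounded_ops" "q \<in> bounded_ops"
      using xM vb by (auto intro: group_vna_bounded_ops bounded_ops_compose simp: q_def)
    \<comment> \<open>The projection stands on the left of \<open>x\<close>; passing to the adjoint,
      which has the same 2-norm, lets it act on \<open>?d\<close>.\<close>
    have "q o\<^sub>L x = x"
      unfolding y(2) by (simp add: compose_assoc[symmetric] qv)
    then have "adj x o\<^sub>L q = adj x"
      using adj_compose[OF xb(2,1)] by (simp add: adjq)
    then have "norm (x ?d) = norm (adj x (q ?d))"
      using norm_adj_point_mass[OF xM] by (metis blinfun_apply_blinfun_compose)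
    also have "\<dots> \<le> norm (adj x) * norm (q ?d)"
      by (rule norm_blinfun)
    also have "\<dots> \<le> 1 * norm (p ?d)"
      unfolding nq using norm_adj_le[OF xb(1)] y(3) by (intro mult_right_mono) auto
    finally have "(norm (x ?d))\<^sup>2 \<le> (norm (p ?d))\<^sup>2"
      by (intro power_mono) auto
    then have "(norm2 group_trace (x - expect ?H x))\<^sup>2 \<le> (norm (p ?d))\<^sup>2"
      using zero_le_power2[of "norm (restrict_op ?H (x ?d))"] unfolding norm2_diff_expect[OF H xM] by linarith
    then show ?thesis
      by (rule power2_le_imp_le) simp
  qed
  have ne: "B \<noteq> {}"
  proof -
    have "v o\<^sub>L 0 o\<^sub>L adj v \<in> conjugate v ?A"
      unfolding conjugate_def by (rule imageI[OF subgroup_vna_zero])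
    then have "0 \<in> B"
      by (simp add: B_def compose_linear)
    then show ?thesis by blast
  qed
  have "D \<le> norm (p ?d)"
    unfolding D by (rule cSUP_least[OF ne upper])
  moreover have "norm (p ?d) \<le> D"
  proof -
    have bdd: "bdd_above ((\<lambda>x. norm2 group_trace (x - expect ?H x)) ` B)"
      by (rule bdd_aboveI2[OF upper])
    \<comment> \<open>Since \<open>adj v\<close> = p \<open>adj v\<close> q and A is abelian, its
      expectation is p q E(\<open>adj v\<close>) = 0, by orthogonality of the two
      projections.\<close>
    have v0: "restrict_op ?H (adj v ?d) = 0"
    proof -
      have qd: "restrict_op ?H (q ?d) = q ?d"
        using qA by (simp add: subgroup_vna_iff)
      have "restrict_op ?H (adj v ?d) = restrict_op ?H (p (adj v (q ?d)))"
        using pav avq by (metis blinfun_apply_blinfun_compose)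
      also have "\<dots> = p (restrict_op ?H (adj v (q ?d)))"
        by (rule subgroup_vna_restrict_subgroup[OF H pA])
      also have "restrict_op ?H (adj v (q ?d)) = restrict_op ?H (expect ?H (adj v) (q ?d))"
        using restrict_op_expect[OF H, of 0 "adj v" "q ?d"] qd by simp
      also have "\<dots> = expect ?H (adj v) (q ?d)"
        by (simp add: subgroup_vna_restrict_subgroup[OF H E[OF avM]] qd)
      also have "\<dots> = q (expect ?H (adj v) ?d)"
        using commA[OF E[OF avM] qA] by (metis blinfun_apply_blinfun_compose)
      also have "p (q (expect ?H (adj v) ?d)) = 0"
        using commA[OF pA qA] qp by (metis blinfun.zero_left blinfun_apply_blinfun_compose)
      finally show ?thesis .
    qed
    define e where "e n = norm (restrict_op ?H (v (?w n (adj v ?d))))" for n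
    have e: "e \<longlonglongrightarrow> 0"
      unfolding e_def by (rule malnormal_mixing[OF mal vM v0])
    have D0: "0 \<le> D" and key: "(norm (p ?d))\<^sup>2 - (e n)\<^sup>2 \<le> D\<^sup>2" for n
    proof -
      define x where "x = v o\<^sub>L ?w n o\<^sub>L adj v"
      have wA: "?w n \<in> ?A"
        by (rule subgroup_vna_left_regular) simp
      have "norm x \<le> 1"
      proof (rule norm_blinfun_bound)
        fix f
        have "norm (x f) \<le> norm v * norm (?w n (adj v f))"
          by (simp add: x_def norm_blinfun del: norm_left_regular_apply)
        also have "\<dots> \<le> 1 * norm (adj v f)"
          using v1 by (simp add: mult_left_le_one_le)
        also have "norm (adj v f) \<le> 1 * norm f"
          using norm_blinfun[of "adj v" f] mult_right_mono[OF av1, of "norm f"] by simp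
        finally show "norm (x f) \<le> 1 * norm f" by simp
      qed simp
      then have x: "x \<in> B" "x \<in> group_vna"
        using wA conjM[OF wA] by (auto simp: B_def conjugate_def x_def)
      have le: "norm2 group_trace (x - expect ?H x) \<le> D"
        unfolding D by (rule cSUP_upper[OF x(1) bdd])
      have n0: "0 \<le> norm2 group_trace (x - expect ?H x)"
        by (rule norm2_nonneg[OF diffM[OF x(2)]])
      with le show "0 \<le> D" by linarith
      have "p (?w n (adj v ?d)) = ?w n (adj v ?d)"
        using commA[OF pA wA] pav by (metis blinfun_apply_blinfun_compose)
      then have "norm (x ?d) = norm (p ?d)"
        by (simp add: x_def nv nav)
      moreover have "(norm2 group_trace (x - expect ?H x))\<^sup>2 \<le> D\<^sup>2"
        by (intro power_mono le n0)
      ultimately show "(norm (p ?d))\<^sup>2 - (e n)\<^sup>2 \<le> D\<^sup>2"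
        unfolding norm2_diff_expect[OF H x(2)] by (simp add: x_def e_def)
    qed
    have "(norm (p ?d))\<^sup>2 - 0\<^sup>2 \<le> D\<^sup>2"
      by (rule LIMSEQ_le_const2[OF tendsto_diff[OF tendsto_const tendsto_power[OF e]]]) (use key in auto)
    then have "(norm (p ?d))\<^sup>2 \<le> D\<^sup>2"
      by simp
    then show ?thesis
      by (rule power2_le_imp_le[OF _ D0])
  qed
  ultimately show ?thesis
    unfolding n2p D_def[symmetric] by (rule antisym)
qed

text \<open>With equality for every admissible element, 1 satisfies the condition. The given
  \<open>v\<close> makes it the greatest such constant, by division by a positive 2-norm.\<close>

lemma popa_delta_zpow:
  assumes mal: "malnormal_cyclic a"
    and v: "popa_admissible group_vna (subgroup_vna (range (zpow a))) v"
  shows "popa_delta group_trace group_vna (subgroup_vna (range (zpow a))) = 1"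
  unfolding popa_delta_def
proof (rule Greatest_equality)
  have vM: "v \<in> bounded_ops" "v \<noteq> 0" "v \<in> group_vna"
    using v by (auto simp: popa_admissible_def dest: group_vna_bounded_ops)
  have pos: "norm2 group_trace (adj v o\<^sub>L v) > 0"
  proof -
    \<comment> \<open>The point mass at 0 separates: an element of the group algebra that kills it
      is 0.\<close>
    have "(adj v o\<^sub>L v) (point_mass 0) \<noteq> 0"
    proof
      assume "(adj v o\<^sub>L v) (point_mass 0) = 0"
      then have "cinner (v (point_mass 0)) (v (point_mass 0)) = 0"
        unfolding cinner_adj_left[OF vM(1), symmetric] by simp
      then have "v (point_mass 0) = 0"
        by simp
      then have "v = 0"
        using vM(3) by (intro group_vna_eqI) (auto simp: group_vna_eq)
      with vM(2) show False ..
    qed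
    then show ?thesis
      by (simp add: norm2_group_trace vM(1) bounded_ops_compose)
  qed
  fix r
  assume "\<forall>v. popa_admissible group_vna (subgroup_vna (range (zpow a))) v \<longrightarrow>
      r * norm2 group_trace (adj v o\<^sub>L v)
      \<le> delta_dist group_trace group_vna (conjugate v (subgroup_vna (range (zpow a)))) (subgroup_vna (range (zpow a)))"
  with v have "r * norm2 group_trace (adj v o\<^sub>L v) \<le> norm2 group_trace (adj v o\<^sub>L v)"
    using popa_delta_dist_zpow[OF mal v] by metis
  with pos show "r \<le> 1"
    by simp
qed (auto simp: popa_delta_dist_zpow[OF mal])


section \<open>Free groups\<close>

lemma foldr_word_equiv:
  assumes S: "\<And>l x. x \<in> S \<Longrightarrow> \<phi> l x \<in> S"
    and inv: "\<And>i b x. x \<in> S \<Longrightarrow> \<phi> (i, b) (\<phi> (i, \<not> b) x) = x"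
    and uv: "word_equiv u v" and x: "x \<in> S"
  shows "foldr \<phi> u x = foldr \<phi> v x"
  using uv
proof (induction rule: word_equiv.induct)
  case (cancel u i b v)
  have "foldr \<phi> v x \<in> S"
    by (induction v) (auto intro: S x)
  then show ?case by (simp add: inv)
qed auto

definition free_act :: "('i \<times> bool \<Rightarrow> 'x \<Rightarrow> 'x) \<Rightarrow> 'i free_group \<Rightarrow> 'x \<Rightarrow> 'x" where
  "free_act \<phi> g = foldr \<phi> (rep_free_group g)"

text \<open>The carrier \<open>S\<close> is there for \<open>prepend\<close>, whose letters invert
  each other on reduced words but not on arbitrary lists. Exponent sums and the dihedral action use
  \<open>UNIV\<close>.\<close>

definition inverse_letters_on :: "'x set \<Rightarrow> ('i \<times> bool \<Rightarrow> 'x \<Rightarrow> 'x) \<Rightarrow> bool" where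
  "inverse_letters_on S \<phi> \<longleftrightarrow>
    (\<forall>l. \<forall>x\<in>S. \<phi> l x \<in> S) \<and> (\<forall>i b. \<forall>x\<in>S. \<phi> (i, b) (\<phi> (i, \<not> b) x) = x)"

lemma free_act_abs:
  assumes "inverse_letters_on S \<phi>" "x \<in> S"
  shows "free_act \<phi> (abs_free_group w) x = foldr \<phi> w x"
proof -
  have "word_equiv (rep_free_group (abs_free_group w)) w"
    using Quotient3_abs_rep[OF Quotient3_free_group, of "abs_free_group w"]
    by (simp add: free_group.abs_eq_iff)
  then show ?thesis
    unfolding free_act_def using assms
    by (intro foldr_word_equiv[of S]) (auto simp: inverse_letters_on_def)
qed

lemma free_act_plus:
  assumes "inverse_letters_on S \<phi>" "x \<in> S"
  shows "free_act \<phi> (g + h) x = free_act \<phi> g (free_act \<phi> h x)"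
proof -
  obtain u v where gh: "g = abs_free_group u" "h = abs_free_group v"
    by (metis Quotient3_abs_rep[OF Quotient3_free_group])
  have "foldr \<phi> v x \<in> S"
    using assms by (induction v) (auto simp: inverse_letters_on_def)
  then show ?thesis
    by (simp add: gh plus_free_group.abs_eq free_act_abs[OF assms] free_act_abs[OF assms(1)])
qed

lemma free_act_zero:
  assumes "inverse_letters_on S \<phi>" "x \<in> S"
  shows "free_act \<phi> 0 x = x"
  using free_act_abs[OF assms, of "[]"] by (simp add: zero_free_group_def)

lemma free_generator_abs: "free_generator i = abs_free_group [(i, True)]"
  by (simp add: free_generator_def)

lemma uminus_free_generator_abs: "- free_generator i = abs_free_group [(i, False)]"
  by (simp add: free_generator_def uminus_free_group.abs_eq inverse_word_def)

lemma zpow_nat_free_generator: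
  "zpow (free_generator i) (int n) = abs_free_group (replicate n (i, True))"
proof (induction n)
  case (Suc n)
  have "zpow (free_generator i) (int (Suc n)) = free_generator i + zpow (free_generator i) (int n)"
    using zpow_succ[of "free_generator i" "int n"] by (simp add: add.commute)
  with Suc show ?case
    by (simp add: free_generator_abs plus_free_group.abs_eq)
qed (simp add: zero_free_group_def)

subsection \<open>Reduced words\<close>

definition inv_letter :: "'i \<times> bool \<Rightarrow> 'i \<times> bool" where
  "inv_letter l = (fst l, \<not> snd l)"

abbreviation reduced_word :: "('i \<times> bool) list \<Rightarrow> bool" where
  "reduced_word \<equiv> successively (\<lambda>x y. y \<noteq> inv_letter x)"

text \<open>Van der Waerden's action on reduced words. Letting a group element act on the empty word
  gives its normal form, so uniqueness requires no confluence argument.\<close>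

fun prepend :: "'i \<times> bool \<Rightarrow> ('i \<times> bool) list \<Rightarrow> ('i \<times> bool) list" where
  "prepend l [] = [l]"
| "prepend l (x # w) = (if x = inv_letter l then w else l # x # w)"

lemma inv_letter_inv_letter [simp]: "inv_letter (inv_letter l) = l"
  by (simp add: inv_letter_def)

lemma inv_letter_Pair: "inv_letter (i, b) = (i, \<not> b)"
  by (simp add: inv_letter_def)

lemma reduced_prepend: "reduced_word w \<Longrightarrow> reduced_word (prepend l w)"
  by (cases w) (auto simp: successively_Cons)

lemma prepend_reduced: "reduced_word (l # w) \<Longrightarrow> prepend l w = l # w"
  by (cases w) auto

lemma inverse_letters_prepend: "inverse_letters_on {w. reduced_word w} prepend"
proof -
  have "prepend l (prepend (inv_letter l) w) = w" if "reduced_word w" for l and w :: "('i \<times> bool) list"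
    using that prepend_reduced by (cases w) auto
  from this[of _ "(i, b)" for i b] show ?thesis
    unfolding inverse_letters_on_def
    by (auto simp: reduced_prepend inv_letter_Pair)
qed

lemma foldr_prepend_reduced: "reduced_word w \<Longrightarrow> foldr prepend w [] = w"
  by (induction w) (auto simp: prepend_reduced successively_Cons)

definition normal_form :: "'i free_group \<Rightarrow> ('i \<times> bool) list" where
  "normal_form g = free_act prepend g []"

lemma normal_form_abs: "reduced_word w \<Longrightarrow> normal_form (abs_free_group w) = w"
  unfolding normal_form_def
  by (simp add: free_act_abs[OF inverse_letters_prepend] foldr_prepend_reduced)

lemma abs_prepend: "abs_free_group (prepend l w) = abs_free_group (l # w)"
proof (cases "\<exists>w'. w = inv_letter l # w'")
  case True
  then show ?thesis
    using word_equiv.sym[OF word_equiv.cancel[of "[]" "fst l" "snd l"]]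
    by (auto simp: free_group.abs_eq_iff inv_letter_def)
next
  case False
  then have "prepend l w = l # w"
    by (cases w) auto
  then show ?thesis by simp
qed

lemma normal_form_reduced: "reduced_word (normal_form g)"
  and abs_normal_form: "abs_free_group (normal_form g) = g"
proof -
  obtain w where g: "g = abs_free_group w"
    by (metis Quotient3_abs_rep[OF Quotient3_free_group])
  have nf: "normal_form g = foldr prepend w []"
    by (simp add: g normal_form_def free_act_abs[OF inverse_letters_prepend])
  show "reduced_word (normal_form g)"
    unfolding nf by (induction w) (auto simp: reduced_prepend)
  have "abs_free_group (foldr prepend w []) = abs_free_group w"
  proof (induction w)
    case (Cons l w)
    then have "abs_free_group ([l] @ foldr prepend w []) = abs_free_group ([l] @ w)"
      unfolding plus_free_group.abs_eq[symmetric] by simp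
    then show ?case by (simp add: abs_prepend)
  qed simp
  then show "abs_free_group (normal_form g) = g"
    unfolding nf by (simp only: g)
qed

section \<open>Exponent sums and malnormality of a generator\<close>

definition exponent :: "'i \<Rightarrow> 'i free_group \<Rightarrow> int" where
  "exponent i g = free_act (\<lambda>(j, b) t. if j = i then (if b then t + 1 else t - 1) else t) g 0"

lemma exponent_plus: "exponent i (g + h) = exponent i g + exponent i h"
proof -
  let ?\<phi> = "\<lambda>(j, b) t. if j = i then (if b then t + 1 else t - 1) else t :: int"
  have inv: "inverse_letters_on UNIV ?\<phi>"
    by (auto simp: inverse_letters_on_def)
  have "free_act ?\<phi> g t = free_act ?\<phi> g 0 + t" for t
  proof -
    obtain w where g: "g = abs_free_group w"
      by (metis Quotient3_abs_rep[OF Quotient3_free_group])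
    have "foldr ?\<phi> w t = foldr ?\<phi> w 0 + t"
      by (induction w) auto
    then show ?thesis
      by (simp add: g free_act_abs[OF inv])
  qed
  then show ?thesis
    unfolding exponent_def free_act_plus[OF inv UNIV_I] .
qed

lemma exponent_free_generator: "exponent i (free_generator i) = 1"
  unfolding exponent_def free_generator_abs
  by (subst free_act_abs[of UNIV]) (auto simp: inverse_letters_on_def)

lemma exponent_zero: "exponent i 0 = 0"
  using exponent_plus[of i 0 0] by simp

lemma exponent_uminus: "exponent i (- g) = - exponent i g"
  using exponent_plus[of i "- g" g] by (simp add: exponent_zero)

lemma exponent_zpow: "exponent i (zpow (free_generator i) n) = n"
proof (induction n rule: int_induct[where k = 0])
  case (step1 n)
  then show ?case
    by (simp add: zpow_succ exponent_plus exponent_free_generator)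
next
  case (step2 n)
  then show ?case
    using zpow_succ[of "free_generator i" "n - 1"] exponent_plus[of i "free_generator i"]
    by (simp add: exponent_free_generator)
qed (simp add: exponent_zero)

text \<open>A shortest element \<open>g'\<close> of the double coset \<open>\<langle>a\<rangle> g \<langle>a\<rangle>\<close> has a reduced word that neither begins nor
  ends with a power of \<open>a\<close>, so \<open>a\<^sup>n g'\<close> and \<open>g' a\<^sup>n\<close> have different normal forms.\<close>

lemma free_generator_centralizer:
  fixes i :: 'i
  defines "a \<equiv> free_generator i"
  assumes comm: "zpow a (int n) + g = g + zpow a (int n)" and n: "n > 0"
  shows "g \<in> range (zpow a)"
proof (rule ccontr)
  assume g: "g \<notin> range (zpow a)"
  define f where "f = (\<lambda>(k, l). zpow a k + g + zpow a l)"
  obtain kl where min: "\<And>kl'. length (normal_form (f kl)) \<le> length (normal_form (f kl'))"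
    using ex_has_least_nat[of "\<lambda>_. True" undefined "\<lambda>kl. length (normal_form (f kl))"] by auto
  obtain k l where kl: "kl = (k, l)" by fastforce
  define g' w where "g' = f kl" and "w = normal_form g'"
  have w: "reduced_word w" "abs_free_group w = g'"
    by (simp_all add: w_def normal_form_reduced abs_normal_form)
  have shift: "zpow a k' + g' + zpow a l' = f (k' + k, l + l')" for k' l'
    by (simp add: g'_def f_def kl zpow_add add.assoc)
  have g'_comm: "zpow a (int n) + g' = g' + zpow a (int n)"
    unfolding g'_def f_def kl
    by simp (metis add.assoc comm zpow_commute)
  have letter: "\<exists>e. abs_free_group [(i, b)] = zpow a e \<and> - abs_free_group [(i, b)] = zpow a (- e)" for b
  proof -
    have "abs_free_group [(i, b)] = zpow a (if b then 1 else - 1)"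
      by (simp add: a_def zpow_uminus free_generator_abs[symmetric] uminus_free_generator_abs[symmetric])
    then show ?thesis
      by (metis zpow_uminus)
  qed
  have "w \<noteq> []"
  proof
    assume "w = []"
    then have "zpow a k + g + zpow a l = 0"
      using w(2) by (simp add: g'_def f_def kl zero_free_group_def)
    then have "g = zpow a (- k) + zpow a (- l)"
      unfolding zpow_uminus by (metis add.assoc add.right_neutral minus_add_cancel minus_unique neg_equal_iff_equal minus_minus eq_neg_iff_add_eq_0)
    with g show False
      by (simp flip: zpow_add)
  qed
  \<comment> \<open>A first letter from generator \<open>i\<close> could be absorbed into the left
    power of \<open>a\<close>, which would give a shorter element of the double coset. The last
    letter is treated likewise on the right.\<close>
  have hd: "fst (hd w) \<noteq> i"
  proof
    assume "fst (hd w) = i"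
    then obtain b u where u: "w = (i, b) # u"
      using \<open>w \<noteq> []\<close> by (metis list.collapse prod.collapse)
    from letter[of b] obtain e where e: "abs_free_group [(i, b)] = zpow a e" by blast
    have "g' = zpow a e + abs_free_group u"
      using w(2) by (simp add: u e[symmetric] plus_free_group.abs_eq)
    then have "abs_free_group u = zpow a (- e) + g' + zpow a 0"
      by (simp add: zpow_uminus add.assoc[symmetric])
    then have "abs_free_group u = f (- e + k, l + 0)"
      by (simp only: shift)
    moreover have "normal_form (abs_free_group u) = u"
      using w(1) by (intro normal_form_abs) (auto simp: u successively_Cons)
    ultimately show False
      using min[of "(- e + k, l + 0)"] by (simp add: u flip: w_def g'_def)
  qed
  have last: "fst (last w) \<noteq> i"
  proof
    assume "fst (last w) = i"
    then obtain b u where u: "w = u @ [(i, b)]"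
      using \<open>w \<noteq> []\<close> by (metis append_butlast_last_id prod.collapse)
    from letter[of b] obtain e where e: "abs_free_group [(i, b)] = zpow a e" by blast
    have "g' = abs_free_group u + zpow a e"
      using w(2) by (simp add: u e[symmetric] plus_free_group.abs_eq)
    then have "abs_free_group u = zpow a 0 + g' + zpow a (- e)"
      by (simp add: zpow_uminus)
    then have "abs_free_group u = f (0 + k, l + - e)"
      by (simp only: shift)
    moreover have "normal_form (abs_free_group u) = u"
      using w(1) by (intro normal_form_abs) (auto simp: u successively_append_iff)
    ultimately show False
      using min[of "(0 + k, l + - e)"] by (simp add: u flip: w_def g'_def)
  qed
  let ?r = "replicate n (i, True)"
  have r: "reduced_word ?r"
    by (induction n) (auto simp: successively_Cons inv_letter_def hd_replicate)
  have "reduced_word (?r @ w)" "reduced_word (w @ ?r)"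
    using r w(1) n hd last by (auto simp: successively_append_iff inv_letter_def)
  then have "?r @ w = normal_form (zpow a (int n) + g')" "w @ ?r = normal_form (g' + zpow a (int n))"
    by (simp_all add: a_def zpow_nat_free_generator w(2)[symmetric] plus_free_group.abs_eq normal_form_abs)
  then have "?r @ w = w @ ?r"
    by (simp add: g'_comm)
  then have "hd (?r @ w) = hd (w @ ?r)"
    by simp
  then have "hd w = (i, True)"
    using n \<open>w \<noteq> []\<close> by (auto simp: hd_append hd_replicate)
  then have "fst (hd w) = i"
    by simp
  with hd show False ..
qed

text \<open>Exponent sums are invariant under conjugation, so a conjugate of a^n that is again a
  power of \<open>a\<close> must be a^n itself. Malnormality thereby reduces to the centralizer of
  a^n.\<close>

lemma malnormal_free_generator: "malnormal_cyclic (free_generator i)"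
  unfolding malnormal_cyclic_def
proof (intro allI impI notI)
  let ?a = "free_generator i"
  fix g n assume g: "g \<notin> range (zpow ?a)" and n: "n \<noteq> 0" and "g + zpow ?a n - g \<in> range (zpow ?a)"
  then obtain m where m: "g + zpow ?a n - g = zpow ?a m" by blast
  have "exponent i (g + zpow ?a n - g) = n"
    by (simp add: diff_conv_add_uminus exponent_plus exponent_uminus exponent_zpow del: add_uminus_conv_diff)
  then have "m = n"
    by (simp add: m exponent_zpow)
  then have comm: "zpow ?a n + g = g + zpow ?a n"
    using m by (metis diff_add_cancel)
  \<comment> \<open>Commutation passes to the inverse, so that the exponent may be taken positive as
    \<open>free_generator_centralizer\<close> requires.\<close>
  have "- zpow ?a n + g = - zpow ?a n + (g + zpow ?a n) + - zpow ?a n"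
    by (simp only: add.assoc[symmetric] add_right_cancel_neg)
  also have "\<dots> = g + - zpow ?a n"
    by (simp only: comm[symmetric] add.assoc[symmetric] left_minus add_0_left)
  finally have "zpow ?a (- n) + g = g + zpow ?a (- n)"
    by (simp only: zpow_uminus)
  with comm have "zpow ?a (int (nat \<bar>n\<bar>)) + g = g + zpow ?a (int (nat \<bar>n\<bar>))"
    by (cases "n \<ge> 0") auto
  then have "g \<in> range (zpow ?a)"
    by (rule free_generator_centralizer) (use n in simp)
  with g show False ..
qed

section \<open>An admissible partial isometry\<close>

lemma self_adjointI: "T \<in> bounded_ops \<Longrightarrow> adj T = T \<Longrightarrow> self_adjoint T"
  for T :: "'a ell2 \<Rightarrow>\<^sub>L 'a ell2"
  by (metis cinner_adj_right self_adjoint_def)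

lemma commute_intertwine_square:
  assumes "P o\<^sub>L X = X o\<^sub>L Q" "Q o\<^sub>L X = X o\<^sub>L P"
  shows "P o\<^sub>L (X o\<^sub>L X) = (X o\<^sub>L X) o\<^sub>L P"
  by (metis assms compose_assoc)

text \<open>The sign commutes with whatever commutes with \<open>X\<close>, in particular with all
  right translations, so it stays in the group algebra.\<close>

lemma group_vna_sign:
  assumes X: "X \<in> group_vna" "self_adjoint X" "norm X \<le> 1" and inj: "\<And>f. X f = 0 \<Longrightarrow> f = 0"
  obtains W where "W \<in> group_vna" "self_adjoint W" "W o\<^sub>L W = id_blinfun"
    "\<And>S T. S o\<^sub>L X = X o\<^sub>L T \<Longrightarrow> T o\<^sub>L (X o\<^sub>L X) = (X o\<^sub>L X) o\<^sub>L T \<Longrightarrow> S o\<^sub>L W = W o\<^sub>L T"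
proof -
  obtain W where W: "self_adjoint W" "W o\<^sub>L W = id_blinfun"
    and intw: "\<And>S T. S o\<^sub>L X = X o\<^sub>L T \<Longrightarrow> T o\<^sub>L (X o\<^sub>L X) = (X o\<^sub>L X) o\<^sub>L T \<Longrightarrow> S o\<^sub>L W = W o\<^sub>L T"
    using sign_exists[OF X(2,3) inj] by metis
  have "W \<in> commutant (range right_regular)"
  proof (rule commutantI)
    fix s :: "'a ell2 \<Rightarrow>\<^sub>L 'a ell2" assume "s \<in> range right_regular"
    then have "s o\<^sub>L X = X o\<^sub>L s"
      using X(1) commutantD unfolding group_vna_eq by metis
    from intw[OF this commute_intertwine_square[OF this this]] show "W o\<^sub>L s = s o\<^sub>L W"
      by (rule HOL.sym)
  qed (rule self_adjoint_bounded_ops[OF W(1)])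
  then show thesis
    using that W intw unfolding group_vna_eq by blast
qed

lemma norm_restrict_op_singleton: "norm (restrict_op {k} f) = cmod (ell2_apply f k)"
proof -
  have "restrict_op {k} f = ell2_apply f k *\<^sub>C point_mass k"
    by (rule ell2_eqI) (simp add: point_mass.rep_eq)
  then show ?thesis
    by (simp add: norm_scaleC)
qed

text \<open>\<open>s\<close> is the sign of \<open>sin \<theta>\<close>, where \<open>a = e\<^sup>i\<^sup>\<theta>\<close>.\<close>

lemma odd_symmetry_exists:
  fixes i :: 'i
  defines "a \<equiv> free_generator i"
  obtains s where "s \<in> subgroup_vna (range (zpow a))" "self_adjoint s" "s o\<^sub>L s = id_blinfun"
    "\<And>h. coeff s h \<noteq> 0 \<Longrightarrow> odd (exponent i h)"
proof -
  let ?H = "range (zpow a)"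
  note H = add_subgroup_zpow[of a]
  \<comment> \<open>The factor \<i> makes the difference of \<open>a\<close> and its inverse
    self-adjoint, and 1/2 makes it a contraction.\<close>
  define X where "X = (\<i> / 2) *\<^sub>C (left_regular a - left_regular (- a))"
  have aH: "a \<in> ?H" "- a \<in> ?H"
    using zpow_one[of a] zpow_uminus[of a 1] by (metis rangeI)+
  have XA: "X \<in> subgroup_vna ?H"
    unfolding X_def by (intro subgroup_vna_scaleC subgroup_vna_diff subgroup_vna_left_regular aH)
  then have XM: "X \<in> group_vna"
    using subgroup_vna_subset by blast
  have "adj X = X"
  proof (rule adj_eqI)
    show "X \<in> bounded_ops" by (rule group_vna_bounded_ops[OF XM])
    have "cinner (left_regular g f) k = cinner f (left_regular (- g) k)" for g :: "'i free_group" and f k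
      using cinner_adj_right[of "left_regular g" f k] by simp
    from this[of a] this[of "- a"] show "cinner (X f) k = cinner f (X k)" for f k
      by (simp add: X_def scaleC_blinfun.rep_eq blinfun.diff_left cinner_scaleC_left cinner_scaleC_right
          cinner_diff_left cinner_diff_right algebra_simps)
  qed
  then have saX: "self_adjoint X"
    by (intro self_adjointI group_vna_bounded_ops[OF XM])
  have nX: "norm X \<le> 1"
  proof (rule norm_blinfun_bound)
    fix f
    have "norm (X f) = (1/2) * norm (left_regular a f - left_regular (- a) f)"
      by (simp add: X_def scaleC_blinfun.rep_eq blinfun.diff_left norm_scaleC norm_divide)
    also have "\<dots> \<le> (1/2) * (norm f + norm f)"
      using norm_triangle_ineq4[of "left_regular a f" "left_regular (- a) f"] by simp
    finally show "norm (X f) \<le> 1 * norm f" by simp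
  qed simp
  \<comment> \<open>A vector in the kernel is invariant under translation by a^2, hence constant on
    infinite sets, which square-summability excludes unless it is 0.\<close>
  have inj: "f = 0" if "X f = 0" for f
  proof (rule ell2_eqI)
    fix h
    have "ell2_apply (X f) (a + k) = 0" for k
      using that by simp
    then have step: "ell2_apply f (a + (a + k)) = ell2_apply f k" for k
      by (simp add: X_def scaleC_blinfun.rep_eq blinfun.diff_left add.assoc[symmetric])
    have const: "ell2_apply f (zpow a (2 * int n) + h) = ell2_apply f h" for n
    proof (induction n)
      case (Suc n)
      have "zpow a (2 * int (Suc n)) = a + (a + zpow a (2 * int n))"
        using zpow_succ[of a "2 * int n"] zpow_succ[of a "2 * int n + 1"]
        by (simp add: add.commute add.left_commute)
      then show ?case
        using step[of "zpow a (2 * int n) + h"] Suc by (simp add: add.assoc)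
    qed simp
    have "zpow a (2 * int m) \<noteq> zpow a (2 * int n)" if "m \<noteq> n" for m n
      using that exponent_zpow[of i "2 * int m"] exponent_zpow[of i "2 * int n"] unfolding a_def by auto
    then have "disjoint_family (\<lambda>n. {zpow a (2 * int n) + h})"
      by (auto simp: disjoint_family_on_def)
    from restrict_op_disjoint_tendsto[OF this, of f]
    have "(\<lambda>n. cmod (ell2_apply f h)) \<longlonglongrightarrow> 0"
      by (simp add: norm_restrict_op_singleton const)
    then show "ell2_apply f h = ell2_apply 0 h"
      by (simp add: LIMSEQ_const_iff)
  qed
  obtain s where s: "s \<in> group_vna" "self_adjoint s" "s o\<^sub>L s = id_blinfun"
    and intw: "\<And>S T. S o\<^sub>L X = X o\<^sub>L T \<Longrightarrow> T o\<^sub>L (X o\<^sub>L X) = (X o\<^sub>L X) o\<^sub>L T \<Longrightarrow> S o\<^sub>L s = s o\<^sub>L T"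
    using group_vna_sign[OF XM saX nX inj] by metis
  have "restrict_op ?H o\<^sub>L X = X o\<^sub>L restrict_op ?H"
    by (rule blinfun_eqI) (simp add: subgroup_vna_restrict_subgroup[OF H XA])
  from intw[OF this commute_intertwine_square[OF this this]]
  have "restrict_op ?H (s (point_mass 0)) = s (restrict_op ?H (point_mass 0))"
    by (metis blinfun_apply_blinfun_compose)
  then have sA: "s \<in> subgroup_vna ?H"
    using s(1) by (simp add: subgroup_vna_iff restrict_op_point_mass add_subgroupD[OF H] del: image_iff)
  \<comment> \<open>\<open>X\<close> exchanges even and odd exponent sums. Its sign inherits this,
    and 0 has even exponent, so the coefficients of \<open>s\<close> sit on odd elements.\<close>
  define P Q where "P = restrict_op {h. odd (exponent i h)}" and "Q = restrict_op {h. even (exponent i h)}"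
  have coeffX: "odd (exponent i k)" if "coeff X k \<noteq> 0" for k
  proof -
    have "k = a \<or> k = - a"
      using that by (auto simp: X_def scaleC_blinfun.rep_eq blinfun.diff_left left_regular_point_mass point_mass.rep_eq
          simp del: left_regular_apply split: if_splits)
    then show ?thesis
      by (auto simp: a_def exponent_uminus exponent_free_generator)
  qed
  have "P o\<^sub>L X = X o\<^sub>L Q" "Q o\<^sub>L X = X o\<^sub>L P"
    unfolding P_def Q_def
    by (rule restrict_op_intertwine[OF XM]; auto dest!: coeffX simp: exponent_plus)+
  then have "P o\<^sub>L s = s o\<^sub>L Q"
    by (intro intw commute_intertwine_square[of Q X P])
  then have "P (s (point_mass 0)) = s (Q (point_mass 0))"
    by (metis blinfun_apply_blinfun_compose)
  also have "Q (point_mass 0) = point_mass 0"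
    by (simp add: Q_def restrict_op_point_mass exponent_zero)
  finally have Ps: "P (s (point_mass 0)) = s (point_mass 0)" .
  have "odd (exponent i h)" if "coeff s h \<noteq> 0" for h
    using arg_cong[OF Ps, of "\<lambda>f. ell2_apply f h"] that by (auto simp: P_def split: if_splits)
  with sA s that show thesis by blast
qed

text \<open>The infinite dihedral group acting on the integers. A reflection is its own inverse,
  which is why the flag is ignored for generator \<open>i\<close>.\<close>

definition dihedral_letter :: "'i \<Rightarrow> 'i \<Rightarrow> 'i \<times> bool \<Rightarrow> int \<Rightarrow> int" where
  "dihedral_letter i j = (\<lambda>(k, b) t. if k = i then - t else if k = j then (if b then t + 1 else t - 1) else t)"

abbreviation dihedral_act :: "'i \<Rightarrow> 'i \<Rightarrow> 'i free_group \<Rightarrow> int \<Rightarrow> int" where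
  "dihedral_act i j \<equiv> free_act (dihedral_letter i j)"

lemma inverse_letters_dihedral: "inverse_letters_on UNIV (dihedral_letter i j)"
  by (auto simp: inverse_letters_on_def dihedral_letter_def)

lemmas dihedral_plus = free_act_plus[OF inverse_letters_dihedral UNIV_I]

lemma dihedral_generators:
  shows "dihedral_act i j (free_generator i) t = - t"
    and "i \<noteq> j \<Longrightarrow> dihedral_act i j (free_generator j) t = t + 1"
    and "i \<noteq> j \<Longrightarrow> dihedral_act i j (- free_generator j) t = t - 1"
  unfolding uminus_free_generator_abs
  unfolding free_generator_abs free_act_abs[OF inverse_letters_dihedral UNIV_I]
  by (auto simp: dihedral_letter_def)

lemma dihedral_zpow:
  "dihedral_act i j (zpow (free_generator i) n) t = (if even n then t else - t)"
proof (induction n rule: int_induct[where k = 0])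
  case base
  show ?case by (simp add: free_act_zero[OF inverse_letters_dihedral])
next
  case (step1 n)
  then show ?case by (simp add: zpow_succ dihedral_plus dihedral_generators)
next
  case (step2 n)
  then show ?case
    using zpow_succ[of "free_generator i" "n - 1"] dihedral_plus[of i j "free_generator i" "zpow (free_generator i) (n - 1)" t]
    by (auto simp: dihedral_generators split: if_splits)
qed

text \<open>With \<open>t = b\<^sup>-\<^sup>1 s b\<close>, the sign \<open>W\<close> of \<open>s - t\<close> satisfies \<open>W s = - t W\<close>, so the unitary \<open>b W\<close> conjugates
  \<open>s\<close> into \<open>- s\<close>, and hence the spectral projection \<open>(1 + s) / 2\<close> into its complement. The kernel of
  \<open>s - t\<close> is trivial because \<open>s\<close> and \<open>t\<close> act on the grading by the orbit of \<open>0 \<in> \<int>\<close> as two reflections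
  whose product is a translation.\<close>

lemma admissible_exists:
  fixes i j :: 'i
  defines "a \<equiv> free_generator i"
  assumes ij: "i \<noteq> j"
  obtains v where "popa_admissible group_vna (subgroup_vna (range (zpow a))) v"
proof -
  let ?H = "range (zpow a)"
  note H = add_subgroup_zpow[of a]
  define b where "b = free_generator j"
  obtain s where sA: "s \<in> subgroup_vna ?H" and sas: "self_adjoint s" and ss: "s o\<^sub>L s = id_blinfun"
    and odd: "\<And>h. coeff s h \<noteq> 0 \<Longrightarrow> odd (exponent i h)"
    using odd_symmetry_exists[of i] unfolding a_def by metis
  have sM: "s \<in> group_vna"
    using sA subgroup_vna_subset by blast
  have s2: "s (s f) = f" for f
    by (metis blinfun_apply_blinfun_compose blinfun_apply_id_blinfun id_apply ss)
  define t where "t = left_regular (- b) o\<^sub>L (s o\<^sub>L left_regular b)"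
  have tM: "t \<in> group_vna"
    unfolding t_def by (intro group_vna_closed sM)
  have bb: "left_regular b (left_regular (- b) f) = f" "left_regular (- b) (left_regular b f) = f" for f
    by (simp_all flip: blinfun_apply_blinfun_compose left_regular_add)
  have t2: "t (t f) = f" for f
    by (simp add: t_def bb s2)
  have sat: "self_adjoint t"
    unfolding self_adjoint_def
  proof (intro allI)
    have "cinner (left_regular g f) k = cinner f (left_regular (- g) k)" for g :: "'i free_group" and f k
      using cinner_adj_right[of "left_regular g" f k] by simp
    from this[of "- b"] this[of b] show "cinner (t f) k = cinner f (t k)" for f k
      by (simp add: t_def self_adjointD[OF sas])
  qed
  have iso: "norm (s f) = norm f" "norm (t f) = norm f" for f
  proof -
    have "(norm (s f))\<^sup>2 = (norm f)\<^sup>2" "(norm (t f))\<^sup>2 = (norm f)\<^sup>2"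
      by (simp_all only: self_adjoint_norm[OF sas] self_adjoint_norm[OF sat] s2 t2 cinner_self Re_complex_of_real)
    then show "norm (s f) = norm f" "norm (t f) = norm f"
      by simp_all
  qed
  \<comment> \<open>The fibres of the orbit map of 0. Odd powers of \<open>a\<close> act as the
    reflection in 0, so \<open>s\<close> carries \<open>C m\<close> to
    \<open>C (- m)\<close>.\<close>
  define C where "C m = {h. dihedral_act i j h 0 = m}" for m
  have sC: "restrict_op (C (- m)) (s f) = s (restrict_op (C m) f)" for m f
  proof -
    have "restrict_op (C (- m)) o\<^sub>L s = s o\<^sub>L restrict_op (C m)"
    proof (rule restrict_op_intertwine[OF sM])
      fix k h assume k: "coeff s k \<noteq> 0"
      then obtain n where n: "k = zpow a n"
        using sA by (auto simp: subgroup_vna_def)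
      then have "odd n"
        using odd[OF k] exponent_zpow[of i n] by (simp add: a_def)
      then show "h \<in> C m \<longleftrightarrow> k + h \<in> C (- m)"
        by (auto simp: C_def n a_def dihedral_plus dihedral_zpow)
    qed
    then show ?thesis by (metis blinfun_apply_blinfun_compose)
  qed
  \<comment> \<open>The three factors of \<open>t\<close> send m to m + 1, then to - m - 1, then to
    - m - 2.\<close>
  have tC: "restrict_op (C (- m - 2)) (t f) = t (restrict_op (C m) f)" for m f
  proof -
    have lC: "restrict_op (C (m + 1)) (left_regular b f) = left_regular b (restrict_op (C m) f)" for m f
      by (rule ell2_eqI) (auto simp: C_def b_def dihedral_plus dihedral_generators ij)
    have lC': "restrict_op (C (m - 1)) (left_regular (- b) f) = left_regular (- b) (restrict_op (C m) f)" for m f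
      by (rule ell2_eqI) (auto simp: C_def b_def dihedral_plus dihedral_generators ij)
    have "- m - 2 = - (m + 1) - 1" by simp
    then show ?thesis
      by (simp only: t_def blinfun_apply_blinfun_compose lC' sC lC)
  qed
  define X where "X = (1/2) *\<^sub>R (s - t)"
  have inj: "f = 0" if "X f = 0" for f
  proof -
    have st: "s f = t f"
      using that by (simp add: X_def blinfun.bilinear_simps)
    \<comment> \<open>The reflections by which \<open>s\<close> and \<open>t\<close> move the
      grading differ by a shift of 2. A vector on which both agree has equal mass on
      \<open>C m\<close> and \<open>C (m + 2)\<close>.\<close>
    have step: "norm (restrict_op (C m) f) = norm (restrict_op (C (m + 2)) f)" for m
    proof -
      have "norm (restrict_op (C (m + 2)) f) = norm (restrict_op (C (- m - 2)) (s f))"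
        using sC[of "m + 2" f] by (simp add: iso)
      also have "\<dots> = norm (restrict_op (C m) f)"
        by (simp add: st tC iso)
      finally show ?thesis by simp
    qed
    have zero: "restrict_op (C m) f = 0" for m
    proof -
      have const: "norm (restrict_op (C (m + 2 * int n)) f) = norm (restrict_op (C m) f)" for n
      proof (induction n)
        case (Suc n)
        then show ?case
          using step[of "m + 2 * int n"] by (simp add: algebra_simps)
      qed simp
      have "disjoint_family (\<lambda>n. C (m + 2 * int n))"
        by (auto simp: disjoint_family_on_def C_def)
      from restrict_op_disjoint_tendsto[OF this, of f] show ?thesis
        by (simp add: const LIMSEQ_const_iff)
    qed
    show ?thesis
    proof (rule ell2_eqI)
      fix h
      show "ell2_apply f h = ell2_apply 0 h"
        using arg_cong[OF zero[of "dihedral_act i j h 0"], of "\<lambda>f. ell2_apply f h"] by (simp add: C_def)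
    qed
  qed
  have XM: "X \<in> group_vna"
  proof -
    have "X = of_real (1/2) *\<^sub>C (s - t)"
      by (rule blinfun_eqI) (simp only: X_def scaleC_blinfun.rep_eq scaleC_of_real blinfun.scaleR_left)
    then show ?thesis
      by (simp only: group_vna_closed sM tM)
  qed
  have saX: "self_adjoint X"
    unfolding X_def by (intro self_adjoint_scaleR self_adjoint_diff sas sat)
  have nX: "norm X \<le> 1"
  proof (rule norm_blinfun_bound)
    show "norm (X f) \<le> 1 * norm f" for f
      using norm_triangle_ineq4[of "s f" "t f"] by (simp add: X_def blinfun.bilinear_simps iso)
  qed simp
  obtain W where W: "W \<in> group_vna" "self_adjoint W" "W o\<^sub>L W = id_blinfun"
    and intw: "\<And>S T. S o\<^sub>L X = X o\<^sub>L T \<Longrightarrow> T o\<^sub>L (X o\<^sub>L X) = (X o\<^sub>L X) o\<^sub>L T \<Longrightarrow> S o\<^sub>L W = W o\<^sub>L T"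
    using group_vna_sign[OF XM saX nX inj] by metis
  have W2: "W (W f) = f" for f
    by (metis W(3) blinfun_apply_blinfun_compose blinfun_apply_id_blinfun id_apply)
  \<comment> \<open>As s^2 = t^2 = 1, both - t (s - t) and (s - t) s equal 1 - t s, while (s - t)^2
    = 2 - s t - t s commutes with s.\<close>
  have "(- t) o\<^sub>L W = W o\<^sub>L s"
    by (rule intw; rule blinfun_eqI)
      (simp_all add: X_def blinfun.bilinear_simps s2 t2 algebra_simps)
  from arg_cong[OF this, of "\<lambda>T. blinfun_apply T f" for f]
  have Ws: "W (s f) = - t (W f)" for f
    by (simp add: blinfun.minus_left)
  define p where "p = (1/2) *\<^sub>R (id_blinfun + s)"
  \<comment> \<open>Conjugation by \<open>W\<close> turns \<open>p\<close> into (1 - t) / 2, and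
    conjugation by \<open>b\<close> turns \<open>t\<close> into \<open>s\<close>. The final
    projection of \<open>v\<close> is therefore 1 - p, which lies in A and is orthogonal to the
    initial projection \<open>p\<close>.\<close>
  define v where "v = left_regular b o\<^sub>L (W o\<^sub>L p)"
  have p_app: "p f = (1/2) *\<^sub>R (f + s f)" for f
    by (simp add: p_def blinfun.bilinear_simps)
  have pA: "p \<in> subgroup_vna ?H"
  proof -
    have "p = of_real (1/2) *\<^sub>C (id_blinfun + s)"
      by (rule blinfun_eqI) (simp only: p_def scaleC_blinfun.rep_eq scaleC_of_real blinfun.scaleR_left)
    then show ?thesis
      by (simp only: subgroup_vna_scaleC subgroup_vna_add subgroup_vna_id[OF H] sA)
  qed
  have pM: "p \<in> group_vna"
    using pA subgroup_vna_subset by blast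
  have sap: "self_adjoint p"
    unfolding p_def by (intro self_adjoint_scaleR self_adjoint_add sas self_adjoint_id)
  have pp: "p (p f) = p f" for f
    by (simp add: p_app blinfun.bilinear_simps s2 scaleR_2[symmetric] algebra_simps)
  have vM: "v \<in> group_vna"
    unfolding v_def by (intro group_vna_closed W pM)
  note bo = group_vna_bounded_ops
  have adjv: "adj v = p o\<^sub>L (W o\<^sub>L left_regular (- b))"
    unfolding v_def
    by (simp add: adj_compose bounded_ops_compose bo W(1) pM self_adjoint_adj sap W(2) compose_assoc)
  have vv: "adj v o\<^sub>L v = p"
    unfolding adjv by (rule blinfun_eqI) (simp add: v_def bb W2 pp)
  have v_v: "v o\<^sub>L adj v = id_blinfun - p"
  proof (rule blinfun_eqI)
    fix f
    have "W (p g) = (1/2) *\<^sub>R (W g - t (W g))" for g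
      by (simp add: p_app blinfun.bilinear_simps Ws)
    then have "(v o\<^sub>L adj v) f = (1/2) *\<^sub>R (left_regular b (left_regular (- b) f) - left_regular b (t (left_regular (- b) f)))"
      unfolding adjv by (simp add: v_def pp W2 blinfun.bilinear_simps)
    also have "\<dots> = f - p f"
      by (simp add: t_def bb p_app algebra_simps) (simp flip: scaleR_add_left)
    finally show "(v o\<^sub>L adj v) f = (id_blinfun - p) f"
      by (simp add: blinfun.diff_left)
  qed
  have "popa_admissible group_vna (subgroup_vna ?H) v"
    unfolding popa_admissible_def partial_isometry_def vv v_v
  proof (intro conjI)
    show "is_projection p"
      unfolding is_projection_def using sap pp
      by (auto intro!: blinfun_eqI self_adjoint_adj self_adjoint_bounded_ops)
    show "v \<noteq> 0"
    proof
      assume "v = 0"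
      then have "p = 0"
        using vv by (simp add: compose_linear)
      then have "ell2_apply (p (point_mass 0)) 0 = 0"
        by simp
      \<comment> \<open>The trace of \<open>s\<close> vanishes because 0 has even exponent, so
        \<open>p\<close> has trace 1/2 and cannot be 0.\<close>
      moreover have "coeff s 0 = 0"
        using odd[of 0] by (auto simp: exponent_zero)
      ultimately show False
        by (simp add: p_app point_mass.rep_eq)
    qed
    show "id_blinfun - p o\<^sub>L p = 0"
      by (rule blinfun_eqI) (simp add: blinfun.diff_left pp)
  qed (use vM pA H in \<open>auto intro: bo subgroup_vna_diff subgroup_vna_id\<close>)
  then show thesis by (rule that)
qed

theorem corollary3p4:
  fixes i :: "'i::countable"
    and M A :: "('i free_group ell2 \<Rightarrow>\<^sub>L 'i free_group ell2) set"
  assumes "infinite (UNIV :: 'i set) \<or> 2 \<le> CARD('i)"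
    and "M = group_vna"
    and "A = generated_vna {left_regular (free_generator i)}"
  shows "strongly_singular_masa group_trace M A \<and> popa_delta group_trace M A = 1"
proof -
  have "\<exists>j. i \<noteq> j"
  proof (rule ccontr)
    assume "\<not> ?thesis"
    then have "UNIV = {i}" by auto
    then have "finite (UNIV :: 'i set)" "CARD('i) = 1"
      by (metis finite.emptyI finite.insertI, metis is_singletonI is_singleton_altdef)
    with assms(1) show False by simp
  qed
  then obtain j where "i \<noteq> j" ..
  from admissible_exists[OF this] obtain v where
    "popa_admissible group_vna (subgroup_vna (range (zpow (free_generator i)))) v"
    by blast
  then show ?thesis
    unfolding assms(2,3) generated_vna_cyclic
    by (intro conjI strongly_singular_zpow popa_delta_zpow malnormal_free_generator)
qed

end
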